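(* Let $\Gamma$ be a discrete subgroup of the group of hyperbolic isometries of the open unit disc $\mathbb{D}$ such that $\mathbb{D}/\Gamma$ is a compact surface. Consider an action of $\Gamma$ by homeomorphisms of $X$, where $X$ is either $S^1$ or $[0,1]$. Then any continuous $\Gamma$-equivariant map from $X$ into $X_0$ takes values in the set of constant functions.
   Context: $\mathbb{D}$ is the open unit disc in $\mathbb{R}^2$ with its hyperbolic metric. $X_0$ denotes the space of all harmonic functions $h:\mathbb{D}\to\mathbb{R}$ with $|h(z)|\le 1$ for all $z\in\mathbb{D}$, with the topology of uniform convergence on compact subsets of $\mathbb{D}$ (a compact metrizable space). $\Gamma$ acts on $X_0$ by $\gamma\cdot h:=h\circ\gamma^{-1}$. A map $F:X\to X_0$ from a $\Gamma$-space $X$ is $\Gamma$-equivariant if $F(\gamma(x))=\gamma\cdot F(x)$ for all $\gamma\in\Gamma$, $x\in X$. *)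

theory Defs
  imports "HOL-Analysis.Analysis" "HOL-Algebra.Group_Action"
begin

abbreviation disc :: "complex set" where
  "disc \<equiv> ball 0 1"

text \<open>The plane is identified with the complex numbers. Functions on the disc are represented
  by extensional functions, so that equality means equality on the disc.\<close>

subsection \<open>Hyperbolic isometries\<close>

text \<open>Distance of the Poincare metric of curvature -1; another normalisation of the metric
  yields the same isometries.\<close>

definition hyp_dist :: "complex \<Rightarrow> complex \<Rightarrow> real" where
  "hyp_dist z w =
     arcosh (1 + 2 * (cmod (z - w))\<^sup>2 / ((1 - (cmod z)\<^sup>2) * (1 - (cmod w)\<^sup>2)))"

text \<open>The full isometry group: orientation-reversing isometries are included. The product is
  composition of functions.\<close>

definition hyp_isometries :: "(complex \<Rightarrow> complex) monoid" where
  "hyp_isometries = (BijGroup disc)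
     \<lparr>carrier := {f \<in> Bij disc. \<forall>z\<in>disc. \<forall>w\<in>disc. hyp_dist (f z) (f w) = hyp_dist z w}\<rparr>"

lemma subgroup_hyp_isometries: "subgroup (carrier hyp_isometries) (BijGroup disc)"
proof (rule group.subgroupI[OF group_BijGroup])
  show "carrier hyp_isometries \<subseteq> carrier (BijGroup disc)"
    by (auto simp: hyp_isometries_def BijGroup_def)
  have "(\<lambda>x\<in>disc. x) \<in> carrier hyp_isometries"
    by (auto simp: hyp_isometries_def id_Bij)
  then show "carrier hyp_isometries \<noteq> {}" by blast
next
  fix f assume f: "f \<in> carrier hyp_isometries"
  then have fB: "f \<in> Bij disc" by (simp add: hyp_isometries_def)
  then have bij: "bij_betw f disc disc" by (simp add: Bij_def)
  have "hyp_dist (inv_into disc f z) (inv_into disc f w) = hyp_dist z w"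
    if "z \<in> disc" "w \<in> disc" for z w
  proof -
    have "inv_into disc f z \<in> disc" "inv_into disc f w \<in> disc"
      using Bij_inv_into_mem[OF fB] that by blast+
    then have "hyp_dist (f (inv_into disc f z)) (f (inv_into disc f w))
        = hyp_dist (inv_into disc f z) (inv_into disc f w)"
      using f by (auto simp: hyp_isometries_def)
    then show ?thesis
      using that bij by (metis bij_betw_inv_into_right)
  qed
  then have "restrict (inv_into disc f) disc \<in> carrier hyp_isometries"
    using restrict_inv_into_Bij[OF fB] by (simp add: hyp_isometries_def)
  then show "inv\<^bsub>BijGroup disc\<^esub> f \<in> carrier hyp_isometries"
    by (simp add: inv_BijGroup[OF fB])
next
  fix f g assume f: "f \<in> carrier hyp_isometries" and g: "g \<in> carrier hyp_isometries"
  then have B: "f \<in> Bij disc" "g \<in> Bij disc" by (auto simp: hyp_isometries_def)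
  have "g z \<in> disc" if "z \<in> disc" for z
    using Bij_imp_funcset[OF B(2)] that by blast
  then have "compose disc f g \<in> carrier hyp_isometries"
    using f g compose_Bij[OF B] by (simp add: hyp_isometries_def compose_eq del: mem_ball)
  then show "f \<otimes>\<^bsub>BijGroup disc\<^esub> g \<in> carrier hyp_isometries"
    using B by (simp add: BijGroup_def)
qed

lemma group_hyp_isometries: "group hyp_isometries"
  using group.subgroup_imp_group[OF group_BijGroup subgroup_hyp_isometries]
  by (simp add: hyp_isometries_def)

subsection \<open>Uniform convergence on compact subsets of the disc\<close>

definition compact_nbhd :: "complex set \<Rightarrow> real \<Rightarrow> (complex \<Rightarrow> 'b::metric_space) \<Rightarrow>
    (complex \<Rightarrow> 'b) set" where
  "compact_nbhd K e f = {g \<in> extensional disc. \<forall>z\<in>K. dist (g z) (f z) < e}"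

definition compact_convergence :: "(complex \<Rightarrow> 'b::metric_space) topology" where
  "compact_convergence = topology (\<lambda>U. U \<subseteq> extensional disc \<and>
     (\<forall>f\<in>U. \<exists>K e. compact K \<and> K \<subseteq> disc \<and> e > 0 \<and> compact_nbhd K e f \<subseteq> U))"

lemma istopology_compact_convergence:
  "istopology (\<lambda>U :: (complex \<Rightarrow> 'b::metric_space) set. U \<subseteq> extensional disc \<and>
     (\<forall>f\<in>U. \<exists>K e. compact K \<and> K \<subseteq> disc \<and> e > 0 \<and> compact_nbhd K e f \<subseteq> U))"
proof -
  define Q :: "(complex \<Rightarrow> 'b) \<Rightarrow> (complex \<Rightarrow> 'b) set \<Rightarrow> bool" where
    "Q f U \<longleftrightarrow> (\<exists>K e. compact K \<and> K \<subseteq> disc \<and> e > 0 \<and> compact_nbhd K e f \<subseteq> U)" for f U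
  have mono: "Q f V" if "Q f U" "U \<subseteq> V" for f U V
    using that unfolding Q_def by (meson order_trans)
  have int: "Q f (U \<inter> V)" if U: "Q f U" and V: "Q f V" for f U V
  proof -
    from U obtain K d where 1: "compact K" "K \<subseteq> disc" "d > 0" "compact_nbhd K d f \<subseteq> U"
      unfolding Q_def by (elim exE conjE)
    from V obtain L e where 2: "compact L" "L \<subseteq> disc" "e > 0" "compact_nbhd L e f \<subseteq> V"
      unfolding Q_def by (elim exE conjE)
    have "compact_nbhd (K \<union> L) (min d e) f \<subseteq> compact_nbhd K d f"
      "compact_nbhd (K \<union> L) (min d e) f \<subseteq> compact_nbhd L e f"
      unfolding compact_nbhd_def by auto
    with 1 2 have "compact_nbhd (K \<union> L) (min d e) f \<subseteq> U \<inter> V"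
      by (meson Int_greatest order_trans)
    moreover have "compact (K \<union> L)" "K \<union> L \<subseteq> disc" "min d e > 0"
      using 1 2 by (simp_all add: compact_Un)
    ultimately show ?thesis unfolding Q_def by (intro exI conjI)
  qed
  have "istopology (\<lambda>U. U \<subseteq> extensional disc \<and> (\<forall>f\<in>U. Q f U))"
    unfolding istopology_def
    by (intro conjI allI impI) (blast intro: int mono[OF _ Union_upper])+
  then show ?thesis by (simp only: Q_def)
qed

lemma openin_compact_convergence:
  "openin compact_convergence U \<longleftrightarrow> U \<subseteq> extensional disc \<and>
     (\<forall>f\<in>U. \<exists>K e. compact K \<and> K \<subseteq> disc \<and> e > 0 \<and> compact_nbhd K e f \<subseteq> U)"
  unfolding compact_convergence_def
  by (simp only: topology_inverse'[OF istopology_compact_convergence])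

lemma topspace_compact_convergence:
  "topspace (compact_convergence :: (complex \<Rightarrow> 'b::metric_space) topology) = extensional disc"
proof (rule subset_antisym)
  show "topspace (compact_convergence :: (complex \<Rightarrow> 'b) topology) \<subseteq> extensional disc"
    by (rule openin_compact_convergence[THEN iffD1, OF openin_topspace, THEN conjunct1])
  have "\<exists>K e. compact K \<and> K \<subseteq> disc \<and> e > 0 \<and> compact_nbhd K e f \<subseteq> extensional disc"
    for f :: "complex \<Rightarrow> 'b"
    by (rule exI[of _ "{}"], rule exI[of _ 1]) (simp add: compact_nbhd_def)
  then have "openin compact_convergence (extensional disc :: (complex \<Rightarrow> 'b) set)"
    unfolding openin_compact_convergence by simp
  then show "extensional disc \<subseteq> topspace (compact_convergence :: (complex \<Rightarrow> 'b) topology)"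
    by (rule openin_subset)
qed

text \<open>On isometries, compact convergence is the usual topology of the isometry group (the
  Euclidean and the hyperbolic metric are equivalent on compact subsets of the disc).\<close>

definition discrete_subgroup :: "(complex \<Rightarrow> complex) set \<Rightarrow> bool" where
  "discrete_subgroup \<Gamma> \<longleftrightarrow> subgroup \<Gamma> hyp_isometries \<and>
     subtopology compact_convergence \<Gamma> = discrete_topology \<Gamma>"

subsection \<open>The quotient of the disc\<close>

abbreviation subgroup_of_isometries :: "(complex \<Rightarrow> complex) set \<Rightarrow> (complex \<Rightarrow> complex) monoid"
  where "subgroup_of_isometries \<Gamma> \<equiv> hyp_isometries\<lparr>carrier := \<Gamma>\<rparr>"

abbreviation disc_orbit :: "(complex \<Rightarrow> complex) set \<Rightarrow> complex \<Rightarrow> complex set" where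
  "disc_orbit \<Gamma> z \<equiv> orbit (subgroup_of_isometries \<Gamma>) (\<lambda>\<gamma>. \<gamma>) z"

definition disc_quotient :: "(complex \<Rightarrow> complex) set \<Rightarrow> complex set topology" where
  "disc_quotient \<Gamma> = topology (\<lambda>U. U \<subseteq> orbits (subgroup_of_isometries \<Gamma>) disc (\<lambda>\<gamma>. \<gamma>) \<and>
     open {z \<in> disc. disc_orbit \<Gamma> z \<in> U})"

lemma openin_disc_quotient:
  "openin (disc_quotient \<Gamma>) U \<longleftrightarrow>
     U \<subseteq> orbits (subgroup_of_isometries \<Gamma>) disc (\<lambda>\<gamma>. \<gamma>) \<and>
     open {z \<in> disc. disc_orbit \<Gamma> z \<in> U}" (is "_ \<longleftrightarrow> ?P U")
proof -
  have "istopology ?P"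
    unfolding istopology_def
  proof (intro conjI allI impI)
    fix S T assume S: "?P S" and T: "?P T"
    have "{z \<in> disc. disc_orbit \<Gamma> z \<in> S \<inter> T}
        = {z \<in> disc. disc_orbit \<Gamma> z \<in> S} \<inter> {z \<in> disc. disc_orbit \<Gamma> z \<in> T}" by blast
    with S T show "open {z \<in> disc. disc_orbit \<Gamma> z \<in> S \<inter> T}" by (simp only: open_Int)
    from S show "S \<inter> T \<subseteq> orbits (subgroup_of_isometries \<Gamma>) disc (\<lambda>\<gamma>. \<gamma>)" by blast
  next
    fix \<K> assume \<K>: "\<forall>S\<in>\<K>. ?P S"
    then show "\<Union>\<K> \<subseteq> orbits (subgroup_of_isometries \<Gamma>) disc (\<lambda>\<gamma>. \<gamma>)" by blast
    have "{z \<in> disc. disc_orbit \<Gamma> z \<in> \<Union>\<K>} = (\<Union>S\<in>\<K>. {z \<in> disc. disc_orbit \<Gamma> z \<in> S})"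
      by blast
    moreover have "open (\<Union>S\<in>\<K>. {z \<in> disc. disc_orbit \<Gamma> z \<in> S})"
      using \<K> by (intro open_UN) blast
    ultimately show "open {z \<in> disc. disc_orbit \<Gamma> z \<in> \<Union>\<K>}" by (simp only:)
  qed
  then show ?thesis
    by (simp add: disc_quotient_def topology_inverse')
qed

lemma topspace_disc_quotient:
  "topspace (disc_quotient \<Gamma>) = orbits (subgroup_of_isometries \<Gamma>) disc (\<lambda>\<gamma>. \<gamma>)"
proof -
  have "{z \<in> disc. disc_orbit \<Gamma> z \<in> orbits (subgroup_of_isometries \<Gamma>) disc (\<lambda>\<gamma>. \<gamma>)} = disc"
    by (auto simp: orbits_def)
  then have "openin (disc_quotient \<Gamma>) (orbits (subgroup_of_isometries \<Gamma>) disc (\<lambda>\<gamma>. \<gamma>))"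
    unfolding openin_disc_quotient by simp
  then have "orbits (subgroup_of_isometries \<Gamma>) disc (\<lambda>\<gamma>. \<gamma>) \<subseteq> topspace (disc_quotient \<Gamma>)"
    by (rule openin_subset)
  moreover have "topspace (disc_quotient \<Gamma>) \<subseteq> orbits (subgroup_of_isometries \<Gamma>) disc (\<lambda>\<gamma>. \<gamma>)"
    by (rule openin_disc_quotient[THEN iffD1, OF openin_topspace, THEN conjunct1])
  ultimately show ?thesis by (intro subset_antisym)
qed

text \<open>A compact 2-manifold without boundary. Second countability is automatic, since a compact
  locally Euclidean space is covered by finitely many charts.\<close>

definition compact_surface :: "'a topology \<Rightarrow> bool" where
  "compact_surface T \<longleftrightarrow> compact_space T \<and> Hausdorff_space T \<and> connected_space T \<and>
     (\<forall>x\<in>topspace T. \<exists>U V. openin T U \<and> x \<in> U \<and> open V \<and>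
        subtopology T U homeomorphic_space top_of_set (V :: complex set))"

subsection \<open>Bounded harmonic functions\<close>

text \<open>The functions hx, hy are the first and hxx, hxy, hyx, hyy the second partial derivatives.\<close>

definition harmonic_on :: "complex set \<Rightarrow> (complex \<Rightarrow> real) \<Rightarrow> bool" where
  "harmonic_on S h \<longleftrightarrow> (\<exists>hx hy hxx hxy hyx hyy.
     (\<forall>z\<in>S. (h has_derivative (\<lambda>v. hx z * Re v + hy z * Im v)) (at z) \<and>
            (hx has_derivative (\<lambda>v. hxx z * Re v + hxy z * Im v)) (at z) \<and>
            (hy has_derivative (\<lambda>v. hyx z * Re v + hyy z * Im v)) (at z) \<and>
            hxx z + hyy z = 0) \<and>
     continuous_on S hxx \<and> continuous_on S hxy \<and> continuous_on S hyx \<and> continuous_on S hyy)"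

definition X0_space :: "(complex \<Rightarrow> real) topology" where
  "X0_space = subtopology compact_convergence
     {h \<in> extensional disc. harmonic_on disc h \<and> (\<forall>z\<in>disc. \<bar>h z\<bar> \<le> 1)}"

definition act_X0 :: "(complex \<Rightarrow> complex) \<Rightarrow> (complex \<Rightarrow> real) \<Rightarrow> (complex \<Rightarrow> real)" where
  "act_X0 \<gamma> h = compose disc h (inv_into disc \<gamma>)"

subsection \<open>Actions by homeomorphisms and equivariant maps\<close>

definition action_by_homeos ::
    "(complex \<Rightarrow> complex) set \<Rightarrow> 'a::topological_space set \<Rightarrow>
     ((complex \<Rightarrow> complex) \<Rightarrow> 'a \<Rightarrow> 'a) \<Rightarrow> bool" where
  "action_by_homeos \<Gamma> X \<phi> \<longleftrightarrow> group_action (subgroup_of_isometries \<Gamma>) X \<phi> \<and>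
     (\<forall>\<gamma>\<in>\<Gamma>. homeomorphic_map (top_of_set X) (top_of_set X) (\<phi> \<gamma>))"

definition equivariant ::
    "(complex \<Rightarrow> complex) set \<Rightarrow> 'a set \<Rightarrow> ((complex \<Rightarrow> complex) \<Rightarrow> 'a \<Rightarrow> 'a) \<Rightarrow>
     ('a \<Rightarrow> complex \<Rightarrow> real) \<Rightarrow> bool" where
  "equivariant \<Gamma> X \<phi> F \<longleftrightarrow> (\<forall>\<gamma>\<in>\<Gamma>. \<forall>x\<in>X. F (\<phi> \<gamma> x) = act_X0 \<gamma> (F x))"

definition constant_functions :: "(complex \<Rightarrow> real) set" where
  "constant_functions = {h. \<exists>c. h = (\<lambda>z\<in>disc. c)}"

end

theory Submission
  imports Defs "HOL-Complex_Analysis.Complex_Analysis"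
begin

text \<open>Write \<open>u x z\<close> for the value of \<open>F x\<close> at \<open>z\<close> and let \<open>N\<close> be the open set of those \<open>x\<close> for which
  \<open>u x\<close> is not constant. By cocompactness and the maximum principle \<open>u\<close> is constant at some point of
  every compact invariant set, so \<open>N\<close> is a union of open intervals (gaps) whose end points carry
  constant functions. The maximum principle also bounds \<open>u\<close> on a gap by the two boundary values.
  These therefore differ, and since \<open>F\<close> is uniformly continuous the orbit of a gap is finite and the
  stabilizer of the gap is again cocompact.

  In a gap, normalised to boundary values 0 and 1, let \<open>s x z\<close> be the maximum of \<open>u y z\<close> over
  \<open>y \<le> x\<close>. It increases in \<open>x\<close>, and being a maximum of harmonic functions it is dominated by its own
  averages in \<open>z\<close>. Reparametrising by the level \<open>t\<close> of \<open>s\<close> at \<open>z\<close> yields monotone transition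
  functions \<open>h z w\<close> of the unit interval with \<open>h z w\<close> and \<open>h w z\<close> inverse to each other. Hence
  the integral of \<open>(h z w t - t)\<^sup>2\<close> is \<open>4/3 - 2 b z w - 2 b w z\<close>, where \<open>b z w\<close> is the
  integral of \<open>t * h z w t\<close>. Average over \<open>z\<close> in the quotient and over \<open>w\<close> with respect to a kernel
  that is symmetric for the hyperbolic area and reproduces harmonic functions. The average of \<open>b\<close> is
  at least 1/3, and because the group is discrete, hence unimodular, it does not change when \<open>z\<close> and \<open>w\<close>
  are exchanged. So \<open>h z w t = t\<close> almost everywhere, and at the point where \<open>u\<close> first exceeds the
  level \<open>t\<close> at \<open>z\<close> the function attains a maximum and is constant, although the point lies in the
  gap.\<close>

subsection \<open>Change of variables in the plane\<close>

text \<open>\<open>X\<close> need not carry a measure invariant under \<open>\<Gamma>\<close>, and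
  \<open>u\<close> need not be monotone in \<open>x\<close>, so there is no direct average over
  \<open>X\<close>. Levels replace points: Lebesgue measure on the unit interval of levels is the
  same for every \<open>z\<close>, and the group acts on pairs \<open>(z, t)\<close> through
  \<open>z\<close> alone. Domination by averages yields only an inequality: \<open>t\<close> is at
  most the mean of \<open>h z w t\<close> over \<open>w\<close>. Multiplied by \<open>t\<close> and
  integrated it gives the bound 1/3 for the mean of \<open>b\<close>. A quadratic quantity makes
  this bound decisive, because inverting \<open>h\<close> exchanges \<open>z\<close> and
  \<open>w\<close>: the unit square measured with density \<open>2 * s\<close> shows that the
  integral of \<open>(h z w t)^2\<close> is \<open>1 - 2 * b w z\<close>. With 1/3 for the integral
  of \<open>t^2\<close> this is where 4/3 comes from, and 4/3 - 2/3 - 2/3 leaves nothing for the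
  mean square deviation. The reduction to gaps supplies the normalisation: a group element reversing
  a gap would exchange its two different boundary values, so the stabilizer acts by increasing maps
  and preserves the running maximum.\<close>

definition vec_of_complex :: "complex \<Rightarrow> real^2" where
  "vec_of_complex z = vector [Re z, Im z]"

definition complex_of_vec :: "real^2 \<Rightarrow> complex" where
  "complex_of_vec x = Complex (x $ 1) (x $ 2)"

lemma complex_of_vec_of_complex [simp]: "complex_of_vec (vec_of_complex z) = z"
  by (simp add: complex_of_vec_def vec_of_complex_def)

lemma vec_of_complex_of_vec [simp]: "vec_of_complex (complex_of_vec x) = x"
  by (simp add: complex_of_vec_def vec_of_complex_def vec_eq_iff forall_2)

lemma bounded_linear_vec_of_complex: "bounded_linear vec_of_complex"
  by (rule linear_conv_bounded_linear[THEN iffD1], rule linearI)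
     (simp_all add: vec_of_complex_def vec_eq_iff forall_2)

lemma bounded_linear_complex_of_vec: "bounded_linear complex_of_vec"
  by (rule linear_conv_bounded_linear[THEN iffD1], rule linearI)
     (simp_all add: complex_of_vec_def complex_eq_iff)

lemma measurable_vec_of_complex [measurable]: "vec_of_complex \<in> borel_measurable borel"
  by (intro borel_measurable_continuous_onI linear_continuous_on bounded_linear_vec_of_complex)

lemma measurable_complex_of_vec [measurable]: "complex_of_vec \<in> borel_measurable borel"
  by (intro borel_measurable_continuous_onI linear_continuous_on bounded_linear_complex_of_vec)

text \<open>Boxes correspond to boxes with the same side lengths, and a measure with the volumes of
  boxes is Lebesgue measure.\<close>

lemma distr_vec_of_complex: "distr lborel borel vec_of_complex = lborel"
proof (rule lborel_eqI[symmetric])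
  fix l u :: "real^2" assume lu: "\<And>b. b \<in> Basis \<Longrightarrow> l \<bullet> b \<le> u \<bullet> b"
  have pre: "vec_of_complex -` box l u = box (complex_of_vec l) (complex_of_vec u)"
    by (auto simp: mem_box_cart forall_2 vec_of_complex_def complex_of_vec_def in_box_complex_iff)
  have b: "l $ i \<le> u $ i" for i
    using lu[of "axis i 1"] by (simp add: inner_axis)
  have "emeasure (distr lborel borel vec_of_complex) (box l u)
      = emeasure lborel (box (complex_of_vec l) (complex_of_vec u))"
    by (subst emeasure_distr) (auto simp: pre)
  also have "\<dots> = ennreal (\<Prod>b\<in>Basis. (complex_of_vec u - complex_of_vec l) \<bullet> b)"
    by (rule emeasure_lborel_box) (auto simp: Basis_complex_def complex_of_vec_def b)
  also have "(\<Prod>b\<in>Basis. (complex_of_vec u - complex_of_vec l) \<bullet> b) = (\<Prod>b\<in>Basis. (u - l) \<bullet> b)"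
    by (simp add: Basis_complex_def complex_of_vec_def Basis_vec_def UNIV_2 inner_axis
        axis_eq_axis)
  finally show "emeasure (distr lborel borel vec_of_complex) (box l u) = (\<Prod>b\<in>Basis. (u - l) \<bullet> b)" .
qed simp

lemma nn_integral_vec_of_complex:
  assumes "g \<in> borel_measurable borel"
  shows "(\<integral>\<^sup>+x. g x \<partial>lborel) = (\<integral>\<^sup>+z. g (vec_of_complex z) \<partial>lborel)"
  by (subst distr_vec_of_complex[symmetric], rule nn_integral_distr) (use assms in auto)

text \<open>The Jacobian formula with determinants is applied on \<open>real^2\<close> and carried
  over. The bounds on \<open>S\<close> and \<open>J\<close> make the integral finite, so that it can
  be read as a real-valued \<open>has_integral\<close>.\<close>

lemma emeasure_differentiable_image_complex:
  fixes f :: "complex \<Rightarrow> complex"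
  assumes S: "S \<in> sets borel" "bounded S" and fS: "f ` S \<in> sets borel" and inj: "inj_on f S"
    and der: "\<And>z. z \<in> S \<Longrightarrow> (f has_derivative L z) (at z)"
    and J: "\<And>z. z \<in> S \<Longrightarrow> J z = \<bar>Re (L z 1) * Im (L z \<i>) - Im (L z 1) * Re (L z \<i>)\<bar>"
    and Jm: "J \<in> borel_measurable borel" and JB: "\<And>z. z \<in> S \<Longrightarrow> J z \<le> B"
  shows "emeasure lborel (f ` S) = (\<integral>\<^sup>+z\<in>S. ennreal (J z) \<partial>lborel)"
proof -
  let ?e = vec_of_complex and ?d = complex_of_vec
  let ?F = "?e \<circ> f \<circ> ?d" and ?F' = "\<lambda>x. ?e \<circ> L (?d x) \<circ> ?d"
  have eS: "?e ` A = ?d -` A" for A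
    by (auto simp: image_iff) (metis vec_of_complex_of_vec)
  have eSm: "?e ` A \<in> sets borel" if "A \<in> sets borel" for A
    using measurable_sets[OF measurable_complex_of_vec that] by (simp add: eS)
  have em: "emeasure lborel (?e ` A) = emeasure lborel A" if A: "A \<in> sets borel" for A
  proof -
    have "emeasure (distr lborel borel ?e) (?e ` A) = emeasure lborel (?e -` (?e ` A))"
      by (subst emeasure_distr) (auto simp: eSm A)
    also have "?e -` (?e ` A) = A" by (auto simp: eS)
    finally show ?thesis by (simp add: distr_vec_of_complex)
  qed
  have derF: "(?F has_derivative ?F' x) (at x within ?e ` S)" if "x \<in> ?e ` S" for x
  proof -
    have 1: "(?d has_derivative ?d) (at x)" and 2: "(?e has_derivative ?e) (at ((f \<circ> ?d) x))"
      by (simp_all add: bounded_linear_complex_of_vec bounded_linear_vec_of_complex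
          bounded_linear_imp_has_derivative)
    have 3: "(f has_derivative L (?d x)) (at (?d x))"
      using der that by (auto simp: eS)
    from diff_chain_at[OF diff_chain_at[OF 1 3] 2]
    have "(?F has_derivative ?F' x) (at x)" by (simp only: comp_assoc)
    then show ?thesis by (rule has_derivative_at_withinI)
  qed
  have det: "\<bar>det (matrix (?F' x))\<bar> = J (?d x)" if "x \<in> ?e ` S" for x
  proof -
    have d: "?d (axis 1 1) = 1" "?d (axis 2 1) = \<i>"
      by (auto simp: complex_of_vec_def axis_def complex_eq_iff)
    have "?d x \<in> S" using that by (simp add: eS)
    from J[OF this] show ?thesis
      by (simp add: matrix_def det_2 d vec_of_complex_def mult.commute)
  qed
  have injF: "inj_on ?F (?e ` S)"
    using inj unfolding inj_on_def
    by (auto simp: eS) (metis complex_of_vec_of_complex vec_of_complex_of_vec)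
  have finS: "emeasure lborel S < \<infinity>"
    by (rule emeasure_bounded_finite[OF S(2)])
  have "(\<integral>\<^sup>+z\<in>S. ennreal (J z) \<partial>lborel) \<le> (\<integral>\<^sup>+z\<in>S. ennreal B \<partial>lborel)"
    by (intro nn_integral_mono) (auto simp: JB ennreal_leI split: split_indicator)
  also have "\<dots> < \<infinity>"
    using finS S by (simp add: nn_integral_cmult_indicator ennreal_mult_less_top)
  finally obtain m where m: "(\<integral>\<^sup>+z\<in>S. ennreal (J z) \<partial>lborel) = ennreal m" "0 \<le> m"
    by (metis ennreal_cases infinity_ennreal_def less_irrefl)
  let ?G = "\<lambda>x. if x \<in> ?e ` S then J (?d x) else 0"
  have [measurable]: "?e ` S \<in> sets borel" by (rule eSm[OF S(1)])
  note Jm[measurable]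
  have Gm: "?G \<in> borel_measurable borel" by measurable
  have "(\<integral>\<^sup>+x. ennreal (?G x) \<partial>lborel) = (\<integral>\<^sup>+z. ennreal (?G (?e z)) \<partial>lborel)"
    by (rule nn_integral_vec_of_complex) (use Gm in measurable)
  also have "\<dots> = (\<integral>\<^sup>+z\<in>S. ennreal (J z) \<partial>lborel)"
    by (intro nn_integral_cong) (auto simp: eS split: split_indicator)
  finally have "(\<integral>\<^sup>+x. ennreal (?G x) \<partial>lborel) = ennreal m" using m by simp
  then have G: "(\<lambda>x. if x \<in> ?e ` S then J (?d x) else 0) \<in> borel_measurable borel \<Longrightarrow> (\<And>x. 0 \<le> ?G x)
      \<Longrightarrow> (?G has_integral m) UNIV"
    using nn_integral_has_integral[of ?G m] m(2) by blast
  have "0 \<le> ?G x" for x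
  proof (cases "x \<in> ?e ` S")
    case True
    then have "?d x \<in> S" by (simp add: eS)
    then show ?thesis using J[of "?d x"] by simp
  qed simp
  then have "(?G has_integral m) UNIV" by (intro G Gm)
  then have "((\<lambda>x. J (?d x)) has_integral m) (?e ` S)"
    by (simp only: has_integral_restrict_UNIV)
  moreover have "((\<lambda>x. J (?d x)) has_integral m) (?e ` S)
      \<longleftrightarrow> ((\<lambda>x. \<bar>det (matrix (?F' x))\<bar>) has_integral m) (?e ` S)"
    by (rule has_integral_cong) (rule det[symmetric])
  ultimately have I: "((\<lambda>x. \<bar>det (matrix (?F' x))\<bar>) has_integral m) (?e ` S)" by blast
  have "?e ` S \<in> sets lebesgue" by simp
  from has_measure_differentiable_image[OF this derF injF, THEN iffD2, OF _ I]
  have *: "?F ` ?e ` S \<in> lmeasurable" "measure lebesgue (?F ` ?e ` S) = m" by blast+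
  have "?d ` ?e ` S = S" by (simp add: image_image)
  then have FS: "?F ` ?e ` S = ?e ` f ` S" by (simp only: image_comp[symmetric])
  have "emeasure lborel (f ` S) = emeasure lborel (?e ` f ` S)"
    by (rule em[OF fS, symmetric])
  also have "\<dots> = emeasure lebesgue (?e ` f ` S)"
    using eSm[OF fS] by simp
  also have "\<dots> = ennreal m"
    using * unfolding FS by (simp add: emeasure_eq_measure2)
  finally show ?thesis by (simp only: m(1))
qed

subsection \<open>Hyperbolic area and isometries\<close>

text \<open>A quarter of the area of the metric of curvature -1. The measure lives on the disc only,
  so statements about its space need no side condition.\<close>

definition hyp_area :: "complex measure" where
  "hyp_area = density (restrict_space lborel disc) (\<lambda>z. ennreal (1 / (1 - (cmod z)\<^sup>2)\<^sup>2))"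

lemma space_hyp_area [simp]: "space hyp_area = disc"
  by (simp add: hyp_area_def space_restrict_space)

lemma sets_hyp_area: "sets hyp_area = sets (restrict_space borel disc)"
  by (simp add: hyp_area_def cong: sets_restrict_space_cong)

lemma measurable_hyp_area_cong: "measurable hyp_area M = measurable (restrict_space borel disc) M"
  by (rule measurable_cong_sets) (simp_all add: sets_hyp_area)

lemma borel_measurable_hyp_area_continuous:
  "continuous_on disc f \<Longrightarrow> f \<in> borel_measurable hyp_area"
  by (simp add: measurable_hyp_area_cong borel_measurable_continuous_on_restrict)

lemma hyp_density_measurable [measurable]:
  "(\<lambda>z. ennreal (1 / (1 - (cmod z)\<^sup>2)\<^sup>2)) \<in> borel_measurable (restrict_space lborel disc)"
  by (intro measurable_restrict_space1) measurable

lemma nn_integral_hyp_area: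
  assumes "g \<in> borel_measurable hyp_area"
  shows "(\<integral>\<^sup>+z. g z \<partial>hyp_area)
    = (\<integral>\<^sup>+z. ennreal (1 / (1 - (cmod z)\<^sup>2)\<^sup>2) * g z \<partial>restrict_space lborel disc)"
  unfolding hyp_area_def
  by (rule nn_integral_density[OF hyp_density_measurable]) (use assms in \<open>simp add: hyp_area_def\<close>)

lemma sq_norm_less_1: "z \<in> disc \<Longrightarrow> (cmod z)\<^sup>2 < 1"
  by (simp add: abs_square_less_1)

definition area_preserving :: "(complex \<Rightarrow> complex) \<Rightarrow> bool" where
  "area_preserving f \<longleftrightarrow> f \<in> measurable hyp_area hyp_area \<and>
     (\<forall>g \<in> borel_measurable hyp_area. (\<integral>\<^sup>+z. g (f z) \<partial>hyp_area) = (\<integral>\<^sup>+z. g z \<partial>hyp_area))"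

lemma measurable_hyp_area_continuous:
  assumes "continuous_on disc f" "f ` disc \<subseteq> disc"
  shows "f \<in> measurable hyp_area hyp_area"
proof -
  have "f \<in> measurable (restrict_space borel disc) (restrict_space borel disc)"
    using assms by (intro measurable_restrict_space2 borel_measurable_continuous_on_restrict)
      (auto simp: space_restrict_space)
  then show ?thesis
    using measurable_cong_sets[OF sets_hyp_area sets_hyp_area] by simp
qed

text \<open>The prescribed Jacobian is the quotient of the density at \<open>z\<close> by the
  density at \<open>f z\<close>, which is what invariance of the density requires. The bound
  \<open>B\<close> keeps the Jacobian integrable.\<close>

lemma area_preservingI:
  assumes fg: "\<And>z. z \<in> disc \<Longrightarrow> f z \<in> disc \<and> g (f z) = z"
    and gf: "\<And>z. z \<in> disc \<Longrightarrow> g z \<in> disc \<and> f (g z) = z"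
    and g: "continuous_on disc g"
    and der: "\<And>z. z \<in> disc \<Longrightarrow> (f has_derivative L z) (at z)"
    and J: "\<And>z. z \<in> disc \<Longrightarrow> \<bar>Re (L z 1) * Im (L z \<i>) - Im (L z 1) * Re (L z \<i>)\<bar>
       = ((1 - (cmod (f z))\<^sup>2) / (1 - (cmod z)\<^sup>2))\<^sup>2"
    and B: "\<And>z. z \<in> disc \<Longrightarrow> (1 - (cmod (f z))\<^sup>2) / (1 - (cmod z)\<^sup>2) \<le> B"
  shows "area_preserving f"
proof -
  \<comment> \<open>Extension by 0 makes the Jacobian a Borel function on the whole plane.\<close>
  define J' where "J' z = (if z \<in> disc then ((1 - (cmod (f z))\<^sup>2) / (1 - (cmod z)\<^sup>2))\<^sup>2 else 0)" for z
  let ?M = "restrict_space lborel disc"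
  have f: "continuous_on disc f"
    by (rule continuous_at_imp_continuous_on) (use der has_derivative_continuous in blast)
  have fM: "f \<in> measurable hyp_area hyp_area"
    by (rule measurable_hyp_area_continuous[OF f]) (use fg in auto)
  have fm: "f \<in> measurable ?M ?M"
    using fM measurable_cong_sets[of hyp_area ?M hyp_area ?M] by (simp add: hyp_area_def)
  have J'm [measurable]: "J' \<in> borel_measurable borel"
    unfolding J'_def
    by (rule borel_measurable_continuous_on_if) 
      (use f sq_norm_less_1 in \<open>auto intro!: continuous_intros simp: less_le simp del: mem_ball\<close>)
  have J'r: "J' \<in> borel_measurable ?M"
    by (intro measurable_restrict_space1) measurable
  have Q: "0 \<le> (1 - (cmod (f z))\<^sup>2) / (1 - (cmod z)\<^sup>2)" if "z \<in> disc" for z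
    using sq_norm_less_1[OF that] sq_norm_less_1[of "f z"] fg[OF that] by (auto intro!: divide_nonneg_nonneg)
  \<comment> \<open>The map \<open>f\<close> carries the preimage \<open>S\<close> of a set
    \<open>A\<close> onto \<open>A\<close>, so the Jacobian formula on \<open>S\<close> computes the
    Lebesgue measure of \<open>A\<close>.\<close>
  have key: "distr (density ?M J') ?M f = ?M"
  proof (rule measure_eqI)
    fix A assume "A \<in> sets (distr (density ?M J') ?M f)"
    then have A: "A \<in> sets borel" "A \<subseteq> disc" by (auto simp: sets_restrict_space_iff)
    define S where "S = {z\<in>disc. f z \<in> A}"
    have S: "S \<in> sets ?M"
      using measurable_sets[OF fm, of A] A by (auto simp: S_def sets_restrict_space_iff space_restrict_space vimage_def Int_def conj_commute)
    then have Sb: "S \<in> sets borel" "S \<subseteq> disc" by (auto simp: sets_restrict_space_iff)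
    have fS: "f ` S = A"
      using A gf fg by (auto simp: S_def image_iff) (metis mem_ball_0 subsetD)
    have "emeasure (distr (density ?M J') ?M f) A = emeasure (density ?M J') S"
      using fm A by (subst emeasure_distr) (auto simp: sets_restrict_space_iff S_def space_restrict_space intro!: arg_cong2[where f=emeasure])
    also have "\<dots> = (\<integral>\<^sup>+z\<in>S. J' z \<partial>?M)"
      using S J'r by (subst emeasure_density) auto
    also have "\<dots> = (\<integral>\<^sup>+z\<in>S. J' z \<partial>lborel)"
      using Sb(2) by (subst nn_integral_restrict_space) (auto intro!: nn_integral_cong split: split_indicator)
    also have "\<dots> = emeasure lborel (f ` S)"
    proof (rule emeasure_differentiable_image_complex[symmetric])
      show "bounded S" using Sb bounded_subset by blast
      show "inj_on f S" using fg Sb by (metis inj_onI subsetD)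
      show "J' z = \<bar>Re (L z 1) * Im (L z \<i>) - Im (L z 1) * Re (L z \<i>)\<bar>" if "z \<in> S" for z
        using that Sb J by (auto simp: J'_def subset_iff)
      show "J' z \<le> B\<^sup>2" if "z \<in> S" for z
        using that Sb B[of z] Q[of z] by (auto simp: J'_def subset_iff intro!: power_mono)
    qed (use Sb A fS der in auto)
    also have "\<dots> = emeasure ?M A"
      using A fS by (simp add: emeasure_restrict_space)
    finally show "emeasure (distr (density ?M J') ?M f) A = emeasure ?M A" .
  qed simp
  have "(\<integral>\<^sup>+z. h (f z) \<partial>hyp_area) = (\<integral>\<^sup>+z. h z \<partial>hyp_area)" if h: "h \<in> borel_measurable hyp_area" for h
  proof -
    let ?d = "\<lambda>z. ennreal (1 / (1 - (cmod z)\<^sup>2)\<^sup>2)"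
    have hm: "h \<in> borel_measurable ?M" using h by (simp add: hyp_area_def)
    have hfm: "(\<lambda>z. ?d (f z) * h (f z)) \<in> borel_measurable ?M"
      by (rule measurable_compose[OF fm]) (use hm in measurable)
    have "(\<integral>\<^sup>+z. h z \<partial>hyp_area) = (\<integral>\<^sup>+z. ?d z * h z \<partial>?M)"
      by (rule nn_integral_hyp_area[OF h])
    also have "\<dots> = (\<integral>\<^sup>+z. ?d z * h z \<partial>distr (density ?M J') ?M f)" by (simp only: key)
    also have "\<dots> = (\<integral>\<^sup>+z. ?d (f z) * h (f z) \<partial>density ?M J')"
      using fm hm by (subst nn_integral_distr) auto
    also have "\<dots> = (\<integral>\<^sup>+z. J' z * (?d (f z) * h (f z)) \<partial>?M)"
      using hfm J'r by (subst nn_integral_density) auto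
    also have "\<dots> = (\<integral>\<^sup>+z. ?d z * h (f z) \<partial>?M)"
    proof (rule nn_integral_cong)
      fix z assume "z \<in> space ?M"
      then have z: "z \<in> disc" by (simp add: space_restrict_space)
      have 1: "1 - (cmod z)\<^sup>2 > 0" "1 - (cmod (f z))\<^sup>2 > 0"
        using sq_norm_less_1 z fg by auto
      have "ennreal (J' z) * ?d (f z) = ?d z"
        using z 1 by (simp add: J'_def ennreal_mult[symmetric] field_simps)
      then show "J' z * (?d (f z) * h (f z)) = ?d z * h (f z)"
        by (simp only: mult.assoc[symmetric])
    qed
    also have "\<dots> = (\<integral>\<^sup>+z. h (f z) \<partial>hyp_area)"
      by (rule nn_integral_hyp_area[symmetric]) (rule measurable_compose[OF fM h])
    finally show ?thesis by simp
  qed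
  then show ?thesis using fM by (simp add: area_preserving_def)
qed

lemma area_preserving_measurable:
  "area_preserving f \<Longrightarrow> f \<in> measurable hyp_area hyp_area"
  by (simp add: area_preserving_def)

lemma area_preserving_nn_integral:
  "area_preserving f \<Longrightarrow> h \<in> borel_measurable hyp_area \<Longrightarrow>
     (\<integral>\<^sup>+z. h (f z) \<partial>hyp_area) = (\<integral>\<^sup>+z. h z \<partial>hyp_area)"
  unfolding area_preserving_def by (elim conjE bspec)

lemma area_preserving_comp:
  assumes f: "area_preserving f" and g: "area_preserving g"
  shows "area_preserving (\<lambda>z. f (g z))"
proof -
  note m = area_preserving_measurable[OF f] area_preserving_measurable[OF g]
  have "(\<integral>\<^sup>+z. h (f (g z)) \<partial>hyp_area) = (\<integral>\<^sup>+z. h z \<partial>hyp_area)"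
    if h: "h \<in> borel_measurable hyp_area" for h
    using area_preserving_nn_integral[OF g measurable_compose[OF m(1) h]]
      area_preserving_nn_integral[OF f h] by (rule trans)
  then show ?thesis
    using measurable_compose[OF m(2,1)] unfolding area_preserving_def by blast
qed

lemma area_preserving_cong:
  assumes "area_preserving f" "\<And>z. z \<in> disc \<Longrightarrow> f z = g z"
  shows "area_preserving g"
proof -
  have "f \<in> measurable hyp_area hyp_area \<longleftrightarrow> g \<in> measurable hyp_area hyp_area"
    by (rule measurable_cong) (use assms(2) in simp)
  moreover have "(\<integral>\<^sup>+z. h (f z) \<partial>hyp_area) = (\<integral>\<^sup>+z. h (g z) \<partial>hyp_area)" for h
    by (rule nn_integral_cong) (use assms(2) in simp)
  ultimately show ?thesis using assms(1) by (simp add: area_preserving_def)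
qed

text \<open>The squared hyperbolic sine of half the hyperbolic distance.\<close>

definition sinh_dist :: "complex \<Rightarrow> complex \<Rightarrow> real" where
  "sinh_dist z w = (cmod (z - w))\<^sup>2 / ((1 - (cmod z)\<^sup>2) * (1 - (cmod w)\<^sup>2))"

section \<open>Moebius transformations of the disc\<close>

definition mobius :: "complex \<Rightarrow> complex \<Rightarrow> complex" where
  "mobius a z = (z + a) / (1 + cnj a * z)"

lemma mobius_denom:
  assumes "a \<in> disc" "z \<in> disc"
  shows "1 + cnj a * z \<noteq> 0"
proof
  assume "1 + cnj a * z = 0"
  then have "cnj a * z = -1" by (simp add: add_eq_0_iff)
  then have "cmod a * cmod z = 1" by (metis complex_mod_cnj norm_minus_cancel norm_mult norm_one)
  moreover have "cmod a * cmod z < 1 * 1" using assms by (intro mult_strict_mono') auto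
  ultimately show False by simp
qed

lemma mobius_norm:
  assumes "a \<in> disc" "z \<in> disc"
  shows "1 - (cmod (mobius a z))\<^sup>2
    = (1 - (cmod a)\<^sup>2) * (1 - (cmod z)\<^sup>2) / (cmod (1 + cnj a * z))\<^sup>2"
proof -
  have "(cmod (1 + cnj a * z))\<^sup>2 - (cmod (z + a))\<^sup>2 = (1 - (cmod a)\<^sup>2) * (1 - (cmod z)\<^sup>2)"
    unfolding cmod_power2 by (simp add: algebra_simps power2_eq_square)
  then show ?thesis
    using mobius_denom[OF assms] unfolding mobius_def norm_divide power_divide
    by (simp add: field_simps)
qed

lemma mobius_in_disc:
  assumes "a \<in> disc" "z \<in> disc"
  shows "mobius a z \<in> disc"
proof -
  have "0 < 1 - (cmod (mobius a z))\<^sup>2"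
    unfolding mobius_norm[OF assms]
    using mobius_denom[OF assms] sq_norm_less_1[OF assms(1)] sq_norm_less_1[OF assms(2)] by simp
  then show ?thesis by (simp add: abs_square_less_1)
qed

lemma mobius_0 [simp]: "mobius a 0 = a" "mobius 0 z = z"
  by (simp_all add: mobius_def)

lemma mobius_diff:
  assumes "a \<in> disc" "z \<in> disc" "w \<in> disc"
  shows "mobius a z - mobius a w
    = complex_of_real (1 - (cmod a)\<^sup>2) * (z - w) / ((1 + cnj a * z) * (1 + cnj a * w))"
proof -
  have "complex_of_real (1 - (cmod a)\<^sup>2) = 1 - cnj a * a"
    by (simp only: of_real_diff of_real_1 complex_norm_square mult.commute)
  then show ?thesis
    using mobius_denom[OF assms(1,2)] mobius_denom[OF assms(1,3)]
    by (simp add: mobius_def divide_simps) (simp add: algebra_simps)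
qed

lemma mobius_inverse:
  assumes "a \<in> disc" "z \<in> disc"
  shows "mobius (- a) (mobius a z) = z"
proof -
  have 1: "1 + cnj a * z \<noteq> 0" by (rule mobius_denom[OF assms])
  have 2: "1 - cnj a * a \<noteq> 0" using mobius_denom[of a "- a"] assms by simp
  have "mobius a z + - a = (1 - cnj a * a) * z / (1 + cnj a * z)"
    using 1 by (simp add: mobius_def field_simps)
  moreover have "1 + cnj (- a) * mobius a z = (1 - cnj a * a) / (1 + cnj a * z)"
    using 1 by (simp add: mobius_def field_simps)
  ultimately show ?thesis
    using 1 2 by (simp add: mobius_def[of "- a"])
qed

lemma mobius_inverse':
  assumes "a \<in> disc" "z \<in> disc"
  shows "mobius a (mobius (- a) z) = z"
  using mobius_inverse[of "- a" z] assms by simp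

text \<open>The factors produced by the difference of the images cancel those produced by the two
  boundary distances.\<close>

lemma sinh_dist_mobius:
  assumes "a \<in> disc" "z \<in> disc" "w \<in> disc"
  shows "sinh_dist (mobius a z) (mobius a w) = sinh_dist z w"
proof -
  have 0: "1 - (cmod a)\<^sup>2 > 0" "1 - (cmod z)\<^sup>2 > 0" "1 - (cmod w)\<^sup>2 > 0"
    using assms sq_norm_less_1 by auto
  have 1: "cmod (1 + cnj a * z) \<noteq> 0" "cmod (1 + cnj a * w) \<noteq> 0"
    using mobius_denom assms by auto
  have 2: "cmod (complex_of_real (1 - (cmod a)\<^sup>2)) = 1 - (cmod a)\<^sup>2"
    using 0 by (simp only: norm_of_real abs_of_pos)
  show ?thesis
    unfolding sinh_dist_def mobius_norm[OF assms(1,2)] mobius_norm[OF assms(1,3)]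
      mobius_diff[OF assms] norm_divide norm_mult 2 power_divide power_mult_distrib
    using 0 1 by (simp add: divide_simps power2_eq_square)
qed

lemma continuous_on_mobius: "a \<in> disc \<Longrightarrow> continuous_on disc (mobius a)"
  unfolding mobius_def using mobius_denom by (intro continuous_intros) blast

lemma mobius_has_field_derivative:
  assumes "a \<in> disc" "z \<in> disc"
  shows "(mobius a has_field_derivative complex_of_real (1 - (cmod a)\<^sup>2) / (1 + cnj a * z)\<^sup>2) (at z)"
proof -
  have *: "complex_of_real (1 - (cmod a)\<^sup>2) = 1 - cnj a * a"
    by (simp only: of_real_diff of_real_1 complex_norm_square mult.commute)
  show ?thesis
    unfolding mobius_def[abs_def] *
    by (rule derivative_eq_intros refl mobius_denom[OF assms])+
       (use mobius_denom[OF assms] in \<open>simp add: field_simps power2_eq_square\<close>)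
qed

lemma holomorphic_on_mobius: "a \<in> disc \<Longrightarrow> mobius a holomorphic_on disc"
  unfolding holomorphic_on_open[OF open_ball] using mobius_has_field_derivative by blast

text \<open>The Jacobian of a holomorphic map is the squared modulus of its derivative, and for
  these maps the modulus is the quotient of \<open>1 - (cmod (mobius a z))^2\<close> by
  \<open>1 - (cmod z)^2\<close>, the equality case of the Schwarz-Pick lemma.\<close>

lemma area_preserving_mobius:
  assumes a: "a \<in> disc"
  shows "area_preserving (mobius a)"
proof (rule area_preservingI)
  have na: "- a \<in> disc" using a by simp
  show "mobius a z \<in> disc \<and> mobius (- a) (mobius a z) = z" if "z \<in> disc" for z
    using mobius_in_disc mobius_inverse a that by blast
  show "mobius (- a) z \<in> disc \<and> mobius a (mobius (- a) z) = z" if "z \<in> disc" for z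
    using mobius_in_disc mobius_inverse' a na that by blast
  show "continuous_on disc (mobius (- a))" by (rule continuous_on_mobius[OF na])
  fix z assume z: "z \<in> disc"
  let ?c = "complex_of_real (1 - (cmod a)\<^sup>2) / (1 + cnj a * z)\<^sup>2"
  have ca: "1 - (cmod a)\<^sup>2 > 0" and cz: "1 - (cmod z)\<^sup>2 > 0"
    using sq_norm_less_1 a z by auto
  show "(mobius a has_derivative (*) ?c) (at z)"
    using mobius_has_field_derivative[OF a z] by (rule has_field_derivative_imp_has_derivative)
  have q: "(1 - (cmod (mobius a z))\<^sup>2) / (1 - (cmod z)\<^sup>2) = cmod ?c"
    using ca cz unfolding mobius_norm[OF a z] norm_divide norm_power norm_of_real
    by simp
  have "\<bar>Re (c * 1) * Im (c * \<i>) - Im (c * 1) * Re (c * \<i>)\<bar> = (cmod c)\<^sup>2" for c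
    using cmod_power2[of c] by (simp add: power2_eq_square)
  then show "\<bar>Re (?c * 1) * Im (?c * \<i>) - Im (?c * 1) * Re (?c * \<i>)\<bar>
      = ((1 - (cmod (mobius a z))\<^sup>2) / (1 - (cmod z)\<^sup>2))\<^sup>2"
    by (simp only: q)
  have "1 - cmod a \<le> cmod (1 + cnj a * z)"
  proof -
    have "cmod a * cmod z \<le> cmod a" using z by (intro mult_left_le) auto
    then have "1 - cmod a \<le> 1 - cmod (- (cnj a * z))" by (simp add: norm_mult)
    also have "\<dots> \<le> cmod (1 - - (cnj a * z))" by (metis norm_one norm_triangle_ineq2)
    finally show ?thesis by simp
  qed
  moreover have "0 < 1 - cmod a" using a by simp
  ultimately have "(1 - cmod a)\<^sup>2 \<le> (cmod (1 + cnj a * z))\<^sup>2" "0 < (1 - cmod a)\<^sup>2"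
    "0 < (cmod (1 + cnj a * z))\<^sup>2"
    by (auto intro!: power_mono)
  then have "cmod ?c \<le> (1 - (cmod a)\<^sup>2) / (1 - cmod a)\<^sup>2"
    using ca unfolding norm_divide norm_power norm_of_real
    by (simp only: abs_of_pos) (intro divide_left_mono mult_pos_pos, auto)
  then show "(1 - (cmod (mobius a z))\<^sup>2) / (1 - (cmod z)\<^sup>2) \<le> (1 - (cmod a)\<^sup>2) / (1 - cmod a)\<^sup>2"
    by (simp only: q)
qed

lemma area_preserving_rotation:
  assumes e: "cmod e = 1"
  shows "area_preserving ((*) e)"
proof (rule area_preservingI[where g = "(*) (cnj e)" and L = "\<lambda>_. (*) e" and B = 1])
  have ee: "e * cnj e = 1" using e by (simp add: complex_norm_square[symmetric])
  show "e * z \<in> disc \<and> cnj e * (e * z) = z" if "z \<in> disc" for z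
    using that ee e by (simp add: norm_mult mult.assoc[symmetric] mult.commute)
  show "cnj e * z \<in> disc \<and> e * (cnj e * z) = z" if "z \<in> disc" for z
    using that ee e by (simp add: norm_mult mult.assoc[symmetric])
  show "((*) e has_derivative (*) e) (at z)" for z by (intro derivative_intros)
  fix z assume "z \<in> disc"
  then have 1: "1 - (cmod z)\<^sup>2 > 0" using sq_norm_less_1 by simp
  have "\<bar>Re e * Re e + Im e * Im e\<bar> = 1" 
    using e cmod_power2[of e] by (simp add: power2_eq_square)
  then show "\<bar>Re (e * 1) * Im (e * \<i>) - Im (e * 1) * Re (e * \<i>)\<bar>
      = ((1 - (cmod (e * z))\<^sup>2) / (1 - (cmod z)\<^sup>2))\<^sup>2"
    using 1 e by (simp add: norm_mult)
  show "(1 - (cmod (e * z))\<^sup>2) / (1 - (cmod z)\<^sup>2) \<le> 1" using 1 e by (simp add: norm_mult)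
qed (intro continuous_intros)

lemma area_preserving_cnj: "area_preserving cnj"
proof (rule area_preservingI[where g = cnj and L = "\<lambda>_. cnj" and B = 1])
  show "(cnj has_derivative cnj) (at z)" for z 
    by (rule bounded_linear_imp_has_derivative[OF bounded_linear_cnj])
  fix z :: complex assume "z \<in> disc"
  then have 1: "1 - (cmod z)\<^sup>2 > 0" using sq_norm_less_1 by simp
  then show "\<bar>Re (cnj 1) * Im (cnj \<i>) - Im (cnj 1) * Re (cnj \<i>)\<bar>
      = ((1 - (cmod (cnj z))\<^sup>2) / (1 - (cmod z)\<^sup>2))\<^sup>2"
    and "(1 - (cmod (cnj z))\<^sup>2) / (1 - (cmod z)\<^sup>2) \<le> 1" by simp_all
qed (auto intro: continuous_intros)

section \<open>Classification of hyperbolic isometries\<close>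

lemma hyp_isometry_in_disc: "f \<in> carrier hyp_isometries \<Longrightarrow> z \<in> disc \<Longrightarrow> f z \<in> disc"
  using Bij_imp_funcset[of f disc] by (auto simp: hyp_isometries_def Pi_iff simp del: mem_ball mem_ball_0)

lemma sinh_dist_nonneg: "z \<in> disc \<Longrightarrow> w \<in> disc \<Longrightarrow> 0 \<le> sinh_dist z w"
  using sq_norm_less_1[of z] sq_norm_less_1[of w] by (simp add: sinh_dist_def less_imp_le)

lemma sinh_dist_commute: "sinh_dist z w = sinh_dist w z"
  by (simp add: sinh_dist_def norm_minus_commute mult.commute)

lemma sinh_dist_isometry:
  assumes f: "f \<in> carrier hyp_isometries" and z: "z \<in> disc" and w: "w \<in> disc"
  shows "sinh_dist (f z) (f w) = sinh_dist z w"
proof -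
  have hd: "cosh (hyp_dist x y) = 1 + 2 * sinh_dist x y" if "x \<in> disc" "y \<in> disc" for x y
    using sinh_dist_nonneg[OF that] by (simp add: hyp_dist_def sinh_dist_def cosh_arcosh_real)
  have "hyp_dist (f z) (f w) = hyp_dist z w"
    using f z w by (auto simp: hyp_isometries_def)
  then show ?thesis
    using hd[OF z w] hd[OF hyp_isometry_in_disc[OF f z] hyp_isometry_in_disc[OF f w]] by simp
qed

lemma sinh_dist_0:
  assumes "z \<in> disc"
  shows "sinh_dist 0 z = 1 / (1 - (cmod z)\<^sup>2) - 1"
  using sq_norm_less_1[OF assms] by (simp add: sinh_dist_def field_simps)

text \<open>Fixing the origin, the identity of pseudodistances reduces to an identity of Euclidean
  distances, so the map is linear.\<close>

lemma sinh_dist_preserving_fixing_0: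
  assumes g: "\<And>z. z \<in> disc \<Longrightarrow> g z \<in> disc" and g0: "g 0 = 0"
    and iso: "\<And>z w. z \<in> disc \<Longrightarrow> w \<in> disc \<Longrightarrow> sinh_dist (g z) (g w) = sinh_dist z w"
  shows "\<exists>e. cmod e = 1 \<and> ((\<forall>z\<in>disc. g z = e * z) \<or> (\<forall>z\<in>disc. g z = e * cnj z))"
proof -
  have n: "cmod (g z) = cmod z" if z: "z \<in> disc" for z
  proof -
    have "sinh_dist 0 (g z) = sinh_dist 0 z" using iso[of 0 z] z g0 by simp
    then have "1 - (cmod (g z))\<^sup>2 = 1 - (cmod z)\<^sup>2"
      using sinh_dist_0 z g by simp
    then show ?thesis by simp
  qed
  have d: "cmod (g z - g w) = cmod (z - w)" if "z \<in> disc" "w \<in> disc" for z w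
  proof -
    have "1 - (cmod z)\<^sup>2 \<noteq> 0" "1 - (cmod w)\<^sup>2 \<noteq> 0" using that sq_norm_less_1 by force+
    then have "(cmod (g z - g w))\<^sup>2 = (cmod (z - w))\<^sup>2"
      using iso[OF that] n that by (simp add: sinh_dist_def)
    then show ?thesis by simp
  qed
  have ip: "Re (g z * cnj (g w)) = Re (z * cnj w)" if "z \<in> disc" "w \<in> disc" for z w
  proof -
    have *: "(cmod (a - b))\<^sup>2 = (cmod a)\<^sup>2 + (cmod b)\<^sup>2 - 2 * Re (a * cnj b)" for a b
      unfolding cmod_power2 by (simp add: algebra_simps power2_eq_square)
    show ?thesis using *[of z w] *[of "g z" "g w"] d[OF that] n that by simp
  qed
  \<comment> \<open>\<open>e\<close> has modulus 1 and is the factor by which a linear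
    \<open>g\<close> would act on the reals. Dividing it out leaves a map \<open>p\<close> that
    fixes 1/2 and hence keeps all real parts.\<close>
  define e where "e = 2 * g (1/2)"
  define p where "p z = g z * cnj e" for z
  have e1: "cmod e = 1" using n[of "1/2"] by (simp add: e_def norm_mult)
  have ee: "e * cnj e = 1" using e1 by (simp add: complex_norm_square[symmetric])
  have gp: "g z = e * p z" for z using ee by (simp add: p_def mult.left_commute)
  have np: "cmod (p z) = cmod z" if "z \<in> disc" for z using e1 n[OF that] by (simp add: p_def norm_mult)
  have ipp: "Re (p z * cnj (p w)) = Re (z * cnj w)" if "z \<in> disc" "w \<in> disc" for z w
  proof -
    have "g z * cnj (g w) = (e * cnj e) * (p z * cnj (p w))"
      by (simp add: gp[of z] gp[of w])
    then show ?thesis using ip[OF that] ee by simp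
  qed
  have rp: "Re (p z) = Re z" if "z \<in> disc" for z
  proof -
    have "p (1/2) = 1/2" using ee by (simp add: p_def e_def)
    then show ?thesis using ipp[OF that, of "1/2", unfolded \<open>p (1/2) = 1/2\<close>] by simp
  qed
  have i: "\<i>/2 \<in> disc" by (simp add: norm_divide)
  have "(Im (p (\<i>/2)))\<^sup>2 = (1/2)\<^sup>2"
  proof -
    have "cmod (p (\<i>/2)) = 1/2" using np[OF i] by (simp add: norm_divide)
    moreover have "Re (p (\<i>/2)) = 0" using rp[OF i] by simp
    moreover have "(Im (p (\<i>/2)))\<^sup>2 = (cmod (p (\<i>/2)))\<^sup>2 - (Re (p (\<i>/2)))\<^sup>2"
      by (simp add: cmod_power2)
    ultimately show ?thesis by (simp only:) simp
  qed
  \<comment> \<open>The sign decides between identity and conjugation, because \<open>p z\<close> is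
    determined by its inner products with the images of 1/2 and of half the imaginary unit.\<close>
  then consider "Im (p (\<i>/2)) = 1/2" | "Im (p (\<i>/2)) = - 1/2"
    by (auto simp: power2_eq_iff)
  then show ?thesis
  proof cases
    case 1
    then have "p (\<i>/2) = \<i>/2" using rp[OF i] by (simp add: complex_eq_iff)
    then have "p z = z" if "z \<in> disc" for z
      using ipp[OF that i, unfolded \<open>p (\<i>/2) = \<i>/2\<close>] rp[OF that] by (simp add: complex_eq_iff)
    then show ?thesis using e1 gp by metis
  next
    case 2
    then have "p (\<i>/2) = - \<i>/2" using rp[OF i] by (simp add: complex_eq_iff)
    then have "p z = cnj z" if "z \<in> disc" for z
      using ipp[OF that i, unfolded \<open>p (\<i>/2) = - \<i>/2\<close>] rp[OF that] by (simp add: complex_eq_iff)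
    then show ?thesis using e1 gp by metis
  qed
qed

text \<open>Moving both \<open>z0\<close> and \<open>f z0\<close> to the origin leaves an isometry
  fixing 0. The base point stays visible because the pair of \<open>f z0\<close> and
  \<open>e\<close> will serve as a compact parameter of \<open>f\<close>.\<close>

lemma hyp_isometry_cases:
  assumes f: "f \<in> carrier hyp_isometries" and z0: "z0 \<in> disc"
  obtains e where "cmod e = 1" "\<And>z. z \<in> disc \<Longrightarrow> f z = mobius (f z0) (e * mobius (- z0) z)"
  | e where "cmod e = 1" "\<And>z. z \<in> disc \<Longrightarrow> f z = mobius (f z0) (e * cnj (mobius (- z0) z))"
proof -
  have d: "- z0 \<in> disc" "f z0 \<in> disc" "- f z0 \<in> disc"
    using z0 hyp_isometry_in_disc[OF f z0] by auto
  define g where "g z = mobius (- f z0) (f (mobius z0 z))" for z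
  have "\<exists>e. cmod e = 1 \<and> ((\<forall>z\<in>disc. g z = e * z) \<or> (\<forall>z\<in>disc. g z = e * cnj z))"
  proof (rule sinh_dist_preserving_fixing_0)
    show "g z \<in> disc" if "z \<in> disc" for z
      unfolding g_def using that d z0 f by (blast intro: mobius_in_disc hyp_isometry_in_disc)
    show "g 0 = 0" by (simp add: g_def mobius_def[of "- f z0"])
    show "sinh_dist (g z) (g w) = sinh_dist z w" if "z \<in> disc" "w \<in> disc" for z w
      using that d z0 f mobius_in_disc hyp_isometry_in_disc
      by (simp add: g_def sinh_dist_mobius sinh_dist_isometry del: mem_ball mem_ball_0)
  qed
  then obtain e where e: "cmod e = 1" "(\<forall>z\<in>disc. g z = e * z) \<or> (\<forall>z\<in>disc. g z = e * cnj z)"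
    by blast
  have fg: "f z = mobius (f z0) (g (mobius (- z0) z))" if "z \<in> disc" for z
    unfolding g_def mobius_inverse'[OF z0 that]
    by (rule mobius_inverse'[OF d(2) hyp_isometry_in_disc[OF f that], symmetric])
  have m: "mobius (- z0) z \<in> disc" if "z \<in> disc" for z by (rule mobius_in_disc[OF d(1) that])
  from e(2) show ?thesis
  proof
    assume *: "\<forall>z\<in>disc. g z = e * z"
    show ?thesis
      by (rule that(1)[OF e(1)]) (use fg *[rule_format, OF m] in simp)
  next
    assume *: "\<forall>z\<in>disc. g z = e * cnj z"
    show ?thesis
      by (rule that(2)[OF e(1)]) (use fg *[rule_format, OF m] in simp)
  qed
qed

lemma area_preserving_isometry:
  assumes f: "f \<in> carrier hyp_isometries"
  shows "area_preserving f"
proof -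
  have d: "f 0 \<in> disc" using hyp_isometry_in_disc[OF f] by simp
  have z0: "0 \<in> disc" by simp
  show ?thesis
  proof (rule hyp_isometry_cases[OF f z0])
    fix e assume e: "cmod e = 1" and fe: "\<And>z. z \<in> disc \<Longrightarrow> f z = mobius (f 0) (e * mobius (- 0) z)"
    show ?thesis
      by (rule area_preserving_cong[OF area_preserving_comp[OF area_preserving_mobius[OF d]
            area_preserving_rotation[OF e]]])
         (rule fe[unfolded minus_zero mobius_0, symmetric])
  next
    fix e assume e: "cmod e = 1"
      and fe: "\<And>z. z \<in> disc \<Longrightarrow> f z = mobius (f 0) (e * cnj (mobius (- 0) z))"
    show ?thesis
      by (rule area_preserving_cong[OF area_preserving_comp[OF area_preserving_mobius[OF d]
            area_preserving_comp[OF area_preserving_rotation[OF e] area_preserving_cnj]]])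
         (rule fe[unfolded minus_zero mobius_0, symmetric])
  qed
qed

lemma continuous_on_isometry:
  assumes f: "f \<in> carrier hyp_isometries"
  shows "continuous_on disc f"
proof -
  have d: "f 0 \<in> disc" using hyp_isometry_in_disc[OF f] by simp
  have z0: "0 \<in> disc" by simp
  have m: "continuous_on disc (\<lambda>z. mobius (f 0) (g z))"
    if "continuous_on disc g" "\<And>z. z \<in> disc \<Longrightarrow> g z \<in> disc" for g
    by (rule continuous_on_compose2[OF continuous_on_mobius[OF d] that(1)]) (use that(2) in blast)
  show ?thesis
  proof (rule hyp_isometry_cases[OF f z0])
    fix e assume e: "cmod e = 1" and fe: "\<And>z. z \<in> disc \<Longrightarrow> f z = mobius (f 0) (e * mobius (- 0) z)"
    have "continuous_on disc (\<lambda>z. mobius (f 0) (e * z))"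
      by (rule m) (use e in \<open>auto intro!: continuous_intros simp: norm_mult\<close>)
    then show ?thesis
      by (rule continuous_on_eq) (rule fe[unfolded minus_zero mobius_0, symmetric])
  next
    fix e assume e: "cmod e = 1"
      and fe: "\<And>z. z \<in> disc \<Longrightarrow> f z = mobius (f 0) (e * cnj (mobius (- 0) z))"
    have "continuous_on disc (\<lambda>z. mobius (f 0) (e * cnj z))"
      by (rule m) (use e in \<open>auto intro!: continuous_intros simp: norm_mult\<close>)
    then show ?thesis
      by (rule continuous_on_eq) (rule fe[unfolded minus_zero mobius_0, symmetric])
  qed
qed

subsection \<open>The mean value property\<close>

lemma measurable_continuous_on_compose:
  fixes f :: "'a::topological_space \<Rightarrow> 'b::topological_space"
  assumes "continuous_on S f" "g \<in> borel_measurable M" "\<And>x. x \<in> space M \<Longrightarrow> g x \<in> S"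
  shows "(\<lambda>x. f (g x)) \<in> borel_measurable M"
  using measurable_compose[OF measurable_restrict_space2[of g M S borel]
      borel_measurable_continuous_on_restrict[OF assms(1)]] assms(2,3) by blast

lemma id_measurable_hyp_area [measurable]: "(\<lambda>z. z) \<in> borel_measurable hyp_area"
  by (rule borel_measurable_hyp_area_continuous) (rule continuous_on_id)

lemma sigma_finite_hyp_area: "sigma_finite_measure hyp_area"
proof -
  have "finite_measure (restrict_space lborel disc)"
    using emeasure_bounded_finite[OF bounded_ball, of "0::complex" 1]
    by (intro finite_measureI) (simp add: emeasure_restrict_space space_restrict_space)
  then interpret finite_measure "restrict_space lborel disc" .
  show ?thesis
    unfolding hyp_area_def
    by (subst sigma_finite_iff_density_finite'[OF hyp_density_measurable]) simp
qed

interpretation hyp: sigma_finite_measure hyp_area by (rule sigma_finite_hyp_area)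

text \<open>The kernel of the Berezin transform: at the origin its product with the hyperbolic area is the
  Lebesgue measure of the disc.\<close>

definition berezin :: "complex \<Rightarrow> complex \<Rightarrow> ennreal" where
  "berezin z w = ennreal (1 / (1 + sinh_dist z w)\<^sup>2)"

lemma berezin_commute: "berezin z w = berezin w z"
  by (simp add: berezin_def sinh_dist_commute)

lemma berezin_isometry:
  "f \<in> carrier hyp_isometries \<Longrightarrow> z \<in> disc \<Longrightarrow> w \<in> disc \<Longrightarrow> berezin (f z) (f w) = berezin z w"
  by (simp add: berezin_def sinh_dist_isometry del: mem_ball mem_ball_0)

lemma continuous_on_sinh_dist: "continuous_on (disc \<times> disc) (\<lambda>(z, w). sinh_dist z w)"
  unfolding sinh_dist_def case_prod_beta
  by (intro continuous_intros) (use sq_norm_less_1 in force)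

lemma pair_id_measurable_hyp_area [measurable]:
  "(\<lambda>p. p) \<in> borel_measurable (hyp_area \<Otimes>\<^sub>M hyp_area)"
proof -
  have "(\<lambda>p. (fst p, snd p)) \<in> borel_measurable (hyp_area \<Otimes>\<^sub>M hyp_area)"
    by (intro borel_measurable_Pair measurable_compose[OF measurable_fst id_measurable_hyp_area]
        measurable_compose[OF measurable_snd id_measurable_hyp_area])
  then show ?thesis by simp
qed

lemma berezin_measurable [measurable]:
  "(\<lambda>(z, w). berezin z w) \<in> borel_measurable (hyp_area \<Otimes>\<^sub>M hyp_area)"
proof -
  have "(\<lambda>p. case p of (z, w) \<Rightarrow> sinh_dist z w) \<in> borel_measurable (hyp_area \<Otimes>\<^sub>M hyp_area)"
    by (rule measurable_continuous_on_compose[OF continuous_on_sinh_dist pair_id_measurable_hyp_area])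
       (auto simp: space_pair_measure simp del: mem_ball mem_ball_0)
  then show ?thesis unfolding berezin_def case_prod_beta by measurable
qed

lemma berezin_measurable' [measurable]:
  "z \<in> disc \<Longrightarrow> berezin z \<in> borel_measurable hyp_area"
  using measurable_compose[OF measurable_Pair1' berezin_measurable] by simp

lemma berezin_0:
  assumes "w \<in> disc"
  shows "berezin 0 w = ennreal ((1 - (cmod w)\<^sup>2)\<^sup>2)"
  using sinh_dist_0[OF assms] by (simp add: berezin_def power_divide)

text \<open>The kernel cancels the density, leaving the Euclidean area of the disc. This is the
  factor \<open>pi\<close> in all later mean values.\<close>

lemma nn_integral_berezin_0: "(\<integral>\<^sup>+w. berezin 0 w \<partial>hyp_area) = ennreal pi"
proof -
  have "(\<integral>\<^sup>+w. berezin 0 w \<partial>hyp_area)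
      = (\<integral>\<^sup>+w. ennreal (1 / (1 - (cmod w)\<^sup>2)\<^sup>2) * berezin 0 w \<partial>restrict_space lborel disc)"
    by (rule nn_integral_hyp_area) simp
  also have "\<dots> = (\<integral>\<^sup>+w. 1 \<partial>restrict_space lborel disc)"
  proof (rule nn_integral_cong)
    fix w assume "w \<in> space (restrict_space lborel disc)"
    then have w: "w \<in> disc" by (simp add: space_restrict_space)
    then have "1 - (cmod w)\<^sup>2 \<noteq> 0" using sq_norm_less_1 by force
    then show "ennreal (1 / (1 - (cmod w)\<^sup>2)\<^sup>2) * berezin 0 w = 1"
      by (simp add: berezin_0[OF w] ennreal_mult[symmetric])
  qed
  also have "\<dots> = emeasure lborel disc"
    by (simp add: emeasure_restrict_space space_restrict_space)
  also have "\<dots> = ennreal pi"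
    by (simp add: emeasure_ball unit_ball_vol_2)
  finally show ?thesis .
qed

section \<open>Harmonic functions as real parts of holomorphic functions\<close>

lemma has_real_derivative_horizontal:
  assumes "(h has_derivative (\<lambda>v. A * Re v + B * Im v)) (at (p + of_real t))"
  shows "((\<lambda>t. h (p + of_real t)) has_real_derivative A) (at t)"
proof -
  have "((\<lambda>t. p + complex_of_real t) has_derivative complex_of_real) (at t)"
    by (auto intro!: derivative_eq_intros)
  from diff_chain_at[OF this assms] show ?thesis
    by (simp add: has_field_derivative_def o_def mult.commute[of A] mult_commute_abs)
qed

lemma has_real_derivative_vertical:
  assumes "(h has_derivative (\<lambda>v. A * Re v + B * Im v)) (at (p + \<i> * of_real t))"
  shows "((\<lambda>t. h (p + \<i> * of_real t)) has_real_derivative B) (at t)"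
proof -
  have "((\<lambda>t. p + \<i> * complex_of_real t) has_derivative (\<lambda>t. \<i> * complex_of_real t)) (at t)"
    by (auto intro!: derivative_eq_intros)
  from diff_chain_at[OF this assms] show ?thesis
    by (simp add: has_field_derivative_def o_def mult_commute_abs)
qed

text \<open>Two applications of the mean value theorem to the second difference over a square of
  side \<open>s\<close>, first horizontally, then vertically.\<close>

lemma mixed_difference_quotient:
  fixes h hx hxy :: "complex \<Rightarrow> real"
  assumes s: "s > 0"
    and h: "\<And>z. dist z0 z < 3 * s \<Longrightarrow> (h has_derivative (\<lambda>v. hx z * Re v + hy z * Im v)) (at z)"
    and hx: "\<And>z. dist z0 z < 3 * s \<Longrightarrow> (hx has_derivative (\<lambda>v. hxx z * Re v + hxy z * Im v)) (at z)"
  shows "\<exists>p. dist z0 p < 3 * s \<and>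
    h (z0 + of_real s + \<i> * of_real s) - h (z0 + of_real s) - h (z0 + \<i> * of_real s) + h z0 = s\<^sup>2 * hxy p"
proof -
  \<comment> \<open>Points of the square are at distance at most \<open>2 * s\<close> from its
    corner; \<open>3 * s\<close> gives a strict bound.\<close>
  have near: "dist z0 (z0 + of_real a + \<i> * of_real b) < 3 * s" if "0 \<le> a" "a \<le> s" "0 \<le> b" "b \<le> s" for a b
  proof -
    have "cmod (of_real a + \<i> * of_real b) \<le> cmod (of_real a) + cmod (\<i> * of_real b)"
      by (rule norm_triangle_ineq)
    then have "cmod (of_real a + \<i> * of_real b) < 3 * s" using that s by (simp add: norm_mult)
    then show ?thesis by (simp add: dist_norm norm_minus_commute add.assoc del: of_real_add)
        (metis add_uminus_conv_diff minus_add_distrib norm_minus_cancel)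
  qed
  let ?f = "\<lambda>t. h (z0 + \<i> * of_real s + of_real t) - h (z0 + of_real t)"
  have "\<exists>t>0. t < s \<and> ?f s - ?f 0
      = (s - 0) * (hx (z0 + \<i> * of_real s + of_real t) - hx (z0 + of_real t))"
  proof (rule MVT2[OF s])
    fix t assume t: "0 \<le> t" "t \<le> s"
    have "dist z0 (z0 + \<i> * of_real s + of_real t) < 3 * s" "dist z0 (z0 + of_real t) < 3 * s"
      using near[of t s] near[of t 0] t s by (simp_all add: algebra_simps)
    from h[OF this(1)] h[OF this(2)]
    show "(?f has_real_derivative hx (z0 + \<i> * of_real s + of_real t) - hx (z0 + of_real t)) (at t)"
      by (intro DERIV_diff has_real_derivative_horizontal)
  qed
  then obtain t where t: "0 < t" "t < s" "?f s - ?f 0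
      = s * (hx (z0 + \<i> * of_real s + of_real t) - hx (z0 + of_real t))" by auto
  have "\<exists>r>0. r < s \<and> hx (z0 + of_real t + \<i> * of_real s) - hx (z0 + of_real t + \<i> * of_real 0)
      = (s - 0) * hxy (z0 + of_real t + \<i> * of_real r)"
  proof (rule MVT2[OF s])
    fix r assume r: "0 \<le> r" "r \<le> s"
    have "dist z0 (z0 + of_real t + \<i> * of_real r) < 3 * s" by (rule near) (use t r in auto)
    from hx[OF this] show "((\<lambda>r. hx (z0 + of_real t + \<i> * of_real r)) has_real_derivative
        hxy (z0 + of_real t + \<i> * of_real r)) (at r)"
      by (rule has_real_derivative_vertical)
  qed
  then obtain r where r: "0 < r" "r < s" "hx (z0 + of_real t + \<i> * of_real s) - hx (z0 + of_real t)
      = s * hxy (z0 + of_real t + \<i> * of_real r)" by auto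
  have "?f s - ?f 0 = s\<^sup>2 * hxy (z0 + of_real t + \<i> * of_real r)"
    using t(3) r(3) by (simp add: power2_eq_square add_ac)
  then show ?thesis
    using near[of t r] t r by (intro exI[of _ "z0 + of_real t + \<i> * of_real r"]) (auto simp: algebra_simps)
qed

text \<open>Schwarz's theorem. \<open>harmonic_on\<close> provides continuous second partial
  derivatives without their symmetry, and the symmetry is one of the Cauchy-Riemann equations for
  the gradient.\<close>

lemma mixed_partials_eq:
  fixes h hx hy hxy hyx :: "complex \<Rightarrow> real"
  assumes S: "open S" "z0 \<in> S"
    and h: "\<And>z. z \<in> S \<Longrightarrow> (h has_derivative (\<lambda>v. hx z * Re v + hy z * Im v)) (at z)"
    and hx: "\<And>z. z \<in> S \<Longrightarrow> (hx has_derivative (\<lambda>v. hxx z * Re v + hxy z * Im v)) (at z)"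
    and hy: "\<And>z. z \<in> S \<Longrightarrow> (hy has_derivative (\<lambda>v. hyx z * Re v + hyy z * Im v)) (at z)"
    and cont: "continuous_on S hxy" "continuous_on S hyx"
  shows "hxy z0 = hyx z0"
proof (rule ccontr)
  assume ne: "hxy z0 \<noteq> hyx z0"
  \<comment> \<open>Both second partials take a common value near \<open>z0\<close>, so with this
    \<open>e\<close> the values at \<open>z0\<close> would differ by less than their
    difference.\<close>
  define e where "e = \<bar>hxy z0 - hyx z0\<bar> / 2"
  have e: "e > 0" using ne by (simp add: e_def)
  have "isCont hxy z0" "isCont hyx z0"
    using cont S continuous_on_eq_continuous_at by blast+
  note c = this[unfolded continuous_at_eps_delta, rule_format, OF e]
  obtain d1 where d1: "d1 > 0" "\<And>z. dist z z0 < d1 \<Longrightarrow> dist (hxy z) (hxy z0) < e"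
    using c(1) by blast
  obtain d2 where d2: "d2 > 0" "\<And>z. dist z z0 < d2 \<Longrightarrow> dist (hyx z) (hyx z0) < e"
    using c(2) by blast
  obtain d3 where d3: "d3 > 0" "ball z0 d3 \<subseteq> S" using S openE by blast
  define s where "s = min d1 (min d2 d3) / 3"
  have s: "s > 0" "3 * s \<le> d1" "3 * s \<le> d2" "3 * s \<le> d3" using d1 d2 d3 by (auto simp: s_def)
  have inS: "z \<in> S" if "dist z0 z < 3 * s" for z using that s d3 by auto
  let ?D = "h (z0 + of_real s + \<i> * of_real s) - h (z0 + of_real s) - h (z0 + \<i> * of_real s) + h z0"
  obtain p where p: "dist z0 p < 3 * s" "?D = s\<^sup>2 * hxy p"
    using mixed_difference_quotient[of s z0 h hx hy hxx hxy] s inS h hx by blast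
  text \<open>The reflection in the diagonal exchanges the two partial derivatives.\<close>
  define \<sigma> where "\<sigma> z = \<i> * cnj z" for z
  have \<sigma>: "bounded_linear \<sigma>" "\<sigma> (\<sigma> z) = z" "Re (\<sigma> z) = Im z" "Im (\<sigma> z) = Re z" for z
    unfolding \<sigma>_def
    by (auto intro: bounded_linear_const_mult bounded_linear_compose[OF bounded_linear_mult_right bounded_linear_cnj] simp: complex_eq_iff)
  have d\<sigma>: "dist (\<sigma> z) (\<sigma> w) = dist z w" for z w
  proof -
    have "\<sigma> z - \<sigma> w = \<i> * cnj (z - w)" by (simp add: \<sigma>_def algebra_simps)
    then show ?thesis by (simp add: dist_norm norm_mult del: complex_cnj_diff)
  qed
  have der: "((\<lambda>z. f (\<sigma> z)) has_derivative (\<lambda>v. b * Re v + a * Im v)) (at z)"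
    if "(f has_derivative (\<lambda>v. a * Re v + b * Im v)) (at (\<sigma> z))" for f :: "complex \<Rightarrow> real" and a b z
    using diff_chain_at[OF bounded_linear_imp_has_derivative[OF \<sigma>(1)] that]
    by (simp add: o_def \<sigma> add.commute)
  have in2: "\<sigma> z \<in> S" if "dist (\<sigma> z0) z < 3 * s" for z
    using that d\<sigma>[of "\<sigma> z0" z] \<sigma>(2) inS by simp
  have "\<exists>q. dist (\<sigma> z0) q < 3 * s \<and>
    h (\<sigma> (\<sigma> z0 + of_real s + \<i> * of_real s)) - h (\<sigma> (\<sigma> z0 + of_real s)) - h (\<sigma> (\<sigma> z0 + \<i> * of_real s)) + h (\<sigma> (\<sigma> z0)) = s\<^sup>2 * hyx (\<sigma> q)"
    by (rule mixed_difference_quotient[where hx = "\<lambda>z. hy (\<sigma> z)" and hy = "\<lambda>z. hx (\<sigma> z)"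
          and hxx = "\<lambda>z. hyy (\<sigma> z)"])
       (use s in \<open>auto intro!: der h hy in2\<close>)
  moreover have "\<sigma> (\<sigma> z0 + of_real s + \<i> * of_real s) = z0 + of_real s + \<i> * of_real s"
    "\<sigma> (\<sigma> z0 + of_real s) = z0 + \<i> * of_real s" "\<sigma> (\<sigma> z0 + \<i> * of_real s) = z0 + of_real s"
    by (auto simp: \<sigma>_def complex_eq_iff)
  ultimately obtain q where q: "dist (\<sigma> z0) q < 3 * s" "?D = s\<^sup>2 * hyx (\<sigma> q)"
    using \<sigma>(2) by auto
  have "hxy p = hyx (\<sigma> q)" using p(2) q(2) s(1) by simp
  moreover have "dist (hxy p) (hxy z0) < e" using p s by (intro d1) (simp add: dist_commute)
  moreover have "dist (\<sigma> q) z0 < d2" using q s d\<sigma>[of "\<sigma> q" z0] \<sigma>(2) by (simp add: dist_commute)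
  then have "dist (hyx (\<sigma> q)) (hyx z0) < e" by (rule d2)
  ultimately show False unfolding e_def dist_real_def by (simp add: abs_if split: if_splits)
qed

text \<open>The conjugate gradient \<open>hx - \<i> * hy\<close> is holomorphic, since the
  Cauchy-Riemann equations say that the Laplacian vanishes and that mixed partials agree. Its
  primitive on the convex disc has a real part with the gradient of \<open>h\<close>.\<close>

lemma harmonic_imp_Re_holomorphic:
  assumes "harmonic_on disc h"
  obtains f where "f holomorphic_on disc" "\<And>z. z \<in> disc \<Longrightarrow> h z = Re (f z)"
proof -
  obtain hx hy hxx hxy hyx hyy where
    h: "\<And>z. z \<in> disc \<Longrightarrow> (h has_derivative (\<lambda>v. hx z * Re v + hy z * Im v)) (at z)" and
    hx: "\<And>z. z \<in> disc \<Longrightarrow> (hx has_derivative (\<lambda>v. hxx z * Re v + hxy z * Im v)) (at z)" and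
    hy: "\<And>z. z \<in> disc \<Longrightarrow> (hy has_derivative (\<lambda>v. hyx z * Re v + hyy z * Im v)) (at z)" and
    lap: "\<And>z. z \<in> disc \<Longrightarrow> hxx z + hyy z = 0" and
    cont: "continuous_on disc hxy" "continuous_on disc hyx"
    using assms unfolding harmonic_on_def by blast
  define g where "g z = complex_of_real (hx z) - \<i> * complex_of_real (hy z)" for z
  have dg: "(g has_field_derivative complex_of_real (hxx z) - \<i> * complex_of_real (hxy z)) (at z)"
    if z: "z \<in> disc" for z
  proof -
    have sym: "hyx z = hxy z"
      using mixed_partials_eq[OF open_ball z h hx hy cont] by simp
    have yy: "hyy z = - hxx z" using lap[OF z] by simp
    have "(g has_derivative (\<lambda>v. complex_of_real (hxx z * Re v + hxy z * Im v)
        - \<i> * complex_of_real (hyx z * Re v + hyy z * Im v))) (at z)"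
      unfolding g_def by (intro derivative_intros hx[OF z] hy[OF z])
    moreover have "(\<lambda>v. complex_of_real (hxx z * Re v + hxy z * Im v)
        - \<i> * complex_of_real (hyx z * Re v + hyy z * Im v))
        = (*) (complex_of_real (hxx z) - \<i> * complex_of_real (hxy z))"
      unfolding sym yy by (auto simp: fun_eq_iff complex_eq_iff algebra_simps)
    ultimately show ?thesis by (simp add: has_field_derivative_def)
  qed
  then have "g holomorphic_on disc"
    unfolding holomorphic_on_open[OF open_ball] by blast
  then obtain f where f: "\<And>z. z \<in> disc \<Longrightarrow> (f has_field_derivative g z) (at z)"
    using holomorphic_convex_primitive'[OF convex_ball open_ball] by (metis at_within_open open_ball)
  have "\<exists>c. \<forall>z\<in>disc. h z - Re (f z) = c"
  proof (rule has_derivative_zero_constant[OF convex_ball])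
    fix z assume z: "z \<in> disc"
    have "((\<lambda>z. h z - Re (f z)) has_derivative (\<lambda>v. (hx z * Re v + hy z * Im v) - Re (g z * v))) (at z)"
      by (intro derivative_intros h[OF z] has_field_derivative_imp_has_derivative[OF f[OF z]])
    moreover have "(\<lambda>v. (hx z * Re v + hy z * Im v) - Re (g z * v)) = (\<lambda>v. 0)"
      by (simp add: g_def)
    ultimately show "((\<lambda>z. h z - Re (f z)) has_derivative (\<lambda>v. 0)) (at z within disc)"
      using has_derivative_at_withinI by metis
  qed
  then obtain c where c: "\<And>z. z \<in> disc \<Longrightarrow> h z - Re (f z) = c" by blast
  show ?thesis
  proof
    have "f holomorphic_on disc" unfolding holomorphic_on_open[OF open_ball] using f by blast
    then show "(\<lambda>z. f z + of_real c) holomorphic_on disc" by (intro holomorphic_intros)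
    show "h z = Re (f z + of_real c)" if "z \<in> disc" for z using c[OF that] by simp
  qed
qed

section \<open>Mean values over circles and against the Berezin kernel\<close>

text \<open>Cauchy's formula on the unit circle for the function sending \<open>u\<close> to
  \<open>f (u * w)\<close>; the radius is hidden in \<open>w\<close>.\<close>

lemma circle_mean_holomorphic:
  assumes f: "f holomorphic_on disc" and w: "w \<in> disc"
  shows "((\<lambda>t. f (exp (2 * of_real pi * \<i> * of_real t) * w)) has_integral f 0) {0..1}"
proof -
  let ?e = "\<lambda>t. exp (2 * of_real pi * \<i> * complex_of_real t)"
  have "(\<lambda>u. f (u * w)) holomorphic_on cball 0 1"
  proof (rule holomorphic_on_compose_gen[of "\<lambda>u. u * w" _ f, unfolded o_def])
    show "(\<lambda>u. u * w) ` cball 0 1 \<subseteq> disc"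
    proof (clarify)
      fix u :: complex assume "u \<in> cball 0 1"
      then have "cmod u * cmod w \<le> 1 * cmod w" by (intro mult_right_mono) auto
      then show "u * w \<in> disc" using w by (simp add: norm_mult)
    qed
  qed (use f in \<open>auto intro: holomorphic_intros\<close>)
  from Cauchy_integral_circlepath_simple[OF this, of 0]
  have "((\<lambda>t. f (circlepath 0 1 t * w) / (circlepath 0 1 t - 0) *
      vector_derivative (circlepath 0 1) (at t within {0..1})) has_integral 2 * of_real pi * \<i> * f 0) {0..1}"
    by (simp add: has_contour_integral_def)
  moreover have "f (circlepath 0 1 t * w) / (circlepath 0 1 t - 0) *
      vector_derivative (circlepath 0 1) (at t within {0..1}) = 2 * of_real pi * \<i> * f (?e t * w)"
    if "t \<in> {0..1}" for t
    using that by (simp add: vector_derivative_circlepath01) (simp add: circlepath)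
  ultimately have "((\<lambda>t. 2 * of_real pi * \<i> * f (?e t * w)) has_integral 2 * of_real pi * \<i> * f 0) {0..1}"
    by (rule has_integral_eq[rotated])
  from has_integral_mult_right[OF this, of "1 / (2 * of_real pi * \<i>)"] show ?thesis
    by simp
qed

text \<open>Kernel and area are invariant under rotations, so the integral may be averaged over all
  of them. After exchanging the integrals, the inner one is a circle mean, independent of
  \<open>w\<close>; this replaces polar coordinates.\<close>

lemma mean_value_0:
  assumes f: "f holomorphic_on disc" and pos: "\<And>z. z \<in> disc \<Longrightarrow> 0 \<le> Re (f z)"
  shows "(\<integral>\<^sup>+w. ennreal (Re (f w)) * berezin 0 w \<partial>hyp_area) = ennreal (pi * Re (f 0))"
proof -
  let ?e = "\<lambda>t. exp (2 * of_real pi * \<i> * complex_of_real t)"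
  let ?I = "\<integral>\<^sup>+w. ennreal (Re (f w)) * berezin 0 w \<partial>hyp_area"
  let ?U = "restrict_space lborel {0..1::real}"
  have fc: "continuous_on disc (\<lambda>w. Re (f w))"
    using holomorphic_on_imp_continuous_on[OF f] by (intro continuous_intros)
  have fm [measurable]: "(\<lambda>w. Re (f w)) \<in> borel_measurable hyp_area"
    by (rule borel_measurable_hyp_area_continuous[OF fc])
  have b0 [measurable]: "berezin 0 \<in> borel_measurable hyp_area" by simp
  have ne: "cmod (?e t) = 1" for t by simp
  have rot: "(\<integral>\<^sup>+w. ennreal (Re (f (?e t * w))) * berezin 0 w \<partial>hyp_area) = ?I" for t
  proof -
    have "(\<integral>\<^sup>+w. ennreal (Re (f (?e t * w))) * berezin 0 (?e t * w) \<partial>hyp_area) = ?I"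
      by (rule area_preserving_nn_integral[OF area_preserving_rotation[OF ne],
            of "\<lambda>w. ennreal (Re (f w)) * berezin 0 w"]) measurable
    moreover have "berezin 0 (?e t * w) = berezin 0 w" for w
      by (simp add: berezin_def sinh_dist_def norm_mult)
    ultimately show ?thesis by simp
  qed
  have em: "emeasure ?U (space ?U) = 1"
    by (simp add: emeasure_restrict_space space_restrict_space)
  interpret U: finite_measure ?U by (rule finite_measureI) (simp only: em, simp)
  interpret P: pair_sigma_finite hyp_area ?U ..
  have um [measurable]: "(\<lambda>t. t) \<in> borel_measurable ?U" by (intro measurable_restrict_space1) simp
  have jm: "(\<lambda>(w, t). ennreal (Re (f (?e t * w))) * berezin 0 w) \<in> borel_measurable (hyp_area \<Otimes>\<^sub>M ?U)"
  proof -
    have "(\<lambda>p. Re (f (?e (snd p) * fst p))) \<in> borel_measurable (hyp_area \<Otimes>\<^sub>M ?U)"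
    proof (rule measurable_continuous_on_compose[OF fc])
      show "(\<lambda>p. ?e (snd p) * fst p) \<in> borel_measurable (hyp_area \<Otimes>\<^sub>M ?U)" 
        by measurable
      show "?e (snd p) * fst p \<in> disc" if "p \<in> space (hyp_area \<Otimes>\<^sub>M ?U)" for p
        using that ne by (auto simp: space_pair_measure norm_mult)
    qed
    then show ?thesis unfolding case_prod_beta by measurable
  qed
  have circ: "(\<integral>\<^sup>+t. ennreal (Re (f (?e t * w))) \<partial>?U) = ennreal (Re (f 0))" if w: "w \<in> disc" for w
  proof -
    have in_disc: "?e t * w \<in> disc" for t using w ne by (simp add: norm_mult)
    have "((\<lambda>t. Re (f (?e t * w))) has_integral Re (f 0)) {0..1}"
      using has_integral_linear[OF circle_mean_holomorphic[OF f w] bounded_linear_Re] by (simp add: o_def)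
    note nn_integral_has_integral_lebesgue[OF pos[OF in_disc] this]
    moreover have "(\<integral>\<^sup>+t. ennreal (Re (f (?e t * w))) \<partial>?U)
        = (\<integral>\<^sup>+t. ennreal (indicator {0..1} t * Re (f (?e t * w))) \<partial>lborel)"
      by (subst nn_integral_restrict_space) (auto intro!: nn_integral_cong split: split_indicator)
    ultimately show ?thesis by (rule trans[rotated])
  qed
  have A: "?I = (\<integral>\<^sup>+t. ?I \<partial>?U)" by (simp only: nn_integral_const em mult_1_right)
  have B: "(\<integral>\<^sup>+t. ?I \<partial>?U) = (\<integral>\<^sup>+t. \<integral>\<^sup>+w. ennreal (Re (f (?e t * w))) * berezin 0 w \<partial>hyp_area \<partial>?U)"
    by (simp only: rot)
  have C: "(\<integral>\<^sup>+t. \<integral>\<^sup>+w. ennreal (Re (f (?e t * w))) * berezin 0 w \<partial>hyp_area \<partial>?U) = (\<integral>\<^sup>+w. \<integral>\<^sup>+t. ennreal (Re (f (?e t * w))) * berezin 0 w \<partial>?U \<partial>hyp_area)"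
    by (rule P.Fubini'[OF jm])
  have D0: "(\<integral>\<^sup>+t. ennreal (Re (f (?e t * w))) * berezin 0 w \<partial>?U) = ennreal (Re (f 0)) * berezin 0 w"
    if w: "w \<in> disc" for w
  proof -
    have "(\<lambda>t. Re (f (?e t * w))) \<in> borel_measurable ?U"
      by (rule measurable_continuous_on_compose[OF fc]) (use w ne in \<open>auto simp: norm_mult\<close>)
    then have "(\<lambda>t. ennreal (Re (f (?e t * w)))) \<in> borel_measurable ?U" by simp
    then have "(\<integral>\<^sup>+t. ennreal (Re (f (?e t * w))) * berezin 0 w \<partial>?U)
        = (\<integral>\<^sup>+t. ennreal (Re (f (?e t * w))) \<partial>?U) * berezin 0 w"
      by (rule nn_integral_multc)
    then show ?thesis by (simp only: circ[OF w])
  qed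
  have D: "(\<integral>\<^sup>+w. \<integral>\<^sup>+t. ennreal (Re (f (?e t * w))) * berezin 0 w \<partial>?U \<partial>hyp_area)
    = (\<integral>\<^sup>+w. ennreal (Re (f 0)) * berezin 0 w \<partial>hyp_area)"
    by (rule nn_integral_cong) (rule D0, simp)
  have E: "(\<integral>\<^sup>+w. ennreal (Re (f 0)) * berezin 0 w \<partial>hyp_area) = ennreal (Re (f 0)) * (\<integral>\<^sup>+w. berezin 0 w \<partial>hyp_area)"
    by (rule nn_integral_cmult) measurable
  have "ennreal (Re (f 0)) * (\<integral>\<^sup>+w. berezin 0 w \<partial>hyp_area) = ennreal (pi * Re (f 0))"
    unfolding nn_integral_berezin_0 by (metis ennreal_mult'' mult.commute pi_ge_zero)
  then show ?thesis by (rule trans[OF A trans[OF B trans[OF C trans[OF D trans[OF E]]]]])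
qed

text \<open>The transformation \<open>mobius z\<close> carries the case of the origin to
  \<open>z\<close>. Nonnegativity allows integrals in the extended nonnegative reals, free of
  integrability conditions.\<close>

lemma harmonic_mean_value:
  assumes h: "harmonic_on disc h" and pos: "\<And>z. z \<in> disc \<Longrightarrow> 0 \<le> h z" and z: "z \<in> disc"
  shows "(\<integral>\<^sup>+w. ennreal (h w) * berezin z w \<partial>hyp_area) = ennreal (pi * h z)"
proof -
  obtain f where f: "f holomorphic_on disc" "\<And>z. z \<in> disc \<Longrightarrow> h z = Re (f z)"
    using harmonic_imp_Re_holomorphic[OF h] by blast
  have fm [measurable]: "(\<lambda>w. Re (f w)) \<in> borel_measurable hyp_area"
    by (rule borel_measurable_hyp_area_continuous)
      (intro continuous_intros holomorphic_on_imp_continuous_on[OF f(1)])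
  have bz [measurable]: "berezin z \<in> borel_measurable hyp_area" using z by simp
  note m = mobius_in_disc[OF z]
  have "(\<integral>\<^sup>+w. ennreal (h w) * berezin z w \<partial>hyp_area)
      = (\<integral>\<^sup>+w. ennreal (Re (f w)) * berezin z w \<partial>hyp_area)"
    by (rule nn_integral_cong) (simp add: f(2))
  also have "\<dots> = (\<integral>\<^sup>+w. ennreal (Re (f (mobius z w))) * berezin z (mobius z w) \<partial>hyp_area)"
    by (rule area_preserving_nn_integral[OF area_preserving_mobius[OF z],
            of "\<lambda>w. ennreal (Re (f w)) * berezin z w", symmetric]) measurable
  also have "\<dots> = (\<integral>\<^sup>+w. ennreal (Re ((f \<circ> mobius z) w)) * berezin 0 w \<partial>hyp_area)"
  proof (rule nn_integral_cong)
    fix w assume "w \<in> space hyp_area"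
    then have "sinh_dist z (mobius z w) = sinh_dist 0 w"
      using sinh_dist_mobius[OF z, of 0 w] by simp
    then show "ennreal (Re (f (mobius z w))) * berezin z (mobius z w)
        = ennreal (Re ((f \<circ> mobius z) w)) * berezin 0 w" by (simp add: berezin_def)
  qed
  also have "\<dots> = ennreal (pi * Re ((f \<circ> mobius z) 0))"
  proof (rule mean_value_0)
    show "f \<circ> mobius z holomorphic_on disc"
      by (rule holomorphic_on_compose_gen[OF holomorphic_on_mobius[OF z] f(1)]) (use m in blast)
    show "0 \<le> Re ((f \<circ> mobius z) w)" if "w \<in> disc" for w
      using pos[OF m[OF that]] f(2)[OF m[OF that]] by simp
  qed
  finally show ?thesis using f(2)[OF z] by simp
qed

subsection \<open>Discrete cocompact groups\<close>

locale isometry_group =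
  fixes \<Gamma> :: "(complex \<Rightarrow> complex) set"
  assumes subgroup: "subgroup \<Gamma> hyp_isometries"
begin

abbreviation inverse_elt :: "(complex \<Rightarrow> complex) \<Rightarrow> complex \<Rightarrow> complex" where
  "inverse_elt \<gamma> \<equiv> inv\<^bsub>hyp_isometries\<^esub> \<gamma>"

abbreviation product_elt :: "(complex \<Rightarrow> complex) \<Rightarrow> (complex \<Rightarrow> complex) \<Rightarrow> complex \<Rightarrow> complex" where
  "product_elt \<gamma> \<delta> \<equiv> \<gamma> \<otimes>\<^bsub>hyp_isometries\<^esub> \<delta>"

lemma isometry: "\<gamma> \<in> \<Gamma> \<Longrightarrow> \<gamma> \<in> carrier hyp_isometries"
  using subgroup.subset[OF subgroup] by blast

lemma in_disc: "\<gamma> \<in> \<Gamma> \<Longrightarrow> z \<in> disc \<Longrightarrow> \<gamma> z \<in> disc"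
  using hyp_isometry_in_disc isometry by blast

lemma elt_Bij: "\<gamma> \<in> \<Gamma> \<Longrightarrow> \<gamma> \<in> Bij disc"
  using isometry by (auto simp: hyp_isometries_def)

lemma elt_extensional: "\<gamma> \<in> \<Gamma> \<Longrightarrow> \<gamma> \<in> extensional disc"
  using elt_Bij by (auto simp: Bij_def)

lemma elt_eqI:
  assumes "\<gamma> \<in> \<Gamma>" "\<delta> \<in> \<Gamma>" "\<And>z. z \<in> disc \<Longrightarrow> \<gamma> z = \<delta> z"
  shows "\<gamma> = \<delta>"
  using extensionalityI[OF elt_extensional[OF assms(1)] elt_extensional[OF assms(2)]] assms(3) by blast

lemma product_closed: "\<gamma> \<in> \<Gamma> \<Longrightarrow> \<delta> \<in> \<Gamma> \<Longrightarrow> product_elt \<gamma> \<delta> \<in> \<Gamma>"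
  by (rule subgroup.m_closed[OF subgroup])

lemma product_apply: "\<gamma> \<in> \<Gamma> \<Longrightarrow> \<delta> \<in> \<Gamma> \<Longrightarrow> z \<in> disc \<Longrightarrow> product_elt \<gamma> \<delta> z = \<gamma> (\<delta> z)"
  using elt_Bij[of \<gamma>] elt_Bij[of \<delta>] by (simp add: hyp_isometries_def BijGroup_def compose_eq)

lemma one_closed: "\<one>\<^bsub>hyp_isometries\<^esub> \<in> \<Gamma>"
  by (rule subgroup.one_closed[OF subgroup])

lemma one_apply: "\<one>\<^bsub>hyp_isometries\<^esub> = (\<lambda>z\<in>disc. z)"
  by (simp add: hyp_isometries_def BijGroup_def)

lemma inverse_closed: "\<gamma> \<in> \<Gamma> \<Longrightarrow> inverse_elt \<gamma> \<in> \<Gamma>"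
  by (rule subgroup.m_inv_closed[OF subgroup])

lemma inverse_product:
  assumes "\<gamma> \<in> \<Gamma>"
  shows "product_elt (inverse_elt \<gamma>) \<gamma> = \<one>\<^bsub>hyp_isometries\<^esub>"
    "product_elt \<gamma> (inverse_elt \<gamma>) = \<one>\<^bsub>hyp_isometries\<^esub>"
  using group.l_inv[OF group_hyp_isometries isometry[OF assms]]
    group.r_inv[OF group_hyp_isometries isometry[OF assms]] by blast+

lemma inverse_apply:
  assumes "\<gamma> \<in> \<Gamma>" "z \<in> disc"
  shows "inverse_elt \<gamma> (\<gamma> z) = z" "\<gamma> (inverse_elt \<gamma> z) = z"
proof -
  have "product_elt (inverse_elt \<gamma>) \<gamma> z = z" "product_elt \<gamma> (inverse_elt \<gamma>) z = z"
    using assms(2) by (simp_all add: inverse_product[OF assms(1)] one_apply)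
  then show "inverse_elt \<gamma> (\<gamma> z) = z" "\<gamma> (inverse_elt \<gamma> z) = z"
    by (simp_all add: product_apply[OF inverse_closed[OF assms(1)] assms(1) assms(2)]
        product_apply[OF assms(1) inverse_closed[OF assms(1)] assms(2)])
qed

lemma inverse_inverse: "\<gamma> \<in> \<Gamma> \<Longrightarrow> inverse_elt (inverse_elt \<gamma>) = \<gamma>"
  using group.inv_inv[OF group_hyp_isometries isometry] by blast

lemma area_preserving_elt: "\<gamma> \<in> \<Gamma> \<Longrightarrow> area_preserving \<gamma>"
  using area_preserving_isometry isometry by blast

end

section \<open>Discreteness, local finiteness and cocompactness\<close>

lemma discrete_isolated_identity:
  assumes "discrete_subgroup \<Gamma>"
  obtains K e where "compact K" "K \<subseteq> disc" "e > 0"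
    "\<And>\<gamma>. \<gamma> \<in> \<Gamma> \<Longrightarrow> (\<And>z. z \<in> K \<Longrightarrow> dist (\<gamma> z) z < e) \<Longrightarrow> \<gamma> = \<one>\<^bsub>hyp_isometries\<^esub>"
proof -
  interpret isometry_group \<Gamma>
    using assms by (simp add: discrete_subgroup_def isometry_group_def)
  have "openin (subtopology compact_convergence \<Gamma>) {\<one>\<^bsub>hyp_isometries\<^esub>}"
    using assms one_closed by (simp add: discrete_subgroup_def)
  then obtain U where U: "openin compact_convergence U" "{\<one>\<^bsub>hyp_isometries\<^esub>} = U \<inter> \<Gamma>"
    by (auto simp: openin_subtopology)
  then have "\<one>\<^bsub>hyp_isometries\<^esub> \<in> U" by blast
  then obtain K e where K: "compact K" "K \<subseteq> disc" "e > 0" "compact_nbhd K e \<one>\<^bsub>hyp_isometries\<^esub> \<subseteq> U"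
    using U(1) unfolding openin_compact_convergence by blast
  show ?thesis
  proof (rule that[OF K(1-3)])
    fix \<gamma> assume \<gamma>: "\<gamma> \<in> \<Gamma>" and d: "\<And>z. z \<in> K \<Longrightarrow> dist (\<gamma> z) z < e"
    have "\<gamma> \<in> compact_nbhd K e \<one>\<^bsub>hyp_isometries\<^esub>"
      using elt_extensional[OF \<gamma>] d K(2) by (auto simp: compact_nbhd_def one_apply subset_iff)
    then show "\<gamma> = \<one>\<^bsub>hyp_isometries\<^esub>" using K(4) U(2) \<gamma> by blast
  qed
qed

lemma continuous_on_mobius_pair: "continuous_on (disc \<times> disc) (\<lambda>q. mobius (fst q) (snd q))"
  unfolding mobius_def
proof (intro continuous_intros ballI)
  fix q :: "complex \<times> complex" assume "q \<in> disc \<times> disc"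
  then show "1 + cnj (fst q) * snd q \<noteq> 0" by (intro mobius_denom) auto
qed

text \<open>Infinitely many distinct points of a compact set accumulate, and two of them lie in a
  ball of radius \<open>d / 2\<close> about the accumulation point.\<close>

lemma infinite_in_compact_close:
  fixes p :: "'a \<Rightarrow> 'b::metric_space"
  assumes "infinite S" "inj_on p S" "p ` S \<subseteq> P" "compact P" "d > 0"
  shows "\<exists>x\<in>S. \<exists>y\<in>S. x \<noteq> y \<and> dist (p y) (p x) < d"
proof -
  have "infinite (p ` S)" using assms finite_imageD by blast
  then obtain x where "x islimpt (p ` S)"
    using assms(3,4) unfolding compact_eq_Bolzano_Weierstrass by blast
  then have inf: "infinite (p ` S \<inter> ball x (d/2))"
    using assms(5) by (simp add: islimpt_eq_infinite_ball)
  from infinite_imp_nonempty[OF inf] obtain y where y: "y \<in> p ` S \<inter> ball x (d/2)" by (elim ex_in_conv[THEN iffD2, elim_format] exE)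
  from infinite_imp_nonempty[OF infinite_remove[OF inf, of y]]
  obtain y' where y': "y' \<in> p ` S \<inter> ball x (d/2) - {y}" by (elim ex_in_conv[THEN iffD2, elim_format] exE)
  have "dist y' y < d"
    using y y' dist_triangle_half_l[of y' x d y] by (auto simp: dist_commute)
  moreover from y obtain a where "a \<in> S" "y = p a" by auto
  moreover from y' obtain b where "b \<in> S" "y' = p b" "p b \<noteq> y" by auto
  ultimately show ?thesis by (intro bexI[of _ a] bexI[of _ b]) auto
qed

text \<open>Isometries moving a base point into a compact set are parametrised by a compact set, and two
  elements of the group with nearby parameters differ by an element close to the identity.\<close>

lemma discrete_imp_finite:
  assumes disc: "discrete_subgroup \<Gamma>" and z0: "z0 \<in> disc" and s: "s < 1"
  shows "finite {\<gamma>\<in>\<Gamma>. \<gamma> z0 \<in> cball 0 s}"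
proof -
  interpret isometry_group \<Gamma>
    using disc by (simp add: discrete_subgroup_def isometry_group_def)
  obtain K \<epsilon> where K: "compact K" "K \<subseteq> disc" "\<epsilon> > 0"
    "\<And>\<gamma>. \<gamma> \<in> \<Gamma> \<Longrightarrow> (\<And>z. z \<in> K \<Longrightarrow> dist (\<gamma> z) z < \<epsilon>) \<Longrightarrow> \<gamma> = \<one>\<^bsub>hyp_isometries\<^esub>"
    using discrete_isolated_identity[OF disc] by blast
  have mz0: "- z0 \<in> disc" using z0 by simp
  \<comment> \<open>\<open>\<tau>\<close> will be the identity and conjugation, so one argument
    treats isometries that preserve and that reverse orientation.\<close>
  have fin: "finite {\<gamma>\<in>\<Gamma>. \<gamma> z0 \<in> cball 0 s \<and>
      (\<exists>e. cmod e = 1 \<and> (\<forall>z\<in>disc. \<gamma> z = mobius (\<gamma> z0) (e * \<tau> (mobius (- z0) z))))}" (is "finite ?S")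
    if \<tau>: "continuous_on UNIV \<tau>" "\<And>z. cmod (\<tau> z) = cmod z" for \<tau>
  proof (rule ccontr)
    assume inf: "infinite ?S"
    define G where "G = (\<lambda>p z. mobius (fst p) (snd p * \<tau> (mobius (- z0) z)))"
    let ?P = "cball (0::complex) s \<times> sphere (0::complex) 1"
    have "\<forall>\<gamma>\<in>?S. \<exists>e. cmod e = 1 \<and> (\<forall>z\<in>disc. \<gamma> z = G (\<gamma> z0, e) z)" by (auto simp: G_def)
    from bchoice[OF this] obtain E where
      E: "\<And>\<gamma>. \<gamma> \<in> ?S \<Longrightarrow> cmod (E \<gamma>) = 1 \<and> (\<forall>z\<in>disc. \<gamma> z = G (\<gamma> z0, E \<gamma>) z)"
      by blast
    define p where "p \<gamma> = (\<gamma> z0, E \<gamma>)" for \<gamma>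
    have pG: "\<gamma> z = G (p \<gamma>) z" if "\<gamma> \<in> ?S" "z \<in> disc" for \<gamma> z
      using E[OF that(1)] that(2) unfolding p_def by blast
    have inj: "inj_on p ?S"
    proof (rule inj_onI)
      fix \<gamma> \<delta> assume a: "\<gamma> \<in> ?S" "\<delta> \<in> ?S" "p \<gamma> = p \<delta>"
      have "\<gamma> z = \<delta> z" if "z \<in> disc" for z using pG[OF a(1) that] pG[OF a(2) that] a(3) by simp
      then show "\<gamma> = \<delta>" using a elt_eqI by blast
    qed
    have in_disc': "snd x * \<tau> (mobius (- z0) z) \<in> disc" if "x \<in> ?P" "z \<in> disc" for x z
      using that mobius_in_disc[OF mz0 that(2)] \<tau>(2) by (auto simp: norm_mult)
    have fst_disc: "fst x \<in> disc" if "x \<in> ?P" for x using that s by auto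
    have G_disc: "G x z \<in> disc" if "x \<in> ?P" "z \<in> disc" for x z
      unfolding G_def using mobius_in_disc[OF fst_disc[OF that(1)] in_disc'[OF that]] .
    have contG: "continuous_on (?P \<times> K) (\<lambda>q. G (fst q) (snd q))"
    proof -
      have c1: "continuous_on (?P \<times> K) (\<lambda>q. snd (fst q) * \<tau> (mobius (- z0) (snd q)))"
        by (intro continuous_intros continuous_on_compose2[OF \<tau>(1)]
            continuous_on_compose2[OF continuous_on_mobius[OF mz0]]) (use K(2) in auto)
      have c2: "continuous_on (?P \<times> K) (\<lambda>q. fst (fst q))" by (intro continuous_intros)
      have "(\<lambda>q. (fst (fst q), snd (fst q) * \<tau> (mobius (- z0) (snd q)))) ` (?P \<times> K) \<subseteq> disc \<times> disc"
        using K(2) by (intro image_subsetI SigmaI fst_disc in_disc') auto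
      from continuous_on_compose2[OF continuous_on_mobius_pair continuous_on_Pair[OF c2 c1] this]
      show ?thesis by (simp add: G_def)
    qed
    \<comment> \<open>Measuring images by \<open>sinh_dist\<close> lets an isometry cancel: the
      value for two group elements equals the displacement of \<open>z\<close> by their quotient
      \<open>\<delta>\<close>. Since \<open>sinh_dist\<close> bounds the squared Euclidean distance
      from above, closeness \<open>\<epsilon>\<^sup>2\<close> is the one to ask for.\<close>
    let ?\<Phi> = "\<lambda>q. sinh_dist (G (fst (fst q)) (snd q)) (G (snd (fst q)) (snd q))"
    have cont\<Phi>: "continuous_on ((?P \<times> ?P) \<times> K) ?\<Phi>"
    proof -
      have "continuous_on ((?P \<times> ?P) \<times> K) (\<lambda>q. G (fst (fst (fst q), snd q)) (snd (fst (fst q), snd q)))"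
        by (rule continuous_on_compose2[OF contG]) (auto intro!: continuous_intros)
      moreover have "continuous_on ((?P \<times> ?P) \<times> K) (\<lambda>q. G (fst (snd (fst q), snd q)) (snd (snd (fst q), snd q)))"
        by (rule continuous_on_compose2[OF contG]) (auto intro!: continuous_intros)
      moreover have "(\<lambda>q. (G (fst (fst q)) (snd q), G (snd (fst q)) (snd q))) ` ((?P \<times> ?P) \<times> K) \<subseteq> disc \<times> disc"
        using K(2) by (intro image_subsetI SigmaI G_disc) auto
      ultimately have "continuous_on ((?P \<times> ?P) \<times> K) (\<lambda>q. case (G (fst (fst q)) (snd q), G (snd (fst q)) (snd q))
          of (z, w) \<Rightarrow> sinh_dist z w)"
        by (intro continuous_on_compose2[OF continuous_on_sinh_dist continuous_on_Pair]) simp_all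
      then show ?thesis by simp
    qed
    have "compact ((?P \<times> ?P) \<times> K)" using K(1) by (intro compact_Times) auto
    then have uc: "uniformly_continuous_on ((?P \<times> ?P) \<times> K) ?\<Phi>"
      by (rule compact_uniformly_continuous[OF cont\<Phi>])
    have "\<exists>d>0. \<forall>q\<in>(?P \<times> ?P) \<times> K. \<forall>q'\<in>(?P \<times> ?P) \<times> K. dist q' q < d \<longrightarrow> dist (?\<Phi> q') (?\<Phi> q) < \<epsilon>\<^sup>2"
      by (rule uc[unfolded uniformly_continuous_on_def, THEN spec, THEN mp]) (rule zero_less_power[OF K(3)])
    then obtain d where d: "d > 0"
      "\<forall>q\<in>(?P \<times> ?P) \<times> K. \<forall>q'\<in>(?P \<times> ?P) \<times> K. dist q' q < d \<longrightarrow> dist (?\<Phi> q') (?\<Phi> q) < \<epsilon>\<^sup>2"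
      by (elim exE conjE)
    have pP: "p ` ?S \<subseteq> ?P"
    proof (rule image_subsetI)
      fix \<gamma> assume "\<gamma> \<in> ?S"
      from this E[OF this] show "p \<gamma> \<in> ?P" by (simp add: p_def)
    qed
    have "compact ?P" by (intro compact_Times compact_cball compact_sphere)
    from infinite_in_compact_close[OF inf inj pP this d(1)]
    obtain \<gamma>1 \<gamma>2 where g: "\<gamma>1 \<in> ?S" "\<gamma>2 \<in> ?S" and ne: "\<gamma>1 \<noteq> \<gamma>2" and close: "dist (p \<gamma>2) (p \<gamma>1) < d"
      by (elim bexE conjE)
    define \<delta> where "\<delta> = product_elt (inverse_elt \<gamma>1) \<gamma>2"
    have \<Gamma>12: "\<gamma>1 \<in> \<Gamma>" "\<gamma>2 \<in> \<Gamma>" using g by auto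
    then have \<delta>: "\<delta> \<in> \<Gamma>" by (simp add: \<delta>_def product_closed inverse_closed)
    have g\<delta>: "\<gamma>1 (\<delta> z) = \<gamma>2 z" if "z \<in> disc" for z
      using \<Gamma>12 that by (simp add: \<delta>_def product_apply inverse_closed inverse_apply in_disc del: mem_ball mem_ball_0)
    have "\<delta> = \<one>\<^bsub>hyp_isometries\<^esub>"
    proof (rule K(4)[OF \<delta>])
      fix z assume z: "z \<in> K"
      then have zd: "z \<in> disc" using K(2) by blast
      have pP': "p \<gamma>1 \<in> ?P" "p \<gamma>2 \<in> ?P" using pP g by (blast intro: imageI)+
      have "dist (?\<Phi> ((p \<gamma>1, p \<gamma>2), z)) (?\<Phi> ((p \<gamma>1, p \<gamma>1), z)) < \<epsilon>\<^sup>2"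
      proof (rule d(2)[rule_format])
        show "dist ((p \<gamma>1, p \<gamma>2), z) ((p \<gamma>1, p \<gamma>1), z) < d"
          using close by (simp add: dist_Pair_Pair)
      qed (intro SigmaI pP' z)+
      moreover have "sinh_dist (\<gamma>1 z) (\<gamma>1 z) = 0" by (simp add: sinh_dist_def)
      ultimately have "\<bar>sinh_dist (\<gamma>1 z) (\<gamma>2 z) - 0\<bar> < \<epsilon>\<^sup>2"
        unfolding fst_conv snd_conv pG[OF g(1) zd, symmetric] pG[OF g(2) zd, symmetric] dist_real_def by simp
      then have "sinh_dist (\<gamma>1 z) (\<gamma>2 z) < \<epsilon>\<^sup>2" by linarith
      moreover have "sinh_dist (\<gamma>1 z) (\<gamma>1 (\<delta> z)) = sinh_dist z (\<delta> z)"
        by (rule sinh_dist_isometry[OF isometry[OF \<Gamma>12(1)] zd in_disc[OF \<delta> zd]])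
      ultimately have lt: "sinh_dist z (\<delta> z) < \<epsilon>\<^sup>2" using g\<delta>[OF zd] by simp
      have "(cmod (z - \<delta> z))\<^sup>2 \<le> sinh_dist z (\<delta> z)"
      proof -
        have "0 < 1 - (cmod z)\<^sup>2" "0 < 1 - (cmod (\<delta> z))\<^sup>2" 
          using sq_norm_less_1[OF zd] sq_norm_less_1[OF in_disc[OF \<delta> zd]] by auto
        moreover from this have "(1 - (cmod z)\<^sup>2) * (1 - (cmod (\<delta> z))\<^sup>2) \<le> 1 * 1"
          by (intro mult_mono) auto
        ultimately show ?thesis
          by (auto simp: sinh_dist_def le_divide_eq intro!: mult_left_le)
      qed
      then have "(cmod (z - \<delta> z))\<^sup>2 < \<epsilon>\<^sup>2" using lt by linarith
      then show "dist (\<delta> z) z < \<epsilon>"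
        using K(3) by (simp add: dist_norm norm_minus_commute power_less_imp_less_base)
    qed
    then have "\<gamma>1 z = \<gamma>2 z" if "z \<in> disc" for z using g\<delta>[OF that] that by (simp add: one_apply)
    then have "\<gamma>1 = \<gamma>2" using elt_eqI \<Gamma>12 by blast
    then show False using ne by simp
  qed
  have "finite ({\<gamma>\<in>\<Gamma>. \<gamma> z0 \<in> cball 0 s \<and>
      (\<exists>e. cmod e = 1 \<and> (\<forall>z\<in>disc. \<gamma> z = mobius (\<gamma> z0) (e * id (mobius (- z0) z))))} \<union>
      {\<gamma>\<in>\<Gamma>. \<gamma> z0 \<in> cball 0 s \<and>
      (\<exists>e. cmod e = 1 \<and> (\<forall>z\<in>disc. \<gamma> z = mobius (\<gamma> z0) (e * cnj (mobius (- z0) z))))})" (is "finite ?F")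
    by (intro finite_UnI fin) (auto intro: continuous_intros)
  then show ?thesis
  proof (rule finite_subset[rotated], intro subsetI)
    fix \<gamma> assume "\<gamma> \<in> {\<gamma>\<in>\<Gamma>. \<gamma> z0 \<in> cball 0 s}"
    then have \<gamma>: "\<gamma> \<in> \<Gamma>" "\<gamma> z0 \<in> cball 0 s" by auto
    show "\<gamma> \<in> ?F"
      by (rule hyp_isometry_cases[OF isometry[OF \<gamma>(1)] z0]) (use \<gamma> in auto)
  qed
qed

text \<open>The orbits meeting concentric balls that exhaust the disc form an increasing open cover
  of the quotient. The largest ball of a finite subcover meets every orbit.\<close>

lemma cocompact_imp_ball:
  assumes sub: "subgroup \<Gamma> hyp_isometries" and cpt: "compact_space (disc_quotient \<Gamma>)"
  obtains r where "0 < r" "r < 1" "\<And>z. z \<in> disc \<Longrightarrow> \<exists>\<gamma>\<in>\<Gamma>. \<gamma> z \<in> cball 0 r"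
proof -
  interpret isometry_group \<Gamma> using sub by (simp add: isometry_group_def)
  let ?O = "orbits (subgroup_of_isometries \<Gamma>) disc (\<lambda>\<gamma>. \<gamma>)"
  have orb: "disc_orbit \<Gamma> z = {\<gamma> z | \<gamma>. \<gamma> \<in> \<Gamma>}" for z by (simp add: orbit_def)
  define rr where "rr n = 1 - 1 / (real n + 2)" for n :: nat
  define U where "U n = {C \<in> ?O. C \<inter> ball 0 (rr n) \<noteq> {}}" for n
  have "openin (disc_quotient \<Gamma>) (U n)" for n
  proof -
    have eq: "{z \<in> disc. disc_orbit \<Gamma> z \<in> U n} = (\<Union>\<gamma>\<in>\<Gamma>. disc \<inter> \<gamma> -` ball 0 (rr n))"
      by (auto simp: U_def orb orbits_def simp del: mem_ball mem_ball_0)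
    have "open (disc \<inter> \<gamma> -` ball 0 (rr n))" if "\<gamma> \<in> \<Gamma>" for \<gamma>
      by (rule continuous_open_preimage[OF continuous_on_isometry[OF isometry[OF that]]]) auto
    then have "open {z \<in> disc. disc_orbit \<Gamma> z \<in> U n}" unfolding eq by (intro open_UN ballI)
    moreover have "U n \<subseteq> ?O" by (auto simp: U_def)
    ultimately show ?thesis unfolding openin_disc_quotient by blast
  qed
  moreover have "topspace (disc_quotient \<Gamma>) \<subseteq> \<Union>(range U)"
  proof
    fix C assume "C \<in> topspace (disc_quotient \<Gamma>)"
    then have C: "C \<in> ?O" by (simp add: topspace_disc_quotient)
    then obtain z where z: "z \<in> disc" "C = disc_orbit \<Gamma> z" by (auto simp: orbits_def)
    have "z \<in> C" using z one_closed by (auto simp: orb one_apply intro!: exI[of _ "\<one>\<^bsub>hyp_isometries\<^esub>"])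
    obtain n :: nat where "1 / (1 - cmod z) < real n" using reals_Archimedean2 by blast
    then have "1 / (1 - cmod z) < real n + 2" by linarith
    then have "1 / (real n + 2) < 1 - cmod z" using z(1) by (simp add: field_simps)
    then have "z \<in> ball 0 (rr n)" by (simp add: rr_def)
    then have "C \<in> U n" using C \<open>z \<in> C\<close> by (auto simp: U_def)
    then show "C \<in> \<Union>(range U)" by blast
  qed
  ultimately obtain \<F> where F: "finite \<F>" "\<F> \<subseteq> range U" "topspace (disc_quotient \<Gamma>) \<subseteq> \<Union>\<F>"
    using cpt unfolding compact_space_def compactin_def by (metis (no_types, lifting) imageE)
  then obtain I where I: "finite I" "\<F> = U ` I" using finite_subset_image by metis
  \<comment> \<open>Inserting 0 keeps the maximum meaningful for an empty index set.\<close>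
  define m where "m = Max (insert 0 I)"
  show ?thesis
  proof
    show "0 < rr m" "rr m < 1" by (auto simp: rr_def)
    fix z assume z: "z \<in> disc"
    then have "disc_orbit \<Gamma> z \<in> topspace (disc_quotient \<Gamma>)"
      by (auto simp: topspace_disc_quotient orbits_def)
    then obtain n where n: "n \<in> I" "disc_orbit \<Gamma> z \<in> U n" using F I by blast
    then obtain \<gamma> where \<gamma>: "\<gamma> \<in> \<Gamma>" "\<gamma> z \<in> ball 0 (rr n)"
      by (auto simp: U_def orb)
    have "n \<le> m" unfolding m_def using n I by (intro Max_ge) auto
    then have "rr n \<le> rr m" by (simp add: rr_def frac_le)
    then show "\<exists>\<gamma>\<in>\<Gamma>. \<gamma> z \<in> cball 0 (rr m)" using \<gamma> by (intro bexI[of _ \<gamma>]) auto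
  qed
qed

section \<open>Weighted fundamental domains and mass transport\<close>

text \<open>Discreteness and compactness of the quotient enter only through these two conditions.
  They pass to the stabilizer of a gap directly, without a study of its quotient.\<close>

locale cocompact_lattice = isometry_group \<Gamma> for \<Gamma> :: "(complex \<Rightarrow> complex) set" +
  fixes r :: real
  assumes r_pos: "0 < r" and r_less_1: "r < 1"
    and covering: "z \<in> disc \<Longrightarrow> \<exists>\<gamma>\<in>\<Gamma>. \<gamma> z \<in> cball 0 r"
    and locally_finite: "z \<in> disc \<Longrightarrow> s < 1 \<Longrightarrow> finite {\<gamma>\<in>\<Gamma>. \<gamma> z \<in> cball 0 s}"
begin

text \<open>Countability justifies exchanging sums over the group with area integrals.\<close>

lemma countable_group: "countable \<Gamma>"
proof -
  have "\<Gamma> \<subseteq> (\<Union>n::nat. {\<gamma>\<in>\<Gamma>. \<gamma> 0 \<in> cball 0 (1 - 1 / (real n + 1))})"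
  proof
    fix \<gamma> assume \<gamma>: "\<gamma> \<in> \<Gamma>"
    have lt: "cmod (\<gamma> 0) < 1" using in_disc[OF \<gamma>, of 0] by simp
    obtain n :: nat where "1 / (1 - cmod (\<gamma> 0)) < real n" using reals_Archimedean2 by blast
    then have "1 / (1 - cmod (\<gamma> 0)) \<le> real n + 1" by linarith
    then have "1 / (real n + 1) \<le> 1 - cmod (\<gamma> 0)" using lt by (simp add: field_simps)
    then show "\<gamma> \<in> (\<Union>n::nat. {\<gamma>\<in>\<Gamma>. \<gamma> 0 \<in> cball 0 (1 - 1 / (real n + 1))})"
      using \<gamma> by (intro UN_I[of n]) auto
  qed
  moreover have "countable (\<Union>n::nat. {\<gamma>\<in>\<Gamma>. \<gamma> 0 \<in> cball 0 (1 - 1 / (real n + 1))})"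
    by (rule countable_UN, simp, rule countable_finite, rule locally_finite) auto
  ultimately show ?thesis by (rule countable_subset)
qed

text \<open>The number of group elements bringing \<open>z\<close> into the ball, written as an
  integral so that reindexing the group is a change of variables for counting measure.\<close>

definition visits :: "complex \<Rightarrow> ennreal" where
  "visits z = (\<integral>\<^sup>+\<gamma>. indicator (cball 0 r) (\<gamma> z) \<partial>count_space \<Gamma>)"

text \<open>A fundamental domain in weighted form: the weights of the points of each orbit add up to 1.\<close>

definition weight :: "complex \<Rightarrow> ennreal" where
  "weight z = indicator (cball 0 r) z / visits z"

lemma visits_eq_card:
  assumes "z \<in> disc"
  shows "visits z = of_nat (card {\<gamma>\<in>\<Gamma>. \<gamma> z \<in> cball 0 r})"
proof -
  have "visits z = (\<Sum>\<gamma>\<in>{\<gamma>\<in>\<Gamma>. \<gamma> z \<in> cball 0 r}. indicator (cball 0 r) (\<gamma> z))"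
    unfolding visits_def
    by (rule nn_integral_count_space') (use locally_finite[OF assms r_less_1] in auto)
  also have "\<dots> = (\<Sum>\<gamma>\<in>{\<gamma>\<in>\<Gamma>. \<gamma> z \<in> cball 0 r}. 1)" by (rule sum.cong) auto
  finally show ?thesis by simp
qed

lemma visits_bounds:
  assumes z: "z \<in> disc"
  shows "1 \<le> visits z" "visits z < \<infinity>"
proof -
  have "{\<gamma>\<in>\<Gamma>. \<gamma> z \<in> cball 0 r} \<noteq> {}" using covering[OF z] by blast
  then have "1 \<le> card {\<gamma>\<in>\<Gamma>. \<gamma> z \<in> cball 0 r}"
    using locally_finite[OF z r_less_1] by (simp add: Suc_le_eq card_gt_0_iff)
  then have "of_nat 1 \<le> (of_nat (card {\<gamma>\<in>\<Gamma>. \<gamma> z \<in> cball 0 r}) :: ennreal)"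
    by (rule of_nat_mono)
  then show "1 \<le> visits z" "visits z < \<infinity>" by (simp_all add: visits_eq_card[OF z] ennreal_of_nat_eq_real_of_nat)
qed

lemma bij_product_right:
  assumes "\<delta> \<in> \<Gamma>"
  shows "bij_betw (\<lambda>\<gamma>. product_elt \<gamma> \<delta>) \<Gamma> \<Gamma>"
proof (rule bij_betwI[where g = "\<lambda>\<gamma>. product_elt \<gamma> (inverse_elt \<delta>)"])
  note pr = product_apply product_closed inverse_closed inverse_apply in_disc
  show "product_elt (product_elt \<gamma> \<delta>) (inverse_elt \<delta>) = \<gamma>" if "\<gamma> \<in> \<Gamma>" for \<gamma>
    by (rule elt_eqI) (use that assms in \<open>auto simp add: pr simp del: mem_ball mem_ball_0\<close>)
  show "product_elt (product_elt \<gamma> (inverse_elt \<delta>)) \<delta> = \<gamma>" if "\<gamma> \<in> \<Gamma>" for \<gamma>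
    by (rule elt_eqI) (use that assms in \<open>auto simp add: pr simp del: mem_ball mem_ball_0\<close>)
qed (use assms in \<open>auto simp: product_closed inverse_closed\<close>)

lemma bij_inverse: "bij_betw inverse_elt \<Gamma> \<Gamma>"
  by (rule bij_betwI[where g = inverse_elt]) (auto simp: inverse_closed inverse_inverse)

lemma visits_invariant:
  assumes "\<delta> \<in> \<Gamma>" "z \<in> disc"
  shows "visits (\<delta> z) = visits z"
proof -
  have "visits z = (\<integral>\<^sup>+\<gamma>. indicator (cball 0 r) (product_elt \<gamma> \<delta> z) \<partial>count_space \<Gamma>)"
    unfolding visits_def
    by (rule nn_integral_bij_count_space[OF bij_product_right[OF assms(1)], symmetric])
  also have "\<dots> = visits (\<delta> z)"
    unfolding visits_def by (rule nn_integral_cong) (simp add: product_apply assms del: mem_ball mem_ball_0)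
  finally show ?thesis by simp
qed

lemma sum_weight:
  assumes z: "z \<in> disc"
  shows "(\<integral>\<^sup>+\<gamma>. weight (\<gamma> z) \<partial>count_space \<Gamma>) = 1"
proof -
  have "(\<integral>\<^sup>+\<gamma>. weight (\<gamma> z) \<partial>count_space \<Gamma>)
      = (\<integral>\<^sup>+\<gamma>. indicator (cball 0 r) (\<gamma> z) / visits z \<partial>count_space \<Gamma>)"
    unfolding weight_def by (rule nn_integral_cong) (simp add: visits_invariant z del: mem_ball mem_ball_0)
  also have "\<dots> = visits z / visits z"
    unfolding visits_def by (rule nn_integral_divide) simp
  also have "\<dots> = 1"
    using visits_bounds[OF z] by (intro ennreal_divide_self) auto
  finally show ?thesis .
qed

lemma sum_weight_inverse:
  assumes z: "z \<in> disc"
  shows "(\<integral>\<^sup>+\<gamma>. weight (inverse_elt \<gamma> z) \<partial>count_space \<Gamma>) = 1"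
  using nn_integral_bij_count_space[OF bij_inverse, of "\<lambda>\<gamma>. weight (\<gamma> z)"] sum_weight[OF z] by simp

lemma indicator_measurable [measurable]:
  "(indicator (cball 0 r) :: complex \<Rightarrow> ennreal) \<in> borel_measurable hyp_area"
  by (rule borel_measurable_indicator)
     (use r_less_1 in \<open>auto simp: sets_hyp_area sets_restrict_space_iff\<close>)

lemma visits_measurable [measurable]: "visits \<in> borel_measurable hyp_area"
proof -
  interpret C: sigma_finite_measure "count_space \<Gamma>"
    by (rule sigma_finite_measure_count_space_countable[OF countable_group])
  have "(\<lambda>(\<gamma>, z). indicator (cball 0 r) (\<gamma> z) :: ennreal) \<in> borel_measurable (count_space \<Gamma> \<Otimes>\<^sub>M hyp_area)"
  proof (rule measurable_pair_measure_countable1[OF countable_group])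
    fix \<gamma> assume "\<gamma> \<in> \<Gamma>"
    then show "(\<lambda>z. case (\<gamma>, z) of (\<gamma>, z) \<Rightarrow> (indicator (cball 0 r) (\<gamma> z) :: ennreal)) \<in> borel_measurable hyp_area"
      using measurable_compose[OF area_preserving_measurable[OF area_preserving_elt] indicator_measurable]
      by simp
  qed
  then have "(\<lambda>(z, \<gamma>). indicator (cball 0 r) (\<gamma> z) :: ennreal) \<in> borel_measurable (hyp_area \<Otimes>\<^sub>M count_space \<Gamma>)"
    by (subst measurable_pair_swap_iff) (simp add: case_prod_beta)
  from C.borel_measurable_nn_integral[OF this] show ?thesis
    unfolding visits_def by simp
qed

lemma weight_measurable [measurable]: "weight \<in> borel_measurable hyp_area"
  unfolding weight_def by measurable

text \<open>Insert the sum of \<open>weight (\<gamma> w)\<close>, which is 1, let each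
  \<open>\<gamma>\<close> act diagonally so that it moves to the other variable, and sum there. This
  is integration of an invariant function over the quotient in each variable in turn.\<close>

lemma mass_transport:
  assumes g [measurable]: "(\<lambda>(z, w). g z w) \<in> borel_measurable (hyp_area \<Otimes>\<^sub>M hyp_area)"
    and inv: "\<And>\<gamma> z w. \<gamma> \<in> \<Gamma> \<Longrightarrow> z \<in> disc \<Longrightarrow> w \<in> disc \<Longrightarrow> g (\<gamma> z) (\<gamma> w) = g z w"
  shows "(\<integral>\<^sup>+z. weight z * (\<integral>\<^sup>+w. g z w \<partial>hyp_area) \<partial>hyp_area)
    = (\<integral>\<^sup>+z. weight z * (\<integral>\<^sup>+w. g w z \<partial>hyp_area) \<partial>hyp_area)"
proof -
  interpret P: pair_sigma_finite hyp_area hyp_area ..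
  have g1 [measurable]: "g z \<in> borel_measurable hyp_area" if "z \<in> disc" for z
    using measurable_compose[OF measurable_Pair1' g] that by simp
  have m\<gamma> [measurable]: "\<gamma> \<in> measurable hyp_area hyp_area" if "\<gamma> \<in> \<Gamma>" for \<gamma>
    by (rule area_preserving_measurable[OF area_preserving_elt[OF that]])
  \<comment> \<open>Replacing \<open>(z, w)\<close> by \<open>(\<gamma> z, \<gamma> w)\<close>
    preserves \<open>g\<close> and the areas, and moves the group element from the weight of
    \<open>w\<close> to that of \<open>z\<close>.\<close>
  have step: "(\<integral>\<^sup>+z. \<integral>\<^sup>+w. weight z * g z w * weight (\<gamma> w) \<partial>hyp_area \<partial>hyp_area)
      = (\<integral>\<^sup>+z. \<integral>\<^sup>+w. weight (inverse_elt \<gamma> z) * g z w * weight w \<partial>hyp_area \<partial>hyp_area)" (is "?L = ?R")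
    if \<gamma>: "\<gamma> \<in> \<Gamma>" for \<gamma>
  proof -
    define F where "F z w = weight (inverse_elt \<gamma> z) * g z w * weight w" for z w
    note [measurable] = m\<gamma>[OF \<gamma>] m\<gamma>[OF inverse_closed[OF \<gamma>]]
    have Fm: "(\<lambda>(z, w). F z w) \<in> borel_measurable (hyp_area \<Otimes>\<^sub>M hyp_area)"
      unfolding F_def by measurable
    have F1: "F z \<in> borel_measurable hyp_area" if "z \<in> disc" for z
      using measurable_compose[OF measurable_Pair1' Fm] that by simp
    have "?L = (\<integral>\<^sup>+z. \<integral>\<^sup>+w. F (\<gamma> z) (\<gamma> w) \<partial>hyp_area \<partial>hyp_area)"
      by (intro nn_integral_cong) (simp add: F_def inv \<gamma> inverse_apply del: mem_ball mem_ball_0)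
    also have "\<dots> = (\<integral>\<^sup>+z. \<integral>\<^sup>+w. F (\<gamma> z) w \<partial>hyp_area \<partial>hyp_area)"
      by (intro nn_integral_cong area_preserving_nn_integral[OF area_preserving_elt[OF \<gamma>]] F1)
         (simp add: in_disc \<gamma> del: mem_ball mem_ball_0)
    also have "\<dots> = (\<integral>\<^sup>+z. \<integral>\<^sup>+w. F z w \<partial>hyp_area \<partial>hyp_area)"
      by (rule area_preserving_nn_integral[OF area_preserving_elt[OF \<gamma>], of "\<lambda>z. \<integral>\<^sup>+w. F z w \<partial>hyp_area"])
         (rule hyp.borel_measurable_nn_integral[OF Fm])
    finally show ?thesis by (simp only: F_def)
  qed
  have sumL: "(\<integral>\<^sup>+z. weight z * (\<integral>\<^sup>+w. g z w \<partial>hyp_area) \<partial>hyp_area)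
      = (\<integral>\<^sup>+\<gamma>. \<integral>\<^sup>+z. \<integral>\<^sup>+w. weight z * g z w * weight (\<gamma> w) \<partial>hyp_area \<partial>hyp_area \<partial>count_space \<Gamma>)"
  proof -
    have "weight z * (\<integral>\<^sup>+w. g z w \<partial>hyp_area)
        = (\<integral>\<^sup>+\<gamma>. \<integral>\<^sup>+w. weight z * g z w * weight (\<gamma> w) \<partial>hyp_area \<partial>count_space \<Gamma>)" if z: "z \<in> disc" for z
    proof -
      note [measurable] = g1[OF z]
      have "weight z * (\<integral>\<^sup>+w. g z w \<partial>hyp_area) = (\<integral>\<^sup>+w. weight z * g z w \<partial>hyp_area)"
        by (rule nn_integral_cmult[symmetric]) measurable
      also have "\<dots> = (\<integral>\<^sup>+w. \<integral>\<^sup>+\<gamma>. weight z * g z w * weight (\<gamma> w) \<partial>count_space \<Gamma> \<partial>hyp_area)"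
        by (intro nn_integral_cong) (simp add: nn_integral_cmult sum_weight del: mem_ball mem_ball_0)
      also have "\<dots> = (\<integral>\<^sup>+\<gamma>. \<integral>\<^sup>+w. weight z * g z w * weight (\<gamma> w) \<partial>hyp_area \<partial>count_space \<Gamma>)"
      proof (rule nn_integral_count_space_nn_integral[OF countable_group])
        fix \<gamma> assume "\<gamma> \<in> \<Gamma>"
        note [measurable] = measurable_compose[OF m\<gamma>[OF this] weight_measurable]
        show "(\<lambda>w. weight z * g z w * weight (\<gamma> w)) \<in> borel_measurable hyp_area" by measurable
      qed
      finally show ?thesis .
    qed
    then have "(\<integral>\<^sup>+z. weight z * (\<integral>\<^sup>+w. g z w \<partial>hyp_area) \<partial>hyp_area)
        = (\<integral>\<^sup>+z. \<integral>\<^sup>+\<gamma>. \<integral>\<^sup>+w. weight z * g z w * weight (\<gamma> w) \<partial>hyp_area \<partial>count_space \<Gamma> \<partial>hyp_area)"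
      by (intro nn_integral_cong) simp
    also have "\<dots> = (\<integral>\<^sup>+\<gamma>. \<integral>\<^sup>+z. \<integral>\<^sup>+w. weight z * g z w * weight (\<gamma> w) \<partial>hyp_area \<partial>hyp_area \<partial>count_space \<Gamma>)"
    proof (rule nn_integral_count_space_nn_integral[OF countable_group])
      fix \<gamma> assume "\<gamma> \<in> \<Gamma>"
      note [measurable] = m\<gamma>[OF this]
      show "(\<lambda>z. \<integral>\<^sup>+w. weight z * g z w * weight (\<gamma> w) \<partial>hyp_area) \<in> borel_measurable hyp_area"
        by measurable
    qed
    finally show ?thesis .
  qed
  \<comment> \<open>Here the sum runs over inverses and is again 1: counting measure is invariant
    under inversion, which is unimodularity.\<close>
  have sumR: "(\<integral>\<^sup>+w. weight w * (\<integral>\<^sup>+z. g z w \<partial>hyp_area) \<partial>hyp_area)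
      = (\<integral>\<^sup>+\<gamma>. \<integral>\<^sup>+z. \<integral>\<^sup>+w. weight (inverse_elt \<gamma> z) * g z w * weight w \<partial>hyp_area \<partial>hyp_area \<partial>count_space \<Gamma>)"
  proof -
    have "(\<integral>\<^sup>+w. weight w * (\<integral>\<^sup>+z. g z w \<partial>hyp_area) \<partial>hyp_area)
        = (\<integral>\<^sup>+w. \<integral>\<^sup>+z. weight w * g z w \<partial>hyp_area \<partial>hyp_area)"
    proof (intro nn_integral_cong nn_integral_cmult[symmetric])
      fix w assume "w \<in> space hyp_area"
      then show "(\<lambda>z. g z w) \<in> borel_measurable hyp_area"
        using measurable_compose[OF measurable_Pair2' g] by simp
    qed
    also have "\<dots> = (\<integral>\<^sup>+z. \<integral>\<^sup>+w. weight w * g z w \<partial>hyp_area \<partial>hyp_area)"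
      by (rule P.Fubini'[symmetric]) measurable
    also have "\<dots> = (\<integral>\<^sup>+z. \<integral>\<^sup>+\<gamma>. \<integral>\<^sup>+w. weight (inverse_elt \<gamma> z) * g z w * weight w \<partial>hyp_area \<partial>count_space \<Gamma> \<partial>hyp_area)"
    proof (rule nn_integral_cong)
      fix z assume "z \<in> space hyp_area"
      then have z: "z \<in> disc" by simp
      note [measurable] = g1[OF z]
      have "(\<integral>\<^sup>+\<gamma>. \<integral>\<^sup>+w. weight (inverse_elt \<gamma> z) * g z w * weight w \<partial>hyp_area \<partial>count_space \<Gamma>)
          = (\<integral>\<^sup>+\<gamma>. weight (inverse_elt \<gamma> z) * (\<integral>\<^sup>+w. weight w * g z w \<partial>hyp_area) \<partial>count_space \<Gamma>)"
        by (intro nn_integral_cong) (subst nn_integral_cmult[symmetric], auto simp: mult_ac)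
      also have "\<dots> = (\<integral>\<^sup>+w. weight w * g z w \<partial>hyp_area)"
        by (simp add: nn_integral_multc sum_weight_inverse[OF z])
      finally show "(\<integral>\<^sup>+w. weight w * g z w \<partial>hyp_area)
          = (\<integral>\<^sup>+\<gamma>. \<integral>\<^sup>+w. weight (inverse_elt \<gamma> z) * g z w * weight w \<partial>hyp_area \<partial>count_space \<Gamma>)" by simp
    qed
    also have "\<dots> = (\<integral>\<^sup>+\<gamma>. \<integral>\<^sup>+z. \<integral>\<^sup>+w. weight (inverse_elt \<gamma> z) * g z w * weight w \<partial>hyp_area \<partial>hyp_area \<partial>count_space \<Gamma>)"
    proof (rule nn_integral_count_space_nn_integral[OF countable_group])
      fix \<gamma> assume "\<gamma> \<in> \<Gamma>"
      note [measurable] = m\<gamma>[OF inverse_closed[OF this]]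
      show "(\<lambda>z. \<integral>\<^sup>+w. weight (inverse_elt \<gamma> z) * g z w * weight w \<partial>hyp_area) \<in> borel_measurable hyp_area"
        by measurable
    qed
    finally show ?thesis .
  qed
  show ?thesis
    unfolding sumL sumR by (rule nn_integral_cong) (simp add: step)
qed

text \<open>The weight is at most the indicator of the ball, on which the density is bounded.
  Finiteness is what permits cancellation in the final estimate.\<close>

lemma weight_total: "(\<integral>\<^sup>+z. weight z \<partial>hyp_area) < \<infinity>"
proof -
  have le: "weight z \<le> indicator (cball 0 r) z" if "z \<in> disc" for z
    unfolding weight_def
  proof (rule divide_le_posI_ennreal)
    show "0 < visits z" using visits_bounds(1)[OF that] by (rule less_le_trans[OF zero_less_one])
    show "indicator (cball 0 r) z \<le> visits z * indicator (cball 0 r) z"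
      using visits_bounds(1)[OF that] by (simp split: split_indicator)
  qed
  have "(\<integral>\<^sup>+z. weight z \<partial>hyp_area) \<le> (\<integral>\<^sup>+z. indicator (cball 0 r) z \<partial>hyp_area)"
    by (rule nn_integral_mono) (simp add: le)
  also have "\<dots> = (\<integral>\<^sup>+z. ennreal (1 / (1 - (cmod z)\<^sup>2)\<^sup>2) * indicator (cball 0 r) z \<partial>restrict_space lborel disc)"
    by (rule nn_integral_hyp_area) measurable
  also have "\<dots> \<le> (\<integral>\<^sup>+z. ennreal (1 / (1 - r\<^sup>2)\<^sup>2) \<partial>restrict_space lborel disc)"
  proof (rule nn_integral_mono)
    fix z
    show "ennreal (1 / (1 - (cmod z)\<^sup>2)\<^sup>2) * indicator (cball 0 r) z \<le> ennreal (1 / (1 - r\<^sup>2)\<^sup>2)"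
    proof (cases "z \<in> cball 0 r")
      case True
      then have "(cmod z)\<^sup>2 \<le> r\<^sup>2" by (intro power_mono) auto
      moreover have "r\<^sup>2 < 1" using r_pos r_less_1 by (simp add: abs_square_less_1)
      ultimately have "1 / (1 - (cmod z)\<^sup>2)\<^sup>2 \<le> 1 / (1 - r\<^sup>2)\<^sup>2"
        by (intro divide_left_mono power_mono mult_pos_pos) auto
      then show ?thesis using True by (simp add: ennreal_leI)
    qed simp
  qed
  also have "\<dots> = ennreal (1 / (1 - r\<^sup>2)\<^sup>2) * emeasure lborel disc"
    by (simp add: emeasure_restrict_space space_restrict_space)
  also have "\<dots> < \<infinity>"
    using emeasure_bounded_finite[OF bounded_ball, of "0::complex" 1] by (simp add: ennreal_mult_less_top)
  finally show ?thesis .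
qed

lemma weight_pos: "z \<in> cball 0 r \<Longrightarrow> weight z > 0"
proof -
  assume z: "z \<in> cball 0 r"
  then have "z \<in> disc" using r_less_1 by auto
  from visits_bounds(2)[OF this] show ?thesis
    using z by (simp add: weight_def ennreal_zero_less_divide)
qed

end

subsection \<open>Families with different boundary values\<close>

lemma AE_hyp_area_open:
  assumes ae: "AE z in hyp_area. P z" and W: "open W" "W \<noteq> {}" "W \<subseteq> disc"
  shows "\<exists>z\<in>W. P z"
proof (rule ccontr)
  assume n: "\<not> (\<exists>z\<in>W. P z)"
  have "AE z in restrict_space lborel disc. 0 < ennreal (1 / (1 - (cmod z)\<^sup>2)\<^sup>2) \<longrightarrow> P z"
    using ae unfolding hyp_area_def by (subst (asm) AE_density[OF hyp_density_measurable])
  then have "AE z in lborel. z \<in> disc \<longrightarrow> 0 < ennreal (1 / (1 - (cmod z)\<^sup>2)\<^sup>2) \<longrightarrow> P z"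
    by (subst (asm) AE_restrict_space_iff) auto
  then have "AE z in lborel. z \<in> W \<longrightarrow> z \<in> {}"
  proof (rule AE_mp, intro AE_I2 impI)
    fix z assume a: "z \<in> disc \<longrightarrow> 0 < ennreal (1 / (1 - (cmod z)\<^sup>2)\<^sup>2) \<longrightarrow> P z" and z: "z \<in> W"
    have "z \<in> disc" using W z by blast
    moreover from this have "0 < ennreal (1 / (1 - (cmod z)\<^sup>2)\<^sup>2)" using sq_norm_less_1 by force
    ultimately show "z \<in> {}" using a n z by blast
  qed
  then have "AE z\<in>W in lebesgue. z \<in> {}" by (rule AE_completion)
  then show False
    using mem_closed_if_AE_lebesgue_open[OF W(1) closed_empty] W(2) by blast
qed

lemma AE_hyp_area_continuous_eq:
  fixes f :: "complex \<Rightarrow> real"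
  assumes f: "continuous_on disc f" and ae: "AE z in hyp_area. f z = c" and z: "z \<in> disc"
  shows "f z = c"
proof (rule ccontr)
  assume "f z \<noteq> c"
  then have "disc \<inter> f -` (- {c}) \<noteq> {}" using z by blast
  moreover have "open (disc \<inter> f -` (- {c}))"
    by (rule continuous_open_preimage[OF f]) auto
  ultimately have "\<exists>w\<in>disc \<inter> f -` (- {c}). f w = c"
    using AE_hyp_area_open[OF ae] by blast
  then show False by blast
qed

section \<open>Lebesgue measure on levels\<close>

text \<open>Levels 0 and 1 are excluded: they are the boundary values, while every level strictly
  between them is first passed at an interior point of the gap.\<close>

abbreviation unit_measure :: "real measure" where
  "unit_measure \<equiv> restrict_space lborel {0<..<1}"

lemma emeasure_unit_measure: "emeasure unit_measure {0<..<1} = 1"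
  by (simp add: emeasure_restrict_space)

lemma space_unit_measure: "space unit_measure = {0<..<1}"
  by (simp add: space_restrict_space)

lemma finite_measure_unit_measure: "finite_measure unit_measure"
  by (rule finite_measureI) (simp only: space_unit_measure emeasure_unit_measure, simp)

interpretation unit: finite_measure unit_measure by (rule finite_measure_unit_measure)

lemma id_measurable_unit [measurable]: "(\<lambda>t. t) \<in> borel_measurable unit_measure"
  by (intro measurable_restrict_space1) simp

lemma nn_integral_unit_power:
  assumes "0 \<le> \<eta>" "\<eta> \<le> 1"
  shows "(\<integral>\<^sup>+t. ennreal (real (Suc n) * t ^ n) * indicator {0<..<\<eta>} t \<partial>unit_measure) = ennreal (\<eta> ^ Suc n)"
proof -
  have "(\<integral>\<^sup>+t. ennreal (real (Suc n) * t ^ n) * indicator {0<..<\<eta>} t \<partial>unit_measure)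
      = (\<integral>\<^sup>+t. ennreal (real (Suc n) * t ^ n) * indicator {0<..<\<eta>} t * indicator {0<..<1} t \<partial>lborel)"
    by (rule nn_integral_restrict_space) simp
  also have "\<dots> = (\<integral>\<^sup>+t. ennreal (real (Suc n) * t ^ n) * indicator {0..\<eta>} t \<partial>lborel)"
  proof (rule nn_integral_cong_AE)
    have "AE t in lborel. t \<noteq> 0" "AE t in lborel. t \<noteq> \<eta>" by (rule AE_lborel_singleton)+
    then show "AE t in lborel. ennreal (real (Suc n) * t ^ n) * indicator {0<..<\<eta>} t * indicator {0<..<1} t
        = ennreal (real (Suc n) * t ^ n) * indicator {0..\<eta>} t"
      by eventually_elim (use assms in \<open>auto split: split_indicator\<close>)
  qed
  also have "\<dots> = ennreal (\<eta> ^ Suc n - 0 ^ Suc n)"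
  proof (rule nn_integral_FTC_Icc)
    show "((\<lambda>t. t ^ Suc n) has_real_derivative real (Suc n) * t ^ n) (at t)" for t
      using DERIV_pow[of "Suc n" t] by simp
  qed (use assms in auto)
  finally show ?thesis by simp
qed

lemma nn_integral_unit_full:
  "(\<integral>\<^sup>+t. ennreal (real (Suc n) * t ^ n) \<partial>unit_measure) = 1"
proof -
  have "(\<integral>\<^sup>+t. ennreal (real (Suc n) * t ^ n) \<partial>unit_measure)
      = (\<integral>\<^sup>+t. ennreal (real (Suc n) * t ^ n) * indicator {0<..<1} t \<partial>unit_measure)"
    by (rule nn_integral_cong) (simp add: space_unit_measure)
  also have "\<dots> = ennreal (1 ^ Suc n)" by (rule nn_integral_unit_power) auto
  finally show ?thesis by simp
qed

lemma nn_integral_unit_square: "(\<integral>\<^sup>+t. ennreal (t\<^sup>2) \<partial>unit_measure) = ennreal (1/3)"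
proof -
  have "(\<integral>\<^sup>+t. ennreal (t\<^sup>2) \<partial>unit_measure) = (\<integral>\<^sup>+t. ennreal (1/3) * ennreal (real (Suc 2) * t ^ 2) \<partial>unit_measure)"
    by (rule nn_integral_cong) (simp add: ennreal_mult'[symmetric])
  also have "\<dots> = ennreal (1/3) * (\<integral>\<^sup>+t. ennreal (real (Suc 2) * t ^ 2) \<partial>unit_measure)"
    by (rule nn_integral_cmult) measurable
  finally show ?thesis by (simp only: nn_integral_unit_full mult_1_right)
qed

lemma AE_unit_singleton: "AE t in unit_measure. t \<noteq> c"
  by (subst AE_restrict_space_iff) (auto intro: AE_mp[OF AE_lborel_singleton[of c]])

lemma AE_unit_ex:
  assumes "AE t in unit_measure. P t"
  shows "\<exists>t. 0 < t \<and> t < 1 \<and> P t"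
proof (rule ccontr)
  assume n: "\<not> (\<exists>t. 0 < t \<and> t < 1 \<and> P t)"
  have "AE t in unit_measure. False"
    using assms AE_space by eventually_elim (use n in \<open>auto simp: space_unit_measure\<close>)
  then obtain N where N: "{t \<in> space unit_measure. \<not> False} \<subseteq> N" "emeasure unit_measure N = 0" "N \<in> sets unit_measure"
    by (rule AE_E)
  have "{0<..<1} \<subseteq> N" using N(1) by (auto simp: space_unit_measure)
  from emeasure_mono[OF this N(3)] show False unfolding N(2) emeasure_unit_measure by simp
qed

text \<open>Up to the single point \<open>\<eta>\<close> the set is the interval from 0 to
  \<open>\<eta>\<close>. The second integral expresses the square of its length as an integral over
  the same set.\<close>

lemma initial_segment_integrals:
  assumes down: "\<And>t s. P t \<Longrightarrow> 0 < s \<Longrightarrow> s < t \<Longrightarrow> t < 1 \<Longrightarrow> P s"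
  shows "\<exists>\<eta>. 0 \<le> \<eta> \<and> \<eta> \<le> 1 \<and>
    (\<integral>\<^sup>+t. (if P t then 1 else 0) \<partial>unit_measure) = ennreal \<eta> \<and>
    (\<integral>\<^sup>+t. ennreal (2 * t) * (if P t then 1 else 0) \<partial>unit_measure) = ennreal (\<eta>\<^sup>2)"
proof -
  \<comment> \<open>With 0 inserted the supremum is meaningful, and equal to 0, when
    \<open>P\<close> holds nowhere.\<close>
  define Z where "Z = insert 0 {t. 0 < t \<and> t < 1 \<and> P t}"
  define \<eta> where "\<eta> = Sup Z"
  have Z: "Z \<noteq> {}" "bdd_above Z" by (auto simp: Z_def intro: bdd_aboveI[of _ 1])
  have "0 \<in> Z" "\<And>t. t \<in> Z \<Longrightarrow> t \<le> 1" by (auto simp: Z_def)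
  then have \<eta>: "0 \<le> \<eta>" "\<eta> \<le> 1"
    unfolding \<eta>_def using cSup_upper[OF _ Z(2)] cSup_least[OF Z(1)] by blast+
  have lt: "P t" if t: "0 < t" "t < \<eta>" for t
  proof -
    have "\<exists>s\<in>Z. t < s" using less_cSup_iff[OF Z] t(2) unfolding \<eta>_def by blast
    then obtain s where "s \<in> Z" "t < s" by (elim bexE)
    then show ?thesis using down[of s t] t by (auto simp: Z_def)
  qed
  have gt: "\<not> P t" if t: "\<eta> < t" "t < 1" for t
  proof
    assume "P t"
    then have "t \<in> Z" using t \<eta> by (auto simp: Z_def)
    then show False using cSup_upper[OF _ Z(2)] t(1) unfolding \<eta>_def by force
  qed
  have "AE t in unit_measure. (if P t then 1 else 0) = (indicator {0<..<\<eta>} t :: ennreal)"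
    using AE_unit_singleton[of \<eta>] AE_space
    by eventually_elim (use lt gt in \<open>auto simp: space_unit_measure not_less_iff_gr_or_eq split: split_indicator\<close>)
  note ae = this
  have "(\<integral>\<^sup>+t. (if P t then 1 else 0) \<partial>unit_measure) = (\<integral>\<^sup>+t. indicator {0<..<\<eta>} t \<partial>unit_measure)"
    by (rule nn_integral_cong_AE[OF ae])
  also have "\<dots> = ennreal \<eta>" using nn_integral_unit_power[OF \<eta>, of 0] by simp
  finally have 1: "(\<integral>\<^sup>+t. (if P t then 1 else 0) \<partial>unit_measure) = ennreal \<eta>" .
  have "(\<integral>\<^sup>+t. ennreal (2 * t) * (if P t then 1 else 0) \<partial>unit_measure)
      = (\<integral>\<^sup>+t. ennreal (2 * t) * indicator {0<..<\<eta>} t \<partial>unit_measure)"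
    by (rule nn_integral_cong_AE) (use ae in eventually_elim, simp)
  also have "\<dots> = ennreal (\<eta>\<^sup>2)" using nn_integral_unit_power[OF \<eta>, of 1] by (simp add: power2_eq_square)
  finally show ?thesis using 1 \<eta> by blast
qed

section \<open>First passage points in a normalised gap\<close>

text \<open>The maps \<open>\<psi>\<close> are controlled only inside the gap, and only for a group
  preserving it. Being increasing, they respect running maxima.\<close>

locale gap_system = cocompact_lattice \<Gamma> r for \<Gamma> r +
  fixes v :: "real \<Rightarrow> complex \<Rightarrow> real" and \<psi> :: "(complex \<Rightarrow> complex) \<Rightarrow> real \<Rightarrow> real" and a b :: real
  assumes a_less_b: "a < b"
    and v_cont: "continuous_on ({a..b} \<times> disc) (\<lambda>(x, z). v x z)"
    and v_harmonic: "x \<in> {a..b} \<Longrightarrow> harmonic_on disc (v x)"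
    and v_bounds: "x \<in> {a..b} \<Longrightarrow> z \<in> disc \<Longrightarrow> 0 \<le> v x z \<and> v x z \<le> 1"
    and v_a: "z \<in> disc \<Longrightarrow> v a z = 0" and v_b: "z \<in> disc \<Longrightarrow> v b z = 1"
    and \<psi>_bij: "\<gamma> \<in> \<Gamma> \<Longrightarrow> bij_betw (\<psi> \<gamma>) {a<..<b} {a<..<b}"
    and \<psi>_mono: "\<gamma> \<in> \<Gamma> \<Longrightarrow> strict_mono_on {a<..<b} (\<psi> \<gamma>)"
    and v_equivariant: "\<gamma> \<in> \<Gamma> \<Longrightarrow> x \<in> {a<..<b} \<Longrightarrow> z \<in> disc \<Longrightarrow> v (\<psi> \<gamma> x) (\<gamma> z) = v x z"
begin

lemma v_cont_x:
  assumes "z \<in> disc"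
  shows "continuous_on {a..b} (\<lambda>x. v x z)"
proof -
  have c: "continuous_on {a..b} (\<lambda>x. (x, z))" by (intro continuous_intros)
  have "(\<lambda>x. (x, z)) ` {a..b} \<subseteq> {a..b} \<times> disc" using assms by auto
  from continuous_on_compose2[OF v_cont c this] show ?thesis by simp
qed

lemma v_cont_z:
  assumes "x \<in> {a..b}"
  shows "continuous_on disc (v x)"
proof -
  have c: "continuous_on disc (\<lambda>z. (x, z))" by (intro continuous_intros)
  have "(\<lambda>z. (x, z)) ` disc \<subseteq> {a..b} \<times> disc" using assms by auto
  from continuous_on_compose2[OF v_cont c this] show ?thesis by simp
qed

text \<open>The generalised inverse in \<open>x\<close> of the running maximum at \<open>z\<close>.
  The strict inequality makes superlevel sets open in \<open>z\<close> and \<open>t\<close>, whence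
  measurability.\<close>

definition passage :: "complex \<Rightarrow> real \<Rightarrow> real" where
  "passage z t = Inf {x \<in> {a..b}. t < v x z}"

context
  fixes z :: complex and t :: real
  assumes z: "z \<in> disc" and t: "0 < t" "t < 1"
begin

lemma passage_nonempty: "b \<in> {x \<in> {a..b}. t < v x z}"
  using a_less_b v_b[OF z] t by simp

lemma passage_bdd: "bdd_below {x \<in> {a..b}. t < v x z}"
  by (rule bdd_belowI[of _ a]) auto

lemma passage_le: "x \<in> {a..b} \<Longrightarrow> t < v x z \<Longrightarrow> passage z t \<le> x"
  unfolding passage_def by (rule cInf_lower[OF _ passage_bdd]) simp

lemma passage_below: "x \<in> {a..b} \<Longrightarrow> x < passage z t \<Longrightarrow> v x z \<le> t"
  using passage_le[of x] by force

lemma passage_Icc: "passage z t \<in> {a..b}"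
  unfolding passage_def using passage_nonempty cInf_lower[OF passage_nonempty passage_bdd]
  by (auto intro!: cInf_greatest)

lemma passage_lessE:
  assumes "passage z t < y"
  obtains x where "x \<in> {a<..<b}" "x < y" "t < v x z" "passage z t \<le> x"
proof -
  obtain x where x: "x \<in> {a..b}" "t < v x z" "x < y"
    using cInf_lessD[OF _ assms[unfolded passage_def]] passage_nonempty by blast
  have xa: "x \<noteq> a" using x v_a[OF z] t by auto
  have le: "passage z t \<le> x" by (rule passage_le[OF x(1,2)])
  show ?thesis
  proof (cases "x = b")
    case False
    then show ?thesis using that[of x] x xa le by auto
  next
    \<comment> \<open>At \<open>b\<close> the value is 1, so a point slightly to the left still
      exceeds \<open>t\<close>. The witness has to be interior because equivariance is given only
      there.\<close>
    case True
    have "\<exists>d>0. \<forall>x'\<in>{a..b}. dist x' b < d \<longrightarrow> dist (v x' z) (v b z) < 1 - t"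
      using v_cont_x[OF z] a_less_b t unfolding continuous_on_iff by auto
    then obtain d where d: "d > 0" "\<And>x'. x' \<in> {a..b} \<Longrightarrow> dist x' b < d \<Longrightarrow> dist (v x' z) (v b z) < 1 - t"
      by blast
    define x' where "x' = max ((a + b) / 2) (b - d / 2)"
    have x': "a < x'" "x' < b" "dist x' b < d"
      using a_less_b d(1) by (auto simp: x'_def dist_real_def max_def field_simps)
    have vx': "t < v x' z" using d(2)[of x'] x' v_b[OF z] by (auto simp: dist_real_def)
    then show ?thesis using that[of x'] x' True x(3) passage_le[of x'] by auto
  qed
qed

text \<open>A larger value would persist slightly to the left, before the infimum; a smaller one
  would persist to the right, against points exceeding \<open>t\<close> arbitrarily near.\<close>

lemma v_passage: "v (passage z t) z = t"
proof (rule ccontr)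
  assume ne: "v (passage z t) z \<noteq> t"
  let ?p = "passage z t"
  have "\<exists>d>0. \<forall>x'\<in>{a..b}. dist x' ?p < d \<longrightarrow> dist (v x' z) (v ?p z) < \<bar>v ?p z - t\<bar>"
    using v_cont_x[OF z] passage_Icc ne unfolding continuous_on_iff by auto
  then obtain d where d: "d > 0" "\<And>x'. x' \<in> {a..b} \<Longrightarrow> dist x' ?p < d \<Longrightarrow> dist (v x' z) (v ?p z) < \<bar>v ?p z - t\<bar>"
    by blast
  consider "t < v ?p z" | "v ?p z < t" using ne by linarith
  then show False
  proof cases
    case 1
    then have "?p \<noteq> a" using v_a[OF z] t by auto
    then have pa: "a < ?p" using passage_Icc by auto
    define x where "x = max a (?p - d / 2)"
    have x: "x \<in> {a..b}" "x < ?p" "dist x ?p < d"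
      using pa passage_Icc d(1) by (auto simp: x_def dist_real_def)
    have "t < v x z" using d(2)[OF x(1,3)] 1 by (auto simp: dist_real_def)
    then show False using passage_le[OF x(1)] x(2) by simp
  next
    case 2
    obtain x where x: "x \<in> {a<..<b}" "x < ?p + d" "t < v x z" "?p \<le> x"
      using passage_lessE[of "?p + d"] d(1) by auto
    have "dist (v x z) (v ?p z) < \<bar>v ?p z - t\<bar>" using x by (intro d(2)) (auto simp: dist_real_def)
    then show False using x 2 by (auto simp: dist_real_def)
  qed
qed

lemma passage_Ioo: "passage z t \<in> {a<..<b}"
proof -
  have "passage z t \<noteq> a" "passage z t \<noteq> b" using v_passage v_a[OF z] v_b[OF z] t by auto
  then show ?thesis using passage_Icc by auto
qed

lemma passage_less: "x \<in> {a..b} \<Longrightarrow> t < v x z \<Longrightarrow> passage z t < x"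
  using passage_le[of x] v_passage by (cases "passage z t = x") auto

end

text \<open>At \<open>passage z t\<close> the value is \<open>t\<close>, already above
  \<open>s\<close>, so level \<open>s\<close> was passed strictly before.\<close>

lemma passage_mono:
  assumes z: "z \<in> disc" and t: "0 < s" "s < t" "t < 1"
  shows "passage z s < passage z t"
proof (rule passage_less)
  show "s < v (passage z t) z" using v_passage[OF z, of t] t by simp
qed (use passage_Icc[OF z, of t] z t in auto)

text \<open>By equivariance \<open>\<psi> \<gamma>\<close> maps the interior superlevel points at
  \<open>z\<close> onto those at \<open>\<gamma> z\<close>, and an increasing bijection respects
  infima.\<close>

lemma passage_equivariant:
  assumes \<gamma>: "\<gamma> \<in> \<Gamma>" and z: "z \<in> disc" and t: "0 < t" "t < 1"
  shows "passage (\<gamma> z) t = \<psi> \<gamma> (passage z t)"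
proof -
  let ?p = "passage z t" and ?q = "passage (\<gamma> z) t"
  have \<gamma>z: "\<gamma> z \<in> disc" by (rule in_disc[OF \<gamma> z])
  note p = passage_Ioo[OF z t] and q = passage_Ioo[OF \<gamma>z t]
  have surj: "\<exists>x\<in>{a<..<b}. \<psi> \<gamma> x = y" if "y \<in> {a<..<b}" for y
    using \<psi>_bij[OF \<gamma>] that unfolding bij_betw_def by (metis imageE)
  have maps: "\<psi> \<gamma> x \<in> {a<..<b}" if "x \<in> {a<..<b}" for x
    using \<psi>_bij[OF \<gamma>] that by (rule bij_betwE[rule_format])
  have mono: "\<psi> \<gamma> x < \<psi> \<gamma> y \<longleftrightarrow> x < y" if "x \<in> {a<..<b}" "y \<in> {a<..<b}" for x y
    by (rule strict_mono_on_less[OF \<psi>_mono[OF \<gamma>] that])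
  show ?thesis
  proof (rule antisym)
    show "?q \<le> \<psi> \<gamma> ?p"
    proof (rule ccontr)
      assume "\<not> ?q \<le> \<psi> \<gamma> ?p"
      then have lt: "\<psi> \<gamma> ?p < ?q" by simp
      obtain y where y: "y \<in> {a<..<b}" "\<psi> \<gamma> y = ?q" using surj[OF q] by blast
      have "?p < y" using lt mono[OF p y(1)] y(2) by simp
      then obtain x where x: "x \<in> {a<..<b}" "x < y" "t < v x z" by (rule passage_lessE[OF z t])
      have "?q \<le> \<psi> \<gamma> x"
        by (rule passage_le[OF \<gamma>z t]) (use maps[OF x(1)] v_equivariant[OF \<gamma> x(1) z] x(3) in auto)
      then show False using mono[OF x(1) y(1)] x(2) y(2) by simp
    qed
    show "\<psi> \<gamma> ?p \<le> ?q"
    proof (rule ccontr)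
      assume "\<not> \<psi> \<gamma> ?p \<le> ?q"
      then have "?q < \<psi> \<gamma> ?p" by simp
      then obtain y where y: "y \<in> {a<..<b}" "y < \<psi> \<gamma> ?p" "t < v y (\<gamma> z)"
        by (rule passage_lessE[OF \<gamma>z t])
      obtain x where x: "x \<in> {a<..<b}" "\<psi> \<gamma> x = y" using surj[OF y(1)] by blast
      have "x < ?p" using y(2) mono[OF x(1) p] x(2) by simp
      moreover have "t < v x z" using v_equivariant[OF \<gamma> x(1) z] x(2) y(3) by simp
      ultimately show False using passage_below[OF z t, of x] x(1) by auto
    qed
  qed
qed

text \<open>The infimum lies below \<open>c\<close> iff some \<open>x < c\<close> already exceeds
  the level, so the set in question is a union of open sets.\<close>

lemma passage_measurable: "(\<lambda>(z, t). passage z t) \<in> borel_measurable (hyp_area \<Otimes>\<^sub>M unit_measure)"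
proof (rule borel_measurableI_less)
  fix c :: real
  let ?M = "hyp_area \<Otimes>\<^sub>M unit_measure"
  let ?W = "\<Union>x\<in>{x\<in>{a..b}. x < c}. {p \<in> disc \<times> {0<..<1}. snd p < v x (fst p)}"
  have id: "(\<lambda>p. (fst p, snd p)) \<in> borel_measurable ?M"
    by (intro borel_measurable_Pair measurable_compose[OF measurable_fst id_measurable_hyp_area]
        measurable_compose[OF measurable_snd id_measurable_unit])
  have "open ?W"
  proof (intro open_UN ballI)
    fix x assume "x \<in> {x\<in>{a..b}. x < c}"
    then have x: "x \<in> {a..b}" by simp
    have c: "continuous_on (disc \<times> {0<..<1::real}) (\<lambda>p. v x (fst p) - snd p)"
      by (intro continuous_intros continuous_on_compose2[OF v_cont_z[OF x]]) auto
    have "open ((disc \<times> {0<..<1::real}) \<inter> (\<lambda>p. v x (fst p) - snd p) -` {0<..})"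
      by (rule continuous_open_preimage[OF c]) (auto intro: open_Times)
    moreover have "(disc \<times> {0<..<1::real}) \<inter> (\<lambda>p. v x (fst p) - snd p) -` {0<..}
        = {p \<in> disc \<times> {0<..<1}. snd p < v x (fst p)}" by auto
    ultimately show "open {p \<in> disc \<times> {0<..<1}. snd p < v x (fst p)}" by simp
  qed
  then have W: "?W \<in> sets borel" by (rule borel_open)
  have sp: "space ?M = disc \<times> {0<..<1}" by (simp add: space_pair_measure space_unit_measure)
  have iff: "passage z t < c \<longleftrightarrow> (\<exists>x\<in>{a..b}. x < c \<and> t < v x z)" if zt: "z \<in> disc" "0 < t" "t < 1" for z t
  proof
    assume "passage z t < c"
    then obtain x where "x \<in> {a<..<b}" "x < c" "t < v x z" by (rule passage_lessE[OF zt])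
    then show "\<exists>x\<in>{a..b}. x < c \<and> t < v x z" by (intro bexI[of _ x]) auto
  next
    assume "\<exists>x\<in>{a..b}. x < c \<and> t < v x z"
    then obtain x where x: "x \<in> {a..b}" "x < c" "t < v x z" by (elim bexE conjE)
    show "passage z t < c" using passage_le[OF zt x(1,3)] x(2) by simp
  qed
  have iff2: "passage (fst p) (snd p) < c \<longleftrightarrow> p \<in> ?W" if p: "p \<in> disc \<times> {0<..<1}" for p
  proof -
    have "fst p \<in> disc" "0 < snd p" "snd p < 1" using p by (simp_all add: mem_Times_iff)
    note iff[OF this]
    also have "(\<exists>x\<in>{a..b}. x < c \<and> snd p < v x (fst p)) \<longleftrightarrow> p \<in> ?W"
      using p by (simp only: UN_iff mem_Collect_eq Bex_def simp_thms conj_assoc)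
    finally show ?thesis .
  qed
  have gen: "{p \<in> A. P p} = (\<lambda>p. (fst p, snd p)) -` B \<inter> A"
    if "\<And>p. p \<in> A \<Longrightarrow> P p \<longleftrightarrow> p \<in> B" for A B and P :: "complex \<times> real \<Rightarrow> bool" using that by auto
  have "{p \<in> space ?M. (case p of (z, t) \<Rightarrow> passage z t) < c} = (\<lambda>p. (fst p, snd p)) -` ?W \<inter> space ?M"
    unfolding sp case_prod_beta by (rule gen[OF iff2])
  also have "\<dots> \<in> sets ?M" by (rule measurable_sets[OF id W])
  finally show "{p \<in> space ?M. (case p of (z, t) \<Rightarrow> passage z t) < c} \<in> sets ?M" .
qed

lemma passage_measurable_comp [measurable (raw)]:
  assumes "f \<in> measurable M hyp_area" "g \<in> measurable M unit_measure"
  shows "(\<lambda>x. passage (f x) (g x)) \<in> borel_measurable M"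
  using measurable_compose[OF measurable_Pair[OF assms] passage_measurable] by simp

text \<open>The monotone transition function: the value at \<open>w\<close> of the running maximum of \<open>v\<close> up to the
  point where it reaches the level \<open>t\<close> at \<open>z\<close>, written as the measure of a set of levels.\<close>

definition transition :: "complex \<Rightarrow> complex \<Rightarrow> real \<Rightarrow> ennreal" where
  "transition z w t = (\<integral>\<^sup>+s. (if passage w s < passage z t then 1 else 0) \<partial>unit_measure)"

lemma transition_measurable [measurable (raw)]:
  assumes [measurable]: "f \<in> measurable M hyp_area" "g \<in> measurable M hyp_area" "h \<in> measurable M unit_measure"
  shows "(\<lambda>x. transition (f x) (g x) (h x)) \<in> borel_measurable M"
  unfolding transition_def
  by (rule unit.borel_measurable_nn_integral) measurable

text \<open>Only the order of passage points matters, and the increasing map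
  \<open>\<psi> \<gamma>\<close> keeps it.\<close>

lemma transition_invariant:
  assumes \<gamma>: "\<gamma> \<in> \<Gamma>" and "z \<in> disc" "w \<in> disc" "0 < t" "t < 1"
  shows "transition (\<gamma> z) (\<gamma> w) t = transition z w t"
  unfolding transition_def
proof (rule nn_integral_cong)
  fix s assume "s \<in> space unit_measure"
  then have s: "0 < s" "s < 1" by (auto simp: space_unit_measure)
  have "passage (\<gamma> w) s < passage (\<gamma> z) t \<longleftrightarrow> passage w s < passage z t"
    unfolding passage_equivariant[OF \<gamma> assms(2,4,5)] passage_equivariant[OF \<gamma> assms(3) s]
    by (rule strict_mono_on_less[OF \<psi>_mono[OF \<gamma>] passage_Ioo[OF assms(3) s] passage_Ioo[OF assms(2,4,5)]])
  then show "(if passage (\<gamma> w) s < passage (\<gamma> z) t then 1 else 0) = (if passage w s < passage z t then 1 else (0::ennreal))"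
    by simp
qed

text \<open>The levels passed at \<open>w\<close> before \<open>passage z t\<close> form an initial
  segment, so one number \<open>\<eta>\<close> describes both integrals.\<close>

lemma transition_real:
  assumes "w \<in> disc"
  obtains \<eta> where "0 \<le> \<eta>" "\<eta> \<le> 1" "transition z w t = ennreal \<eta>"
    "(\<integral>\<^sup>+s. ennreal (2 * s) * (if passage w s < passage z t then 1 else 0) \<partial>unit_measure) = ennreal (\<eta>\<^sup>2)"
proof -
  have "\<exists>\<eta>. 0 \<le> \<eta> \<and> \<eta> \<le> 1 \<and>
    (\<integral>\<^sup>+s. (if passage w s < passage z t then 1 else 0) \<partial>unit_measure) = ennreal \<eta> \<and>
    (\<integral>\<^sup>+s. ennreal (2 * s) * (if passage w s < passage z t then 1 else 0) \<partial>unit_measure) = ennreal (\<eta>\<^sup>2)"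
  proof (rule initial_segment_integrals)
    fix s s' assume "passage w s < passage z t" "0 < s'" "s' < s" "s < 1"
    then show "passage w s' < passage z t" using passage_mono[OF assms, of s' s] by simp
  qed
  then show ?thesis using that unfolding transition_def by blast
qed

text \<open>A running maximum is at least the current value: each level below
  \<open>v (passage z t) w\<close> is passed at \<open>w\<close> strictly before
  \<open>passage z t\<close>.\<close>

lemma transition_ge:
  assumes z: "z \<in> disc" and w: "w \<in> disc" and t: "0 < t" "t < 1"
  shows "ennreal (v (passage z t) w) \<le> transition z w t"
proof -
  let ?x = "passage z t"
  have x: "?x \<in> {a..b}" by (rule passage_Icc[OF z t])
  have b: "0 \<le> v ?x w" "v ?x w \<le> 1" using v_bounds[OF x w] by auto
  have "ennreal (v ?x w) = (\<integral>\<^sup>+s. indicator {0<..<v ?x w} s \<partial>unit_measure)"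
    using nn_integral_unit_power[OF b, of 0] by simp
  also have "\<dots> \<le> transition z w t"
    unfolding transition_def
  proof (rule nn_integral_mono)
    fix s assume "s \<in> space unit_measure"
    then have s: "0 < s" "s < 1" by (auto simp: space_unit_measure)
    show "indicator {0<..<v ?x w} s \<le> (if passage w s < passage z t then 1 else (0::ennreal))"
      using passage_less[OF w s x] by (auto split: split_indicator)
  qed
  finally show ?thesis .
qed

section \<open>Moments of the transition functions\<close>

definition moment :: "complex \<Rightarrow> complex \<Rightarrow> ennreal" where
  "moment z w = (\<integral>\<^sup>+t. ennreal t * transition z w t \<partial>unit_measure)"

definition deviation :: "complex \<Rightarrow> complex \<Rightarrow> ennreal" where
  "deviation z w = (\<integral>\<^sup>+t. ennreal ((enn2real (transition z w t) - t)\<^sup>2) \<partial>unit_measure)"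

lemma moment_measurable [measurable (raw)]:
  assumes [measurable]: "f \<in> measurable M hyp_area" "g \<in> measurable M hyp_area"
  shows "(\<lambda>x. moment (f x) (g x)) \<in> borel_measurable M"
  unfolding moment_def
  by (rule unit.borel_measurable_nn_integral) measurable

lemma deviation_measurable [measurable (raw)]:
  assumes [measurable]: "f \<in> measurable M hyp_area" "g \<in> measurable M hyp_area"
  shows "(\<lambda>x. deviation (f x) (g x)) \<in> borel_measurable M"
  unfolding deviation_def
  by (rule unit.borel_measurable_nn_integral) measurable

text \<open>The transition functions from \<open>z\<close> to \<open>w\<close> and from \<open>w\<close> to \<open>z\<close> are inverse to each other, so the
  regions below the first and beside the second graph fill the unit square.\<close>

lemma transition_square:
  assumes z: "z \<in> disc" and w: "w \<in> disc"
  shows "(\<integral>\<^sup>+t. (transition z w t)\<^sup>2 \<partial>unit_measure) + 2 * moment w z = 1"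
proof -
  interpret P: pair_sigma_finite unit_measure unit_measure ..
  have cz [measurable]: "(\<lambda>x. z) \<in> measurable N hyp_area" "(\<lambda>x. w) \<in> measurable N hyp_area" for N :: "'x measure"
    using z w by auto
  have pm: "(\<lambda>(t, s). ennreal (2 * s) * (if passage w s < passage z t then 1 else 0))
      \<in> borel_measurable (unit_measure \<Otimes>\<^sub>M unit_measure)"
    by measurable
  have "(\<integral>\<^sup>+t. (transition z w t)\<^sup>2 \<partial>unit_measure)
      = (\<integral>\<^sup>+t. \<integral>\<^sup>+s. ennreal (2 * s) * (if passage w s < passage z t then 1 else 0) \<partial>unit_measure \<partial>unit_measure)"
  proof (rule nn_integral_cong)
    fix t
    obtain \<eta> where "0 \<le> \<eta>" "transition z w t = ennreal \<eta>"
      "(\<integral>\<^sup>+s. ennreal (2 * s) * (if passage w s < passage z t then 1 else 0) \<partial>unit_measure) = ennreal (\<eta>\<^sup>2)"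
      using transition_real[OF w] by blast
    then show "(transition z w t)\<^sup>2 = (\<integral>\<^sup>+s. ennreal (2 * s) * (if passage w s < passage z t then 1 else 0) \<partial>unit_measure)"
      by (simp add: ennreal_power)
  qed
  also have "\<dots> = (\<integral>\<^sup>+s. \<integral>\<^sup>+t. ennreal (2 * s) * (if passage w s < passage z t then 1 else 0) \<partial>unit_measure \<partial>unit_measure)"
    by (rule P.Fubini'[OF pm, symmetric])
  also have "\<dots> = (\<integral>\<^sup>+s. ennreal (2 * s) * (\<integral>\<^sup>+t. (if passage w s < passage z t then 1 else 0) \<partial>unit_measure) \<partial>unit_measure)"
  proof (rule nn_integral_cong)
    fix s assume "s \<in> space unit_measure"
    then have [measurable]: "(\<lambda>x. s) \<in> measurable unit_measure unit_measure" by simp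
    show "(\<integral>\<^sup>+t. ennreal (2 * s) * (if passage w s < passage z t then 1 else 0) \<partial>unit_measure)
        = ennreal (2 * s) * (\<integral>\<^sup>+t. (if passage w s < passage z t then 1 else 0) \<partial>unit_measure)"
      by (rule nn_integral_cmult) measurable
  qed
  finally have sq: "(\<integral>\<^sup>+t. (transition z w t)\<^sup>2 \<partial>unit_measure)
    = (\<integral>\<^sup>+s. ennreal (2 * s) * (\<integral>\<^sup>+t. (if passage w s < passage z t then 1 else 0) \<partial>unit_measure) \<partial>unit_measure)" .
  \<comment> \<open>Apart from ties the two conditions on \<open>t\<close> are complementary, so the
    inner integral is 1 minus \<open>transition w z s\<close>. Weighted by \<open>2 * s\<close> this
    turns the square into \<open>1 - 2 * moment w z\<close>.\<close>
  have compl: "(\<integral>\<^sup>+t. (if passage w s < passage z t then 1 else 0) \<partial>unit_measure) + transition w z s = 1"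
    if s: "s \<in> space unit_measure" for s
  proof -
    have s': "0 < s" "s < 1" using s by (auto simp: space_unit_measure)
    have [measurable]: "(\<lambda>x. s) \<in> measurable unit_measure unit_measure" using s by simp
    have "(\<integral>\<^sup>+t. (if passage w s < passage z t then 1 else 0) \<partial>unit_measure) + transition w z s
        = (\<integral>\<^sup>+t. (if passage w s < passage z t then 1 else 0) + (if passage z t < passage w s then 1 else 0) \<partial>unit_measure)"
      unfolding transition_def by (rule nn_integral_add[symmetric]) measurable
    also have "\<dots> = (\<integral>\<^sup>+t. 1 \<partial>unit_measure)"
    proof (rule nn_integral_cong_AE)
      \<comment> \<open>A tie forces \<open>t\<close> to be the value at \<open>z\<close> of
        \<open>v\<close> at the point \<open>passage w s\<close>, a single level.\<close>
      have "AE t in unit_measure. t \<noteq> v (passage w s) z" by (rule AE_unit_singleton)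
      then show "AE t in unit_measure. (if passage w s < passage z t then 1 else 0) + (if passage z t < passage w s then 1 else 0) = (1::ennreal)"
        using AE_space
      proof eventually_elim
        fix t assume "t \<noteq> v (passage w s) z" "t \<in> space unit_measure"
        then have "passage z t \<noteq> passage w s"
          using v_passage[OF z, of t] by (auto simp: space_unit_measure)
        then show "(if passage w s < passage z t then 1 else 0) + (if passage z t < passage w s then 1 else 0) = (1::ennreal)"
          by auto
      qed
    qed
    also have "\<dots> = 1" by (simp add: emeasure_restrict_space space_unit_measure)
    finally show ?thesis .
  qed
  have m [measurable]: "(\<lambda>s. transition w z s) \<in> borel_measurable unit_measure" by measurable
  have inner [measurable]: "(\<lambda>s. \<integral>\<^sup>+t. (if passage w s < passage z t then 1 else 0) \<partial>unit_measure)
      \<in> borel_measurable unit_measure"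
    by (rule unit.borel_measurable_nn_integral) measurable
  have m1: "(\<lambda>s. ennreal (2 * s) * (\<integral>\<^sup>+t. (if passage w s < passage z t then 1 else 0) \<partial>unit_measure))
      \<in> borel_measurable unit_measure"
    by (rule borel_measurable_times_ennreal[OF _ inner]) measurable
  have m2: "(\<lambda>s. ennreal (2 * s) * transition w z s) \<in> borel_measurable unit_measure"
    by (rule borel_measurable_times_ennreal[OF _ m]) measurable
  have m3: "(\<lambda>s. ennreal s * transition w z s) \<in> borel_measurable unit_measure"
    by (rule borel_measurable_times_ennreal[OF _ m]) measurable
  have "2 * moment w z = (\<integral>\<^sup>+s. 2 * (ennreal s * transition w z s) \<partial>unit_measure)"
    unfolding moment_def by (rule nn_integral_cmult[OF m3, symmetric])
  also have "\<dots> = (\<integral>\<^sup>+s. ennreal (2 * s) * transition w z s \<partial>unit_measure)"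
    by (rule nn_integral_cong) (simp add: ennreal_mult' mult.assoc[symmetric])
  finally have "(\<integral>\<^sup>+t. (transition z w t)\<^sup>2 \<partial>unit_measure) + 2 * moment w z
      = (\<integral>\<^sup>+s. ennreal (2 * s) * (\<integral>\<^sup>+t. (if passage w s < passage z t then 1 else 0) \<partial>unit_measure)
        + ennreal (2 * s) * transition w z s \<partial>unit_measure)"
    by (simp only: sq nn_integral_add[OF m1 m2])
  also have "\<dots> = (\<integral>\<^sup>+s. ennreal (real (Suc 1) * s ^ 1) \<partial>unit_measure)"
    by (rule nn_integral_cong) (simp add: distrib_left[symmetric] compl)
  also have "\<dots> = 1" by (rule nn_integral_unit_full)
  finally show ?thesis .
qed

text \<open>Expanding the square in additive form, which avoids subtraction of extended reals; 4/3
  is 1 from \<open>transition_square\<close> plus 1/3 from the integral of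
  \<open>t^2\<close>.\<close>

lemma deviation_identity:
  assumes z: "z \<in> disc" and w: "w \<in> disc"
  shows "deviation z w + 2 * moment z w + 2 * moment w z = ennreal (4/3)"
proof -
  have [measurable]: "(\<lambda>x. z) \<in> measurable N hyp_area" "(\<lambda>x. w) \<in> measurable N hyp_area" for N :: "'x measure"
    using z w by auto
  have m [measurable]: "(\<lambda>t. transition z w t) \<in> borel_measurable unit_measure" by measurable
  have m1: "(\<lambda>t. ennreal t * transition z w t) \<in> borel_measurable unit_measure"
    by (rule borel_measurable_times_ennreal[OF _ m]) measurable
  have m2: "(\<lambda>t. 2 * (ennreal t * transition z w t)) \<in> borel_measurable unit_measure"
    by (rule borel_measurable_times_ennreal[OF _ m1]) measurable
  have m3: "(\<lambda>t. ennreal ((enn2real (transition z w t) - t)\<^sup>2)) \<in> borel_measurable unit_measure"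
    by measurable
  have "2 * moment z w = (\<integral>\<^sup>+t. 2 * (ennreal t * transition z w t) \<partial>unit_measure)"
    unfolding moment_def by (rule nn_integral_cmult[OF m1, symmetric])
  then have "deviation z w + 2 * moment z w
      = (\<integral>\<^sup>+t. ennreal ((enn2real (transition z w t) - t)\<^sup>2) + 2 * (ennreal t * transition z w t) \<partial>unit_measure)"
    by (simp only: deviation_def nn_integral_add[OF m3 m2])
  also have "\<dots> = (\<integral>\<^sup>+t. (transition z w t)\<^sup>2 + ennreal (t\<^sup>2) \<partial>unit_measure)"
  proof (rule nn_integral_cong)
    fix t assume "t \<in> space unit_measure"
    then have t: "0 < t" by (simp add: space_unit_measure)
    obtain \<eta> where \<eta>: "0 \<le> \<eta>" "transition z w t = ennreal \<eta>" using transition_real[OF w] by blast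
    have "ennreal ((\<eta> - t)\<^sup>2) + 2 * (ennreal t * ennreal \<eta>) = ennreal ((\<eta> - t)\<^sup>2 + 2 * (t * \<eta>))"
      using \<eta> t by (simp add: ennreal_mult ennreal_plus)
    also have "(\<eta> - t)\<^sup>2 + 2 * (t * \<eta>) = \<eta>\<^sup>2 + t\<^sup>2" by (simp add: power2_diff)
    finally show "ennreal ((enn2real (transition z w t) - t)\<^sup>2) + 2 * (ennreal t * transition z w t)
        = (transition z w t)\<^sup>2 + ennreal (t\<^sup>2)"
      using \<eta> by (simp add: ennreal_power)
  qed
  also have "\<dots> = (\<integral>\<^sup>+t. (transition z w t)\<^sup>2 \<partial>unit_measure) + (\<integral>\<^sup>+t. ennreal (t\<^sup>2) \<partial>unit_measure)"
    by (rule nn_integral_add) measurable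
  also have "(\<integral>\<^sup>+t. ennreal (t\<^sup>2) \<partial>unit_measure) = ennreal (1/3)"
    by (rule nn_integral_unit_square)
  finally have "deviation z w + 2 * moment z w + 2 * moment w z
      = ((\<integral>\<^sup>+t. (transition z w t)\<^sup>2 \<partial>unit_measure) + 2 * moment w z) + ennreal (1/3)"
    by (simp add: add_ac)
  then show ?thesis
    unfolding transition_square[OF z w] by (simp flip: ennreal_1 ennreal_plus)
qed

lemma moment_invariant:
  assumes "\<gamma> \<in> \<Gamma>" "z \<in> disc" "w \<in> disc"
  shows "moment (\<gamma> z) (\<gamma> w) = moment z w"
  unfolding moment_def
proof (rule nn_integral_cong)
  fix t assume "t \<in> space unit_measure"
  then have "0 < t" "t < 1" by (auto simp: space_unit_measure)
  then show "ennreal t * transition (\<gamma> z) (\<gamma> w) t = ennreal t * transition z w t"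
    by (simp only: transition_invariant[OF assms])
qed

text \<open>The mean value property for the constant harmonic function \<open>v b\<close>.\<close>

lemma nn_integral_berezin:
  assumes z: "z \<in> disc"
  shows "(\<integral>\<^sup>+w. berezin z w \<partial>hyp_area) = ennreal pi"
proof -
  have b: "b \<in> {a..b}" using a_less_b by simp
  have "(\<integral>\<^sup>+w. berezin z w \<partial>hyp_area) = (\<integral>\<^sup>+w. ennreal (v b w) * berezin z w \<partial>hyp_area)"
    by (rule nn_integral_cong) (simp add: v_b)
  also have "\<dots> = ennreal (pi * v b z)"
    by (rule harmonic_mean_value[OF v_harmonic[OF b] _ z]) (use v_bounds[OF b] in blast)
  finally show ?thesis by (simp add: v_b[OF z])
qed

lemma passage_mean_value:
  assumes z: "z \<in> disc" and t: "0 < t" "t < 1"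
  shows "(\<integral>\<^sup>+w. ennreal (v (passage z t) w) * berezin z w \<partial>hyp_area) = ennreal (pi * t)"
  using harmonic_mean_value[OF v_harmonic[OF passage_Icc[OF z t]] _ z] v_bounds[OF passage_Icc[OF z t]]
    v_passage[OF z t] by simp

lemma v_measurable: "x \<in> {a..b} \<Longrightarrow> v x \<in> borel_measurable hyp_area"
  by (rule borel_measurable_hyp_area_continuous[OF v_cont_z])

lemma berezin_measurable_comp [measurable (raw)]:
  assumes "f \<in> measurable M hyp_area" "g \<in> measurable M hyp_area"
  shows "(\<lambda>x. berezin (f x) (g x)) \<in> borel_measurable M"
  using measurable_compose[OF measurable_Pair[OF assms] berezin_measurable] by simp

text \<open>For fixed \<open>t\<close> the transition function dominates a harmonic function with
  value \<open>t\<close> at \<open>z\<close>, whose mean is \<open>pi * t\<close>. Integrating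
  \<open>t\<close> times this gives \<open>pi / 3\<close>.\<close>

lemma moment_mean_ge:
  assumes z: "z \<in> disc"
  shows "ennreal (pi / 3) \<le> (\<integral>\<^sup>+w. moment z w * berezin z w \<partial>hyp_area)"
proof -
  interpret P: pair_sigma_finite hyp_area unit_measure ..
  have [measurable]: "(\<lambda>x. z) \<in> measurable N hyp_area" for N :: "'x measure" using z by auto
  have bz: "berezin z \<in> borel_measurable hyp_area" by (rule berezin_measurable'[OF z])
  have fm: "(\<lambda>(w, t). ennreal t * transition z w t * berezin z w) \<in> borel_measurable (hyp_area \<Otimes>\<^sub>M unit_measure)"
    by measurable
  have "(\<integral>\<^sup>+w. moment z w * berezin z w \<partial>hyp_area)
      = (\<integral>\<^sup>+w. \<integral>\<^sup>+t. ennreal t * transition z w t * berezin z w \<partial>unit_measure \<partial>hyp_area)"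
    unfolding moment_def
  proof (intro nn_integral_cong nn_integral_multc[symmetric])
    fix w assume "w \<in> space hyp_area"
    then have [measurable]: "(\<lambda>x. w) \<in> measurable unit_measure hyp_area" by simp
    show "(\<lambda>t. ennreal t * transition z w t) \<in> borel_measurable unit_measure" by measurable
  qed
  also have "\<dots> = (\<integral>\<^sup>+t. \<integral>\<^sup>+w. ennreal t * transition z w t * berezin z w \<partial>hyp_area \<partial>unit_measure)"
    by (rule P.Fubini'[OF fm, symmetric])
  also have "\<dots> \<ge> (\<integral>\<^sup>+t. ennreal pi * ennreal (t\<^sup>2) \<partial>unit_measure)"
  proof (rule nn_integral_mono)
    fix t assume "t \<in> space unit_measure"
    then have t: "0 < t" "t < 1" by (auto simp: space_unit_measure)
    have vm: "(\<lambda>w. ennreal (v (passage z t) w)) \<in> borel_measurable hyp_area"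
      using v_measurable[OF passage_Icc[OF z t]] by measurable
    have "ennreal pi * ennreal (t\<^sup>2) = ennreal t * ennreal (pi * t)"
      using t by (simp add: ennreal_mult[symmetric] power2_eq_square mult_ac)
    also have "\<dots> = (\<integral>\<^sup>+w. ennreal t * (ennreal (v (passage z t) w) * berezin z w) \<partial>hyp_area)"
      unfolding passage_mean_value[OF z t, symmetric]
      by (rule nn_integral_cmult[symmetric]) (rule borel_measurable_times_ennreal[OF vm bz])
    also have "\<dots> \<le> (\<integral>\<^sup>+w. ennreal t * transition z w t * berezin z w \<partial>hyp_area)"
    proof (rule nn_integral_mono)
      fix w assume "w \<in> space hyp_area"
      then have "ennreal (v (passage z t) w) \<le> transition z w t" using transition_ge[OF z _ t] by simp
      then show "ennreal t * (ennreal (v (passage z t) w) * berezin z w) \<le> ennreal t * transition z w t * berezin z w"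
        unfolding mult.assoc by (intro mult_left_mono mult_right_mono) auto
    qed
    finally show "ennreal pi * ennreal (t\<^sup>2) \<le> (\<integral>\<^sup>+w. ennreal t * transition z w t * berezin z w \<partial>hyp_area)" .
  qed
  also have "(\<integral>\<^sup>+t. ennreal pi * ennreal (t\<^sup>2) \<partial>unit_measure) = ennreal pi * ennreal (1/3)"
    unfolding nn_integral_unit_square[symmetric] by (rule nn_integral_cmult) measurable
  also have "\<dots> = ennreal (pi / 3)" by (simp add: ennreal_mult[symmetric])
  finally show ?thesis .
qed

text \<open>Averaging \<open>deviation_identity\<close> gives \<open>4 / 3 * pi\<close> times the
  total weight. Four averaged moments, each at least \<open>pi / 3\<close> times the total weight,
  exhaust it, and the finite amount can be cancelled.\<close>

lemma deviation_total:
  "(\<integral>\<^sup>+z. weight z * (\<integral>\<^sup>+w. deviation z w * berezin z w \<partial>hyp_area) \<partial>hyp_area) = 0"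
proof -
  define E where "E f = (\<integral>\<^sup>+z. weight z * (\<integral>\<^sup>+w. f z w * berezin z w \<partial>hyp_area) \<partial>hyp_area)" for f
  define W where "W = (\<integral>\<^sup>+z. weight z \<partial>hyp_area)"
  have b2: "(\<lambda>(z, w). f z w * berezin z w) \<in> borel_measurable (hyp_area \<Otimes>\<^sub>M hyp_area)"
    if "(\<lambda>(z, w). f z w) \<in> borel_measurable (hyp_area \<Otimes>\<^sub>M hyp_area)" for f
    using borel_measurable_times_ennreal[OF that berezin_measurable] by (simp add: case_prod_beta')
  have inner: "(\<lambda>z. \<integral>\<^sup>+w. f z w * berezin z w \<partial>hyp_area) \<in> borel_measurable hyp_area"
    if "(\<lambda>(z, w). f z w) \<in> borel_measurable (hyp_area \<Otimes>\<^sub>M hyp_area)" for f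
    by (rule hyp.borel_measurable_nn_integral[OF b2[OF that]])
  have sect: "(\<lambda>w. f z w * berezin z w) \<in> borel_measurable hyp_area"
    if "(\<lambda>(z, w). f z w) \<in> borel_measurable (hyp_area \<Otimes>\<^sub>M hyp_area)" "z \<in> disc" for f z
    using measurable_compose[OF measurable_Pair1' b2[OF that(1)]] that(2) by simp
  have add: "E (\<lambda>z w. f z w + g z w) = E f + E g"
    if f: "(\<lambda>(z, w). f z w) \<in> borel_measurable (hyp_area \<Otimes>\<^sub>M hyp_area)"
      and g: "(\<lambda>(z, w). g z w) \<in> borel_measurable (hyp_area \<Otimes>\<^sub>M hyp_area)" for f g
  proof -
    have "E (\<lambda>z w. f z w + g z w) = (\<integral>\<^sup>+z. weight z * (\<integral>\<^sup>+w. f z w * berezin z w \<partial>hyp_area)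
        + weight z * (\<integral>\<^sup>+w. g z w * berezin z w \<partial>hyp_area) \<partial>hyp_area)"
      unfolding E_def
    proof (rule nn_integral_cong)
      fix z assume "z \<in> space hyp_area"
      then have z: "z \<in> disc" by simp
      have "(\<integral>\<^sup>+w. (f z w + g z w) * berezin z w \<partial>hyp_area)
          = (\<integral>\<^sup>+w. f z w * berezin z w \<partial>hyp_area) + (\<integral>\<^sup>+w. g z w * berezin z w \<partial>hyp_area)"
        unfolding distrib_right by (rule nn_integral_add[OF sect[OF f z] sect[OF g z]])
      then show "weight z * (\<integral>\<^sup>+w. (f z w + g z w) * berezin z w \<partial>hyp_area)
        = weight z * (\<integral>\<^sup>+w. f z w * berezin z w \<partial>hyp_area) + weight z * (\<integral>\<^sup>+w. g z w * berezin z w \<partial>hyp_area)"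
        by (simp only: distrib_left)
    qed
    also have "\<dots> = E f + E g"
      unfolding E_def
      by (rule nn_integral_add) (rule borel_measurable_times_ennreal[OF weight_measurable inner], fact)+
    finally show ?thesis .
  qed
  have mm: "(\<lambda>(z, w). moment z w) \<in> borel_measurable (hyp_area \<Otimes>\<^sub>M hyp_area)" by measurable
  have mm': "(\<lambda>(z, w). moment w z) \<in> borel_measurable (hyp_area \<Otimes>\<^sub>M hyp_area)" by measurable
  have dm: "(\<lambda>(z, w). deviation z w) \<in> borel_measurable (hyp_area \<Otimes>\<^sub>M hyp_area)" by measurable
  \<comment> \<open>Doubled moments are written as sums so that additivity of \<open>E\<close>
    suffices.\<close>
  have m2: "(\<lambda>(z, w). moment z w + moment z w) \<in> borel_measurable (hyp_area \<Otimes>\<^sub>M hyp_area)" by measurable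
  have m2': "(\<lambda>(z, w). moment w z + moment w z) \<in> borel_measurable (hyp_area \<Otimes>\<^sub>M hyp_area)" by measurable
  have dm2: "(\<lambda>(z, w). deviation z w + (moment z w + moment z w)) \<in> borel_measurable (hyp_area \<Otimes>\<^sub>M hyp_area)"
    by measurable
  \<comment> \<open>Mass transport exchanges the arguments of both factors; symmetry of the kernel
    undoes the exchange in \<open>berezin\<close>.\<close>
  have sym: "E (\<lambda>z w. moment w z) = E moment"
  proof -
    have "(\<integral>\<^sup>+z. weight z * (\<integral>\<^sup>+w. moment z w * berezin z w \<partial>hyp_area) \<partial>hyp_area)
        = (\<integral>\<^sup>+z. weight z * (\<integral>\<^sup>+w. moment w z * berezin w z \<partial>hyp_area) \<partial>hyp_area)"
      by (rule mass_transport[OF b2[OF mm]])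
         (simp only: moment_invariant berezin_isometry[OF isometry])
    then show ?thesis unfolding E_def by (simp only: berezin_commute)
  qed
  have const: "(\<integral>\<^sup>+z. weight z * c \<partial>hyp_area) = W * c" for c
    unfolding W_def by (rule nn_integral_multc) measurable
  have "E (\<lambda>z w. deviation z w + (moment z w + moment z w) + (moment w z + moment w z))
      = (\<integral>\<^sup>+z. weight z * (ennreal (4/3) * ennreal pi) \<partial>hyp_area)"
    unfolding E_def
  proof (rule nn_integral_cong)
    fix z assume "z \<in> space hyp_area"
    then have z: "z \<in> disc" by simp
    have "(\<integral>\<^sup>+w. (deviation z w + (moment z w + moment z w) + (moment w z + moment w z)) * berezin z w \<partial>hyp_area)
        = (\<integral>\<^sup>+w. ennreal (4/3) * berezin z w \<partial>hyp_area)"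
    proof (rule nn_integral_cong)
      fix w assume "w \<in> space hyp_area"
      then have "deviation z w + 2 * moment z w + 2 * moment w z = ennreal (4/3)"
        using deviation_identity[OF z] by simp
      then show "(deviation z w + (moment z w + moment z w) + (moment w z + moment w z)) * berezin z w
          = ennreal (4/3) * berezin z w"
        by (simp only: mult_2)
    qed
    also have "\<dots> = ennreal (4/3) * ennreal pi"
      unfolding nn_integral_berezin[OF z, symmetric] by (rule nn_integral_cmult[OF berezin_measurable'[OF z]])
    finally show "weight z * (\<integral>\<^sup>+w. (deviation z w + (moment z w + moment z w) + (moment w z + moment w z)) * berezin z w \<partial>hyp_area)
        = weight z * (ennreal (4/3) * ennreal pi)" by (simp only:)
  qed
  moreover have "ennreal (4/3) * ennreal pi = ennreal (4 / 3 * pi)"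
    by (rule ennreal_mult[symmetric]) auto
  ultimately have eq: "E deviation + (E moment + E moment) + (E moment + E moment) = W * ennreal (4 / 3 * pi)"
    unfolding add[OF dm2 m2'] add[OF dm m2] add[OF mm mm] add[OF mm' mm'] sym const
    by (simp only:)
  have "W * ennreal (pi / 3) = (\<integral>\<^sup>+z. weight z * ennreal (pi / 3) \<partial>hyp_area)" by (simp only: const)
  also have "\<dots> \<le> E moment"
    unfolding E_def by (intro nn_integral_mono mult_left_mono moment_mean_ge) auto
  finally have le: "W * ennreal (pi / 3) \<le> E moment" .
  have "ennreal (4 / 3 * pi) = (ennreal (pi/3) + ennreal (pi/3)) + (ennreal (pi/3) + ennreal (pi/3))"
    by (simp flip: ennreal_plus)
  then have "E deviation + W * ennreal (4 / 3 * pi)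
      = E deviation + (W * ennreal (pi/3) + W * ennreal (pi/3)) + (W * ennreal (pi/3) + W * ennreal (pi/3))"
    by (simp only: distrib_left add.assoc)
  also have "\<dots> \<le> W * ennreal (4 / 3 * pi)"
    unfolding eq[symmetric] by (intro add_mono le order_refl)
  finally have "W * ennreal (4 / 3 * pi) + E deviation \<le> W * ennreal (4 / 3 * pi) + 0"
    by (simp only: add.commute[of "E deviation"] add_0_right)
  moreover have "W * ennreal (4 / 3 * pi) < \<infinity>"
    using weight_total by (simp add: W_def ennreal_mult_less_top)
  ultimately have "E deviation \<le> 0"
    by (subst (asm) ennreal_add_left_cancel_le) auto
  then show ?thesis by (simp add: E_def)
qed

lemma constant_in_gap: "\<exists>x\<in>{a<..<b}. \<exists>c. \<forall>z\<in>disc. v x z = c"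
proof -
  interpret P: pair_sigma_finite hyp_area unit_measure ..
  have I: "(\<lambda>z. weight z * (\<integral>\<^sup>+w. deviation z w * berezin z w \<partial>hyp_area)) \<in> borel_measurable hyp_area"
    by (intro borel_measurable_times_ennreal weight_measurable hyp.borel_measurable_nn_integral) measurable
  have "AE z in hyp_area. weight z * (\<integral>\<^sup>+w. deviation z w * berezin z w \<partial>hyp_area) = 0"
    using deviation_total unfolding nn_integral_0_iff_AE[OF I] .
  \<comment> \<open>On this ball the weight is positive, so the integral over \<open>w\<close>
    itself vanishes.\<close>
  from AE_hyp_area_open[OF this, of "ball 0 r"] r_pos r_less_1
  obtain z where z: "z \<in> ball 0 r" "weight z * (\<integral>\<^sup>+w. deviation z w * berezin z w \<partial>hyp_area) = 0"
    by (auto simp: subset_ball)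
  then have zd: "z \<in> disc" using r_less_1 by auto
  have [measurable]: "(\<lambda>x. z) \<in> measurable N hyp_area" for N :: "'x measure" using zd by auto
  have fm: "(\<lambda>(w, t). ennreal ((enn2real (transition z w t) - t)\<^sup>2) * berezin z w) \<in> borel_measurable (hyp_area \<Otimes>\<^sub>M unit_measure)"
    by measurable
  have "weight z > 0" by (rule weight_pos) (use z(1) in auto)
  then have "0 = (\<integral>\<^sup>+w. deviation z w * berezin z w \<partial>hyp_area)" using z(2) by auto
  also have "\<dots> = (\<integral>\<^sup>+w. \<integral>\<^sup>+t. ennreal ((enn2real (transition z w t) - t)\<^sup>2) * berezin z w \<partial>unit_measure \<partial>hyp_area)"
    unfolding deviation_def
  proof (intro nn_integral_cong nn_integral_multc[symmetric])
    fix w assume "w \<in> space hyp_area"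
    then have [measurable]: "(\<lambda>x. w) \<in> measurable unit_measure hyp_area" by simp
    show "(\<lambda>t. ennreal ((enn2real (transition z w t) - t)\<^sup>2)) \<in> borel_measurable unit_measure" by measurable
  qed
  also have "\<dots> = (\<integral>\<^sup>+t. \<integral>\<^sup>+w. ennreal ((enn2real (transition z w t) - t)\<^sup>2) * berezin z w \<partial>hyp_area \<partial>unit_measure)"
    by (rule P.Fubini'[OF fm, symmetric])
  finally have zero: "(\<integral>\<^sup>+t. \<integral>\<^sup>+w. ennreal ((enn2real (transition z w t) - t)\<^sup>2) * berezin z w \<partial>hyp_area \<partial>unit_measure) = 0"
    by simp
  have Jm: "(\<lambda>t. \<integral>\<^sup>+w. ennreal ((enn2real (transition z w t) - t)\<^sup>2) * berezin z w \<partial>hyp_area) \<in> borel_measurable unit_measure"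
    by (rule hyp.borel_measurable_nn_integral) measurable
  \<comment> \<open>With the order of integration exchanged, one level \<open>t\<close> serves
    almost every \<open>w\<close>.\<close>
  have "AE t in unit_measure. (\<integral>\<^sup>+w. ennreal ((enn2real (transition z w t) - t)\<^sup>2) * berezin z w \<partial>hyp_area) = 0"
    using zero unfolding nn_integral_0_iff_AE[OF Jm] .
  from AE_unit_ex[OF this] obtain t where t: "0 < t" "t < 1"
    and t0: "(\<integral>\<^sup>+w. ennreal ((enn2real (transition z w t) - t)\<^sup>2) * berezin z w \<partial>hyp_area) = 0"
    by blast
  have [measurable]: "(\<lambda>x. t) \<in> measurable hyp_area unit_measure" using t by (auto simp: space_unit_measure)
  have Km: "(\<lambda>w. ennreal ((enn2real (transition z w t) - t)\<^sup>2) * berezin z w) \<in> borel_measurable hyp_area"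
    by measurable
  let ?x = "passage z t"
  note x = passage_Icc[OF zd t]
  have "AE w in hyp_area. ennreal ((enn2real (transition z w t) - t)\<^sup>2) * berezin z w = 0"
    using t0 unfolding nn_integral_0_iff_AE[OF Km] .
  then have le: "AE w in hyp_area. v ?x w \<le> t"
    using AE_space
  proof eventually_elim
    fix w assume a: "ennreal ((enn2real (transition z w t) - t)\<^sup>2) * berezin z w = 0" and "w \<in> space hyp_area"
    then have w: "w \<in> disc" by simp
    have "0 < 1 + sinh_dist z w" using sinh_dist_nonneg[OF zd w] by linarith
    then have "berezin z w \<noteq> 0" by (simp add: berezin_def ennreal_eq_0_iff)
    then have "(enn2real (transition z w t) - t)\<^sup>2 \<le> 0" using a by (simp add: ennreal_eq_0_iff)
    then have "enn2real (transition z w t) = t" by simp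
    moreover obtain \<eta> where "0 \<le> \<eta>" "transition z w t = ennreal \<eta>" using transition_real[OF w] by blast
    ultimately have "transition z w t = ennreal t" by simp
    then show "v ?x w \<le> t" using transition_ge[OF zd w t] t by (simp add: ennreal_le_iff)
  qed
  have vm [measurable]: "v ?x \<in> borel_measurable hyp_area" by (rule v_measurable[OF x])
  have bz [measurable]: "berezin z \<in> borel_measurable hyp_area" by (rule berezin_measurable'[OF zd])
  \<comment> \<open>\<open>t - v ?x w\<close> is nonnegative for almost every \<open>w\<close>.
    Adding the mean \<open>pi * t\<close> of \<open>v ?x\<close> gives the mean of the constant
    \<open>t\<close>, which is \<open>pi * t\<close> as well, so the defect has mean 0.\<close>
  have Lm: "(\<lambda>w. ennreal (t - v ?x w) * berezin z w) \<in> borel_measurable hyp_area" by measurable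
  have Lm': "(\<lambda>w. ennreal (v ?x w) * berezin z w) \<in> borel_measurable hyp_area" by measurable
  have "(\<integral>\<^sup>+w. ennreal (t - v ?x w) * berezin z w \<partial>hyp_area) + ennreal (pi * t)
      = (\<integral>\<^sup>+w. ennreal (t - v ?x w) * berezin z w + ennreal (v ?x w) * berezin z w \<partial>hyp_area)"
    unfolding passage_mean_value[OF zd t, symmetric] by (rule nn_integral_add[OF Lm Lm', symmetric])
  also have "\<dots> = (\<integral>\<^sup>+w. ennreal t * berezin z w \<partial>hyp_area)"
  proof (rule nn_integral_cong_AE)
    show "AE w in hyp_area. ennreal (t - v ?x w) * berezin z w + ennreal (v ?x w) * berezin z w = ennreal t * berezin z w"
      using le AE_space
    proof eventually_elim
      fix w assume "v ?x w \<le> t" "w \<in> space hyp_area"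
      then have "ennreal (t - v ?x w) + ennreal (v ?x w) = ennreal t"
        using v_bounds[OF x, of w] by (subst ennreal_plus[symmetric]) auto
      then show "ennreal (t - v ?x w) * berezin z w + ennreal (v ?x w) * berezin z w = ennreal t * berezin z w"
        by (simp only: distrib_right[symmetric])
    qed
  qed
  also have "\<dots> = ennreal t * ennreal pi"
    unfolding nn_integral_berezin[OF zd, symmetric] by (rule nn_integral_cmult[OF bz])
  also have "\<dots> = 0 + ennreal (pi * t)" using t by (simp add: ennreal_mult[symmetric] mult.commute)
  finally have "ennreal (pi * t) + (\<integral>\<^sup>+w. ennreal (t - v ?x w) * berezin z w \<partial>hyp_area) = ennreal (pi * t) + 0"
    by (simp only: add.commute)
  then have "(\<integral>\<^sup>+w. ennreal (t - v ?x w) * berezin z w \<partial>hyp_area) = 0"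
    by (subst (asm) ennreal_add_left_cancel) auto
  then have "AE w in hyp_area. ennreal (t - v ?x w) * berezin z w = 0"
    unfolding nn_integral_0_iff_AE[OF Lm] .
  then have "AE w in hyp_area. v ?x w = t"
    using le AE_space
  proof eventually_elim
    fix w assume a: "ennreal (t - v ?x w) * berezin z w = 0" "v ?x w \<le> t" and "w \<in> space hyp_area"
    then have w: "w \<in> disc" by simp
    have "0 < 1 + sinh_dist z w" using sinh_dist_nonneg[OF zd w] by linarith
    then have "berezin z w \<noteq> 0" by (simp add: berezin_def ennreal_eq_0_iff)
    then show "v ?x w = t" using a by (simp add: ennreal_eq_0_iff)
  qed
  then have "v ?x w = t" if "w \<in> disc" for w
    by (rule AE_hyp_area_continuous_eq[OF v_cont_z[OF x] _ that])
  then show ?thesis using passage_Ioo[OF zd t] by blast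
qed

end

subsection \<open>Gaps between constant functions\<close>

lemma harmonic_on_affine:
  assumes "harmonic_on S h"
  shows "harmonic_on S (\<lambda>z. p * h z + q)"
proof -
  obtain hx hy hxx hxy hyx hyy where
    h: "\<And>z. z \<in> S \<Longrightarrow> (h has_derivative (\<lambda>v. hx z * Re v + hy z * Im v)) (at z)" and
    hx: "\<And>z. z \<in> S \<Longrightarrow> (hx has_derivative (\<lambda>v. hxx z * Re v + hxy z * Im v)) (at z)" and
    hy: "\<And>z. z \<in> S \<Longrightarrow> (hy has_derivative (\<lambda>v. hyx z * Re v + hyy z * Im v)) (at z)" and
    lap: "\<And>z. z \<in> S \<Longrightarrow> hxx z + hyy z = 0" and
    cont: "continuous_on S hxx" "continuous_on S hxy" "continuous_on S hyx" "continuous_on S hyy"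
    using assms unfolding harmonic_on_def by blast
  have der: "((\<lambda>z. p * f z + c) has_derivative (\<lambda>v. (p * A) * Re v + (p * B) * Im v)) (at z)"
    if "(f has_derivative (\<lambda>v. A * Re v + B * Im v)) (at z)" for f :: "complex \<Rightarrow> real" and A B c z
  proof -
    have "((\<lambda>z. p * f z + c) has_derivative (\<lambda>v. p * (A * Re v + B * Im v) + 0)) (at z)"
      by (intro has_derivative_add has_derivative_mult_right that has_derivative_const)
    then show ?thesis by (simp add: algebra_simps)
  qed
  show ?thesis
    unfolding harmonic_on_def
  proof (intro exI conjI ballI)
    fix z assume z: "z \<in> S"
    show "((\<lambda>z. p * h z + q) has_derivative (\<lambda>v. (p * hx z) * Re v + (p * hy z) * Im v)) (at z)"
      by (rule der[OF h[OF z]])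
    show "((\<lambda>z. p * hx z) has_derivative (\<lambda>v. (p * hxx z) * Re v + (p * hxy z) * Im v)) (at z)"
      using der[OF hx[OF z], of 0] by simp
    show "((\<lambda>z. p * hy z) has_derivative (\<lambda>v. (p * hyx z) * Re v + (p * hyy z) * Im v)) (at z)"
      using der[OF hy[OF z], of 0] by simp
    show "p * hxx z + p * hyy z = 0" using lap[OF z] by (metis distrib_left mult_zero_right)
  qed (intro continuous_intros cont)+
qed

lemma harmonic_on_continuous:
  assumes "harmonic_on S h"
  shows "continuous_on S h"
proof (rule continuous_at_imp_continuous_on, intro ballI)
  fix z assume "z \<in> S"
  with assms obtain D where "(h has_derivative D) (at z)" unfolding harmonic_on_def by blast
  then show "isCont h z" by (rule has_derivative_continuous)
qed

text \<open>The nonnegative harmonic function \<open>M - h\<close> vanishes at \<open>z\<close>, so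
  its mean against the positive kernel is 0 and it vanishes almost everywhere, hence everywhere by
  continuity.\<close>

lemma harmonic_maximum_principle:
  assumes h: "harmonic_on disc h" and le: "\<And>z. z \<in> disc \<Longrightarrow> h z \<le> M" and z: "z \<in> disc" "h z = M"
    and w: "w \<in> disc"
  shows "h w = M"
proof -
  have h': "harmonic_on disc (\<lambda>z. (- 1) * h z + M)" by (rule harmonic_on_affine[OF h])
  have hm: "h \<in> borel_measurable hyp_area"
    by (rule borel_measurable_hyp_area_continuous[OF harmonic_on_continuous[OF h]])
  have bz: "berezin z \<in> borel_measurable hyp_area" by (rule berezin_measurable'[OF z(1)])
  have m: "(\<lambda>w. ennreal ((- 1) * h w + M) * berezin z w) \<in> borel_measurable hyp_area"
    by (rule borel_measurable_times_ennreal[OF _ bz]) (use hm in measurable)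
  have "(\<integral>\<^sup>+w. ennreal ((- 1) * h w + M) * berezin z w \<partial>hyp_area) = ennreal (pi * ((- 1) * h z + M))"
    by (rule harmonic_mean_value[OF h' _ z(1)]) (use le in force)
  also have "\<dots> = 0" using z(2) by simp
  finally have "AE w in hyp_area. ennreal ((- 1) * h w + M) * berezin z w = 0"
    unfolding nn_integral_0_iff_AE[OF m] .
  then have "AE w in hyp_area. h w = M"
    using AE_space
  proof eventually_elim
    fix w assume a: "ennreal ((- 1) * h w + M) * berezin z w = 0" and "w \<in> space hyp_area"
    then have w: "w \<in> disc" by simp
    have "0 < 1 + sinh_dist z w" using sinh_dist_nonneg[OF z(1) w] by linarith
    then have "berezin z w \<noteq> 0" by (simp add: berezin_def ennreal_eq_0_iff)
    then show "h w = M" using a le[OF w] by (simp add: ennreal_eq_0_iff)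
  qed
  then show ?thesis
    by (rule AE_hyp_area_continuous_eq[OF harmonic_on_continuous[OF h] _ w])
qed

text \<open>Gap ends carry constant functions, where the action is not under control; one-sided
  limits stand in for the images of the ends.\<close>

lemma strict_mono_on_image_tendsto:
  fixes f :: "real \<Rightarrow> real"
  assumes ab: "a < b" and mono: "strict_mono_on {a<..<b} f" and img: "f ` {a<..<b} = {a'<..<b'}"
  shows "(f \<longlongrightarrow> a') (at_right a)" "(f \<longlongrightarrow> b') (at_left b)"
proof -
  have maps: "a' < f x \<and> f x < b'" if "x \<in> {a<..<b}" for x
    using img imageI[OF that, of f] by auto
  have a'b': "a' < b'" using maps[of "(a + b) / 2"] ab by auto
  show "(f \<longlongrightarrow> a') (at_right a)"
  proof (rule order_tendstoI)
    fix y assume "y < a'"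
    then show "eventually (\<lambda>x. y < f x) (at_right a)"
      using maps ab by (force simp: eventually_at_right_field)
  next
    fix y assume y: "a' < y"
    \<comment> \<open>The minimum keeps \<open>c\<close> inside the image interval when
      \<open>y\<close> lies beyond \<open>b'\<close>.\<close>
    define c where "c = (a' + min y b') / 2"
    have c: "c \<in> {a'<..<b'}" "c < y" using y a'b' by (auto simp: c_def min_def)
    then obtain x1 where x1: "x1 \<in> {a<..<b}" "f x1 = c" using img by (metis imageE)
    have "f x < y" if "a < x" "x < x1" for x
      using strict_mono_onD[OF mono _ x1(1) that(2)] that x1 c(2) by auto
    then show "eventually (\<lambda>x. f x < y) (at_right a)"
      using x1(1) by (auto simp: eventually_at_right_field)
  qed
  show "(f \<longlongrightarrow> b') (at_left b)"
  proof (rule order_tendstoI)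
    fix y assume "b' < y"
    then show "eventually (\<lambda>x. f x < y) (at_left b)"
      using maps ab by (force simp: eventually_at_left_field)
  next
    fix y assume y: "y < b'"
    define c where "c = (b' + max y a') / 2"
    have c: "c \<in> {a'<..<b'}" "y < c" using y a'b' by (auto simp: c_def max_def)
    then obtain x1 where x1: "x1 \<in> {a<..<b}" "f x1 = c" using img by (metis imageE)
    have "y < f x" if "x1 < x" "x < b" for x
      using strict_mono_onD[OF mono x1(1) _ that(1)] that x1 c(2) by auto
    then show "eventually (\<lambda>x. y < f x) (at_left b)"
      using x1(1) by (auto simp: eventually_at_left_field)
  qed
qed

section \<open>Gaps as components of the set of nonconstant parameters\<close>

text \<open>The action is described on \<open>N\<close> only, so a circle cut open at a constant
  point fits although the group may move the cut. The ends of the parameter interval are constant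
  points, so every component of \<open>N\<close> is an open interval.\<close>

locale interval_system = cocompact_lattice \<Gamma> r for \<Gamma> r +
  fixes v :: "real \<Rightarrow> complex \<Rightarrow> real" and \<psi> :: "(complex \<Rightarrow> complex) \<Rightarrow> real \<Rightarrow> real" and N :: "real set"
  assumes v_cont: "continuous_on ({0..1} \<times> disc) (\<lambda>(x, z). v x z)"
    and v_harmonic: "x \<in> {0..1} \<Longrightarrow> harmonic_on disc (v x)"
    and N_eq: "N = {x \<in> {0..1}. \<not> (\<exists>c. \<forall>z\<in>disc. v x z = c)}"
    and endpoints: "0 \<notin> N" "1 \<notin> N"
    and \<psi>_closed: "\<gamma> \<in> \<Gamma> \<Longrightarrow> x \<in> N \<Longrightarrow> \<psi> \<gamma> x \<in> N"
    and \<psi>_cont: "\<gamma> \<in> \<Gamma> \<Longrightarrow> continuous_on N (\<psi> \<gamma>)"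
    and \<psi>_one: "x \<in> N \<Longrightarrow> \<psi> \<one>\<^bsub>hyp_isometries\<^esub> x = x"
    and \<psi>_product: "\<gamma> \<in> \<Gamma> \<Longrightarrow> \<delta> \<in> \<Gamma> \<Longrightarrow> x \<in> N \<Longrightarrow> \<psi> (product_elt \<gamma> \<delta>) x = \<psi> \<gamma> (\<psi> \<delta> x)"
    and v_equivariant: "\<gamma> \<in> \<Gamma> \<Longrightarrow> x \<in> N \<Longrightarrow> z \<in> disc \<Longrightarrow> v (\<psi> \<gamma> x) (\<gamma> z) = v x z"
begin

lemma v_cont_x:
  assumes "z \<in> disc"
  shows "continuous_on {0..1} (\<lambda>x. v x z)"
proof -
  have c: "continuous_on {0..1} (\<lambda>x::real. (x, z))" by (intro continuous_intros)
  have "(\<lambda>x. (x, z)) ` {0..1} \<subseteq> {0..1} \<times> disc" using assms by auto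
  from continuous_on_compose2[OF v_cont c this] show ?thesis by simp
qed

lemma constant_outside:
  assumes "x \<in> {0..1}" "x \<notin> N" "z \<in> disc"
  shows "v x z = v x 0"
proof -
  obtain c where "\<forall>z\<in>disc. v x z = c" using assms by (auto simp: N_eq)
  then have "v x z = c" "v x 0 = c" using assms(3) by auto
  then show ?thesis by simp
qed

lemma \<psi>_inverse:
  assumes "\<gamma> \<in> \<Gamma>" "x \<in> N"
  shows "\<psi> (inverse_elt \<gamma>) (\<psi> \<gamma> x) = x" "\<psi> \<gamma> (\<psi> (inverse_elt \<gamma>) x) = x"
  using \<psi>_product[OF inverse_closed[OF assms(1)] assms(1,2)] \<psi>_product[OF assms(1) inverse_closed[OF assms(1)] assms(2)]
  by (simp_all add: inverse_product[OF assms(1)] \<psi>_one[OF assms(2)])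

definition gap :: "real \<Rightarrow> real \<Rightarrow> bool" where
  "gap a b \<longleftrightarrow> 0 \<le> a \<and> a < b \<and> b \<le> 1 \<and> a \<notin> N \<and> b \<notin> N \<and> {a<..<b} \<subseteq> N"

lemma gapD:
  assumes "gap a b"
  shows "a < b" "a \<in> {0..1}" "b \<in> {0..1}" "a \<notin> N" "b \<notin> N" "\<And>x. x \<in> {a<..<b} \<Longrightarrow> x \<in> N"
    "\<And>x. x \<in> {a<..<b} \<Longrightarrow> x \<in> {0..1}"
  using assms unfolding gap_def by auto

lemma closed_constant: "closed {x \<in> {0..1}. x \<notin> N}"
proof -
  have "closed {x \<in> {0..1}. v x z - v x 0 = 0}" if "z \<in> disc" for z
  proof (rule continuous_closed_preimage_constant)
    show "continuous_on {0..1} (\<lambda>x. v x z - v x 0)"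
      by (rule continuous_on_diff[OF v_cont_x[OF that] v_cont_x]) simp
  qed simp
  then have "closed (\<Inter>z\<in>disc. {x \<in> {0..1}. v x z - v x 0 = 0})" by (rule closed_INT[OF ballI])
  moreover have "{x \<in> {0..1}. x \<notin> N} = (\<Inter>z\<in>disc. {x \<in> {0..1}. v x z - v x 0 = 0})"
  proof (intro equalityI subsetI)
    fix x assume x: "x \<in> (\<Inter>z\<in>disc. {x \<in> {0..1}. v x z - v x 0 = 0})"
    have *: "x \<in> {0..1} \<and> v x z = v x 0" if "z \<in> disc" for z using INT_D[OF x that] by simp
    have "x \<in> {0..1}" using *[of 0] by simp
    moreover have "\<exists>c. \<forall>z\<in>disc. v x z = c" using * by (intro exI ballI) (rule conjunct2)
    ultimately show "x \<in> {x \<in> {0..1}. x \<notin> N}" unfolding N_eq mem_Collect_eq by blast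
  next
    fix x assume "x \<in> {x \<in> {0..1}. x \<notin> N}"
    then have "x \<in> {0..1}" "x \<notin> N" by simp_all
    note c = constant_outside[OF this]
    show "x \<in> (\<Inter>z\<in>disc. {x \<in> {0..1}. v x z - v x 0 = 0})"
      by (rule INT_I) (simp only: mem_Collect_eq \<open>x \<in> {0..1}\<close> c diff_self simp_thms)
  qed
  ultimately show ?thesis by (simp only:)
qed

lemma gap_exists:
  assumes x: "x \<in> N"
  obtains a b where "gap a b" "x \<in> {a<..<b}"
proof -
  have x01: "x \<in> {0..1}" using x by (auto simp: N_eq)
  let ?L = "{y \<in> {0..1}. y \<notin> N} \<inter> {..x}" and ?R = "{y \<in> {0..1}. y \<notin> N} \<inter> {x..}"
  have "0 \<in> ?L" "1 \<in> ?R" using endpoints x01 by auto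
  then have ne: "?L \<noteq> {}" "?R \<noteq> {}" by blast+
  have "bdd_above ?L" "bdd_below ?R" by (auto intro: bdd_aboveI[of _ x] bdd_belowI[of _ x])
  moreover have "closed ?L" "closed ?R"
    by (intro closed_Int closed_constant closed_atMost closed_atLeast)+
  ultimately have L: "?L \<noteq> {}" "bdd_above ?L" "closed ?L" and R: "?R \<noteq> {}" "bdd_below ?R" "closed ?R"
    using ne by blast+
  define a where "a = Sup ?L"
  define b where "b = Inf ?R"
  have a: "a \<in> {0..1}" "a \<notin> N" "a \<le> x" using closed_contains_Sup[OF L] by (auto simp: a_def)
  have b: "b \<in> {0..1}" "b \<notin> N" "x \<le> b" using closed_contains_Inf[OF R] by (auto simp: b_def)
  have "a \<noteq> x" "b \<noteq> x" using a(2) b(2) x by blast+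
  then have xab: "x \<in> {a<..<b}" using a(3) b(3) by simp
  have "y \<in> N" if y: "y \<in> {a<..<b}" for y
  proof (rule ccontr)
    assume "y \<notin> N"
    moreover have "y \<in> {0..1}" using y a b by auto
    ultimately have "y \<in> ?L \<or> y \<in> ?R" by auto
    then have "y \<le> a \<or> b \<le> y"
      using cSup_upper[OF _ L(2), of y] cInf_lower[OF _ R(2), of y] unfolding a_def b_def by blast
    then show False using y by auto
  qed
  then have "gap a b" using a b xab unfolding gap_def by auto
  then show ?thesis using xab by (rule that)
qed

lemma connected_in_gap:
  assumes g: "gap a b" and I: "connected I" "I \<subseteq> N" and p: "p \<in> I" "p \<in> {a<..<b}"
  shows "I \<subseteq> {a<..<b}"
proof
  fix y assume y: "y \<in> I"
  have "\<not> y \<le> a"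
  proof
    assume "y \<le> a"
    then have "a \<in> {y..p}" using p by auto
    then show False using connected_contains_Icc[OF I(1) y p(1)] I(2) gapD(4)[OF g] by blast
  qed
  moreover have "\<not> b \<le> y"
  proof
    assume "b \<le> y"
    then have "b \<in> {p..y}" using p by auto
    then show False using connected_contains_Icc[OF I(1) p(1) y] I(2) gapD(5)[OF g] by blast
  qed
  ultimately show "y \<in> {a<..<b}" by auto
qed

lemma gap_unique:
  assumes g: "gap a b" "gap a' b'" and x: "x \<in> {a<..<b}" "x \<in> {a'<..<b'}"
  shows "a = a' \<and> b = b'"
proof -
  have "{a<..<b} \<subseteq> {a'<..<b'}"
    by (rule connected_in_gap[OF g(2) _ _ x]) (use gapD(6)[OF g(1)] in auto)
  moreover have "{a'<..<b'} \<subseteq> {a<..<b}"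
    by (rule connected_in_gap[OF g(1) _ _ x(2,1)]) (use gapD(6)[OF g(2)] in auto)
  ultimately show ?thesis
    using gapD(1)[OF g(1)] gapD(1)[OF g(2)] by (simp add: greaterThanLessThan_subseteq_greaterThanLessThan)
qed

text \<open>Images of connected sets stay within one gap; applied to \<open>\<gamma>\<close> and to
  its inverse this gives both inclusions.\<close>

lemma gap_image:
  assumes \<gamma>: "\<gamma> \<in> \<Gamma>" and g: "gap a b"
  obtains a' b' where "gap a' b'" "\<psi> \<gamma> ` {a<..<b} = {a'<..<b'}"
proof -
  let ?m = "(a + b) / 2"
  have m: "?m \<in> {a<..<b}" using gapD(1)[OF g] by auto
  have sub: "{a<..<b} \<subseteq> N" using gapD(6)[OF g] by blast
  have mN: "?m \<in> N" using m sub by blast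
  obtain a' b' where g': "gap a' b'" "\<psi> \<gamma> ?m \<in> {a'<..<b'}" using gap_exists[OF \<psi>_closed[OF \<gamma> mN]] by blast
  have sub': "{a'<..<b'} \<subseteq> N" using gapD(6)[OF g'(1)] by blast
  have i\<gamma>: "inverse_elt \<gamma> \<in> \<Gamma>" by (rule inverse_closed[OF \<gamma>])
  have 1: "\<psi> \<gamma> ` {a<..<b} \<subseteq> {a'<..<b'}"
  proof (rule connected_in_gap[OF g'(1), where p = "\<psi> \<gamma> ?m"])
    show "connected (\<psi> \<gamma> ` {a<..<b})"
      by (rule connected_continuous_image[OF continuous_on_subset[OF \<psi>_cont[OF \<gamma>] sub]]) simp
    show "\<psi> \<gamma> ` {a<..<b} \<subseteq> N" using \<psi>_closed[OF \<gamma>] sub by blast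
  qed (intro imageI m g'(2))+
  have 2: "\<psi> (inverse_elt \<gamma>) ` {a'<..<b'} \<subseteq> {a<..<b}"
  proof (rule connected_in_gap[OF g, where p = "\<psi> (inverse_elt \<gamma>) (\<psi> \<gamma> ?m)"])
    show "connected (\<psi> (inverse_elt \<gamma>) ` {a'<..<b'})"
      by (rule connected_continuous_image[OF continuous_on_subset[OF \<psi>_cont[OF i\<gamma>] sub']]) simp
    show "\<psi> (inverse_elt \<gamma>) ` {a'<..<b'} \<subseteq> N" using \<psi>_closed[OF i\<gamma>] sub' by blast
    show "\<psi> (inverse_elt \<gamma>) (\<psi> \<gamma> ?m) \<in> {a<..<b}" unfolding \<psi>_inverse(1)[OF \<gamma> mN] by (rule m)
  qed (intro imageI g'(2))
  have "{a'<..<b'} \<subseteq> \<psi> \<gamma> ` {a<..<b}"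
  proof
    fix y assume y: "y \<in> {a'<..<b'}"
    have "\<psi> (inverse_elt \<gamma>) y \<in> {a<..<b}" using 2 y by blast
    moreover have "\<psi> \<gamma> (\<psi> (inverse_elt \<gamma>) y) = y" using \<psi>_inverse(2)[OF \<gamma>] sub' y by blast
    ultimately show "y \<in> \<psi> \<gamma> ` {a<..<b}" by (metis imageI)
  qed
  then show ?thesis using that[OF g'(1)] 1 by blast
qed

lemma \<psi>_inj_on: "\<gamma> \<in> \<Gamma> \<Longrightarrow> inj_on (\<psi> \<gamma>) N"
  by (rule inj_on_inverseI[where g = "\<psi> (inverse_elt \<gamma>)"]) (rule \<psi>_inverse(1))

text \<open>Pass to the limit along \<open>F\<close> in the equivariance relation at the point 0. It
  yields the value of \<open>v q\<close> at \<open>\<gamma> 0\<close>, which agrees with that at 0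
  because \<open>v q\<close> is constant.\<close>

lemma boundary_value_transfer:
  assumes \<gamma>: "\<gamma> \<in> \<Gamma>" and F: "F \<noteq> bot" "eventually (\<lambda>x. x \<in> N) F" and p: "((\<lambda>x. x) \<longlongrightarrow> p) F"
    and q: "(\<psi> \<gamma> \<longlongrightarrow> q) F" and pq: "p \<in> {0..1}" "p \<notin> N" "q \<in> {0..1}" "q \<notin> N"
  shows "v q 0 = v p 0"
proof -
  have \<gamma>0: "\<gamma> 0 \<in> disc" by (rule in_disc[OF \<gamma>]) simp
  have N01: "x \<in> {0..1}" if "x \<in> N" for x using that by (auto simp: N_eq)
  have 1: "((\<lambda>x. v x 0) \<longlongrightarrow> v p 0) F"
    by (rule continuous_on_tendsto_compose[OF v_cont_x p pq(1)])
      (simp, rule eventually_mono[OF F(2)], rule N01)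
  have "((\<lambda>x. v (\<psi> \<gamma> x) (\<gamma> 0)) \<longlongrightarrow> v q (\<gamma> 0)) F"
    by (rule continuous_on_tendsto_compose[OF v_cont_x[OF \<gamma>0] q pq(3)])
       (rule eventually_mono[OF F(2)], rule N01, rule \<psi>_closed[OF \<gamma>])
  moreover have "eventually (\<lambda>x. v (\<psi> \<gamma> x) (\<gamma> 0) = v x 0) F"
    by (rule eventually_mono[OF F(2)]) (rule v_equivariant[OF \<gamma>], auto)
  ultimately have "((\<lambda>x. v x 0) \<longlongrightarrow> v q (\<gamma> 0)) F" by (rule Lim_transform_eventually)
  then have "v q (\<gamma> 0) = v p 0" using tendsto_unique[OF F(1) _ 1] by blast
  then show ?thesis using constant_outside[OF pq(3,4) \<gamma>0] by simp
qed

text \<open>An injective continuous map on an interval is monotone, and its direction decides which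
  ends correspond. Monotonicity is recorded in the first alternative because different boundary
  values exclude the second one for a preserved gap.\<close>

lemma gap_image_boundary:
  assumes \<gamma>: "\<gamma> \<in> \<Gamma>" and g: "gap a b" and g': "gap a' b'" and img: "\<psi> \<gamma> ` {a<..<b} = {a'<..<b'}"
  shows "strict_mono_on {a<..<b} (\<psi> \<gamma>) \<and> v a' 0 = v a 0 \<and> v b' 0 = v b 0 \<or>
    v a' 0 = v b 0 \<and> v b' 0 = v a 0"
proof -
  have sub: "{a<..<b} \<subseteq> N" using gapD(6)[OF g] by blast
  note ab = gapD(1)[OF g]
  have evr: "eventually (\<lambda>x. x \<in> N) (at_right a)"
    unfolding eventually_at_right_field using ab sub by (intro exI[of _ b]) auto
  have evl: "eventually (\<lambda>x. x \<in> N) (at_left b)"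
    unfolding eventually_at_left_field using ab sub by (intro exI[of _ a]) auto
  note tr = boundary_value_transfer[OF \<gamma> trivial_limit_at_right_real evr tendsto_ident_at]
  note tl = boundary_value_transfer[OF \<gamma> trivial_limit_at_left_real evl tendsto_ident_at]
  have "strict_mono_on {a<..<b} (\<psi> \<gamma>) \<or> strict_antimono_on {a<..<b} (\<psi> \<gamma>)"
    using injective_eq_monotone_map[OF _ continuous_on_subset[OF \<psi>_cont[OF \<gamma>] sub]]
      inj_on_subset[OF \<psi>_inj_on[OF \<gamma>] sub] by (simp add: is_interval_oo)
  then show ?thesis
  proof
    assume m: "strict_mono_on {a<..<b} (\<psi> \<gamma>)"
    note t = strict_mono_on_image_tendsto[OF ab m img]
    have "v a' 0 = v a 0" by (rule tr[OF t(1)]) (use gapD[OF g] gapD[OF g'] in auto)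
    moreover have "v b' 0 = v b 0" by (rule tl[OF t(2)]) (use gapD[OF g] gapD[OF g'] in auto)
    ultimately show ?thesis using m by blast
  next
    assume m: "strict_antimono_on {a<..<b} (\<psi> \<gamma>)"
    \<comment> \<open>Negation reduces the decreasing case to an increasing map with target ends
      \<open>- b'\<close> and \<open>- a'\<close>.\<close>
    have m': "strict_mono_on {a<..<b} (\<lambda>x. - \<psi> \<gamma> x)"
      using m by (auto simp: monotone_on_def)
    have img': "(\<lambda>x. - \<psi> \<gamma> x) ` {a<..<b} = {- b'<..<- a'}"
    proof -
      have "(\<lambda>x. - \<psi> \<gamma> x) ` {a<..<b} = uminus ` (\<psi> \<gamma> ` {a<..<b})" by (simp add: image_image)
      then show ?thesis by (simp add: img)
    qed
    note t = strict_mono_on_image_tendsto[OF ab m' img']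
    have t1: "(\<psi> \<gamma> \<longlongrightarrow> b') (at_right a)" and t2: "(\<psi> \<gamma> \<longlongrightarrow> a') (at_left b)"
      using tendsto_minus[OF t(1)] tendsto_minus[OF t(2)] by simp_all
    have "v b' 0 = v a 0" by (rule tr[OF t1]) (use gapD[OF g] gapD[OF g'] in auto)
    moreover have "v a' 0 = v b 0" by (rule tl[OF t2]) (use gapD[OF g] gapD[OF g'] in auto)
    ultimately show ?thesis by blast
  qed
qed

text \<open>The supremum over all translates of the gap is attained on a compact set. At a point of a
  translate this contradicts the maximum principle; any other maximum point is a limit of end points
  of translates.\<close>

lemma gap_maximum:
  assumes g: "gap a b" and x1: "x1 \<in> {a<..<b}" and z1: "z1 \<in> disc" and \<sigma>: "\<sigma> \<noteq> 0"
  shows "\<sigma> * v x1 z1 \<le> max (\<sigma> * v a 0) (\<sigma> * v b 0)"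
proof -
  \<comment> \<open>The factor \<open>\<sigma>\<close>, later 1 and -1, treats upper and lower
    bounds at once.\<close>
  define m where "m = max (\<sigma> * v a 0) (\<sigma> * v b 0)"
  define G where "G = (\<Union>\<gamma>\<in>\<Gamma>. \<psi> \<gamma> ` {a<..<b})"
  have GN: "G \<subseteq> N" using \<psi>_closed gapD(6)[OF g] by (auto simp: G_def)
  have N01: "N \<subseteq> {0..1}" by (auto simp: N_eq)
  have cG: "closure G \<subseteq> {0..1}" by (rule closure_minimal) (use GN N01 in auto)
  have kd: "cball 0 r \<subseteq> disc" using r_less_1 by auto
  have G_trans: "\<psi> \<gamma> x \<in> G" if "\<gamma> \<in> \<Gamma>" "x \<in> G" for \<gamma> x
  proof -
    obtain \<delta> x' where d: "\<delta> \<in> \<Gamma>" "x' \<in> {a<..<b}" "x = \<psi> \<delta> x'" using \<open>x \<in> G\<close> by (auto simp: G_def)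
    have "\<psi> \<gamma> x = \<psi> (product_elt \<gamma> \<delta>) x'" using \<psi>_product[OF that(1) d(1) gapD(6)[OF g d(2)]] d(3) by simp
    then show ?thesis using product_closed[OF that(1) d(1)] d(2) unfolding G_def by blast
  qed
  have inG: "{a<..<b} \<subseteq> G"
    unfolding G_def using one_closed \<psi>_one gapD(6)[OF g] by force
  have ne: "closure G \<times> cball (0::complex) r \<noteq> {}" using inG x1 r_pos closure_subset by fastforce
  have "compact (closure G)" using cG by (meson bounded_closed_interval bounded_subset closed_closure compact_eq_bounded_closed)
  then have "compact (closure G \<times> cball (0::complex) r)" by (intro compact_Times compact_cball)
  moreover have "continuous_on (closure G \<times> cball 0 r) (\<lambda>p. \<sigma> * (case p of (x, z) \<Rightarrow> v x z))"
    by (intro continuous_on_mult_left continuous_on_subset[OF v_cont]) (use cG kd in blast)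
  ultimately obtain p where p: "p \<in> closure G \<times> cball 0 r"
    "\<And>q. q \<in> closure G \<times> cball 0 r \<Longrightarrow> \<sigma> * (case q of (x, z) \<Rightarrow> v x z) \<le> \<sigma> * (case p of (x, z) \<Rightarrow> v x z)"
    using continuous_attains_sup[OF _ ne] by blast
  obtain x z where xz: "p = (x, z)" by (cases p)
  have x: "x \<in> closure G" and z: "z \<in> cball 0 r" using p(1) xz by auto
  have zd: "z \<in> disc" using z kd by blast
  have x01: "x \<in> {0..1}" using x cG by blast
  \<comment> \<open>The group brings \<open>w\<close> into the compact ball and keeps
    \<open>G\<close> invariant, so the maximum over the compact set bounds all of \<open>G\<close>
    times the disc.\<close>
  have sup: "\<sigma> * v y w \<le> \<sigma> * v x z" if y: "y \<in> G" and w: "w \<in> disc" for y w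
  proof -
    obtain \<gamma> where \<gamma>: "\<gamma> \<in> \<Gamma>" "\<gamma> w \<in> cball 0 r" using covering[OF w] by blast
    have "\<psi> \<gamma> y \<in> closure G" using G_trans[OF \<gamma>(1) y] closure_subset by blast
    then have "\<sigma> * v (\<psi> \<gamma> y) (\<gamma> w) \<le> \<sigma> * v x z" using p(2)[of "(\<psi> \<gamma> y, \<gamma> w)"] \<gamma>(2) xz by auto
    then show ?thesis using v_equivariant[OF \<gamma>(1) _ w] y GN by (metis subsetD)
  qed
  have "\<sigma> * v x z \<le> m"
  proof (cases "x \<in> G")
    case True
    have "harmonic_on disc (\<lambda>w. \<sigma> * v x w + 0)"
      by (rule harmonic_on_affine[OF v_harmonic[OF x01]])
    from harmonic_maximum_principle[OF this, of "\<sigma> * v x z" z]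
    have "\<sigma> * v x w = \<sigma> * v x z" if "w \<in> disc" for w using sup[OF True] zd that by simp
    then have "\<forall>w\<in>disc. v x w = v x z" using \<sigma> by simp
    then have "x \<notin> N" unfolding N_eq by blast
    then show ?thesis using True GN by blast
  next
    case False
    show ?thesis
    proof (rule ccontr)
      assume "\<not> \<sigma> * v x z \<le> m"
      then have e: "0 < \<sigma> * v x z - m" by simp
      have "continuous_on {0..1} (\<lambda>x. \<sigma> * v x z)" by (intro continuous_on_mult_left v_cont_x[OF zd])
      then obtain d where d: "d > 0" "\<And>y. y \<in> {0..1} \<Longrightarrow> dist y x < d \<Longrightarrow> dist (\<sigma> * v y z) (\<sigma> * v x z) < \<sigma> * v x z - m"
        using x01 e unfolding continuous_on_iff by metis
      obtain x' where x': "x' \<in> G" "dist x' x < d" using x d(1) by (meson closure_approachable)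
      obtain \<gamma> where \<gamma>: "\<gamma> \<in> \<Gamma>" "x' \<in> \<psi> \<gamma> ` {a<..<b}" using x'(1) by (auto simp: G_def)
      obtain a' b' where g': "gap a' b'" "\<psi> \<gamma> ` {a<..<b} = {a'<..<b'}" by (rule gap_image[OF \<gamma>(1) g])
      have "{a'<..<b'} \<subseteq> G" using g'(2) \<gamma>(1) by (auto simp: G_def)
      then have nx: "x \<notin> {a'<..<b'}" using False by blast
      have x'': "x' \<in> {a'<..<b'}" using \<gamma>(2) g'(2) by blast
      \<comment> \<open>The end of the translate lying between \<open>x\<close> and
        \<open>x'\<close>, hence as close to \<open>x\<close> as \<open>x'\<close> is.\<close>
      define e where "e = (if x \<le> a' then a' else b')"
      have ee: "e \<in> {0..1}" "e \<notin> N" "dist e x < d"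
        using gapD[OF g'(1)] nx x'' x'(2) by (auto simp: e_def dist_real_def)
      have "v e 0 = v a 0 \<or> v e 0 = v b 0"
        using gap_image_boundary[OF \<gamma>(1) g g'] by (auto simp: e_def)
      then have "\<sigma> * v e z \<le> m" using constant_outside[OF ee(1,2) zd] by (auto simp: m_def)
      then show False using d(2)[OF ee(1,3)] by (auto simp: dist_real_def)
    qed
  qed
  moreover have "\<sigma> * v x1 z1 \<le> \<sigma> * v x z" using sup[OF _ z1] inG x1 by blast
  ultimately show ?thesis by (simp add: m_def)
qed

lemma gap_bounds:
  assumes "gap a b" "x \<in> {a<..<b}" "z \<in> disc"
  shows "v x z \<le> max (v a 0) (v b 0)" "min (v a 0) (v b 0) \<le> v x z"
  using gap_maximum[OF assms, of 1] gap_maximum[OF assms, of "-1"] by (auto simp: max_def min_def split: if_splits)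

section \<open>Finite orbits and stabilizers of gaps\<close>

text \<open>Equal boundary values would squeeze \<open>v\<close> to a constant inside the
  gap.\<close>

lemma gap_boundary_values_neq:
  assumes g: "gap a b"
  shows "v a 0 \<noteq> v b 0"
proof
  assume eq: "v a 0 = v b 0"
  have m: "(a + b) / 2 \<in> {a<..<b}" using gapD(1)[OF g] by auto
  have "\<forall>z\<in>disc. v ((a + b) / 2) z = v a 0" using gap_bounds[OF g m] eq by force
  then show False using gapD(6)[OF g m] unfolding N_eq by blast
qed

text \<open>All translates have the same jump between their boundary values, so uniform continuity
  bounds their length below. Each then contains a point of a fixed finite grid, and distinct gaps
  are disjoint.\<close>

lemma finite_gap_orbit:
  assumes g: "gap a b"
  shows "finite {(a', b'). gap a' b' \<and> (\<exists>\<gamma>\<in>\<Gamma>. \<psi> \<gamma> ` {a<..<b} = {a'<..<b'})}" (is "finite ?F")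
proof -
  have "uniformly_continuous_on {0..1} (\<lambda>x. v x 0)"
    by (rule compact_uniformly_continuous[OF v_cont_x]) auto
  moreover have "0 < \<bar>v a 0 - v b 0\<bar>" using gap_boundary_values_neq[OF g] by simp
  ultimately obtain d where d: "d > 0"
    "\<And>x y. x \<in> {0..1} \<Longrightarrow> y \<in> {0..1} \<Longrightarrow> dist y x < d \<Longrightarrow> dist (v y 0) (v x 0) < \<bar>v a 0 - v b 0\<bar>"
    unfolding uniformly_continuous_on_def by metis
  obtain n :: nat where n: "n > 0" "1 / real n < d"
    using real_arch_inverse[THEN iffD1, OF d(1)] by (auto simp: inverse_eq_divide)
  have "?F \<subseteq> (\<Union>k\<in>{..n}. {(a', b'). gap a' b' \<and> real k / real n \<in> {a'<..<b'}})"
  proof clarify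
    fix a' b' \<gamma> assume g': "gap a' b'" and \<gamma>: "\<gamma> \<in> \<Gamma>" "\<psi> \<gamma> ` {a<..<b} = {a'<..<b'}"
    have "dist (v b' 0) (v a' 0) = \<bar>v a 0 - v b 0\<bar>"
      using gap_image_boundary[OF \<gamma>(1) g g' \<gamma>(2)] by (auto simp: dist_real_def)
    then have "d \<le> b' - a'"
      using d(2)[OF gapD(2,3)[OF g']] gapD(1)[OF g'] by (force simp: dist_real_def)
    then have len: "1 / real n < b' - a'" using n by simp
    \<comment> \<open>The first grid index strictly to the right of \<open>a'\<close>; hence floor
      plus 1 even when \<open>a'\<close> is a grid point.\<close>
    define k where "k = nat (\<lfloor>real n * a'\<rfloor> + 1)"
    have a'0: "0 \<le> real n * a'" using gapD(2)[OF g'] by simp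
    have rk: "real k = of_int \<lfloor>real n * a'\<rfloor> + 1" using a'0 by (simp add: k_def)
    have "real n * a' < real k" unfolding rk by linarith
    then have 1: "a' < real k / real n" using n(1) by (simp add: field_simps)
    have "real k \<le> real n * a' + 1" unfolding rk by linarith
    also have "\<dots> < real n * b'" using len n(1) by (simp add: field_simps)
    finally have 2: "real k / real n < b'" using n(1) by (simp add: field_simps)
    have "real k / real n \<le> 1" using 2 gapD(3)[OF g'] by simp
    then have "k \<le> n" using n(1) by simp
    then show "(a', b') \<in> (\<Union>k\<in>{..n}. {(a', b'). gap a' b' \<and> real k / real n \<in> {a'<..<b'}})"
      using 1 2 g' by auto
  qed
  moreover have "finite {(a', b'). gap a' b' \<and> c \<in> {a'<..<b'}}" (is "finite ?C") for c
  proof (cases "\<exists>a' b'. gap a' b' \<and> c \<in> {a'<..<b'}")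
    case True
    then obtain a' b' where c: "gap a' b'" "c \<in> {a'<..<b'}" by blast
    have "?C \<subseteq> {(a', b')}" using gap_unique[OF _ c(1) _ c(2)] by blast
    then show ?thesis by (rule finite_subset) simp
  next
    case False
    then have "?C = {}" by blast
    then show ?thesis by (simp only: finite.emptyI)
  qed
  then have "finite (\<Union>k\<in>{..n}. {(a', b'). gap a' b' \<and> real k / real n \<in> {a'<..<b'}})"
    by (intro finite_UN_I finite_atMost)
  ultimately show ?thesis by (rule finite_subset)
qed

lemma image_cball_subset:
  assumes \<gamma>: "\<gamma> \<in> \<Gamma>"
  shows "\<exists>s<1. \<gamma> ` cball 0 r \<subseteq> cball 0 s"
proof -
  have kd: "cball 0 r \<subseteq> disc" using r_less_1 by auto
  have "continuous_on (cball 0 r) (\<lambda>z. cmod (\<gamma> z))"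
    by (intro continuous_on_norm continuous_on_subset[OF continuous_on_isometry[OF isometry[OF \<gamma>]] kd])
  moreover have "cball 0 r \<noteq> ({} :: complex set)" using r_pos by simp
  ultimately obtain z where z: "z \<in> cball 0 r" "\<forall>w\<in>cball 0 r. cmod (\<gamma> w) \<le> cmod (\<gamma> z)"
    using continuous_attains_sup[OF compact_cball] by blast
  have "cmod (\<gamma> z) < 1" using in_disc[OF \<gamma>, of z] z(1) kd by auto
  moreover have "\<gamma> ` cball 0 r \<subseteq> cball 0 (cmod (\<gamma> z))" using z(2) by auto
  ultimately show ?thesis by blast
qed

text \<open>The orbit of the gap is finite, so the stabilizer has finitely many cosets. Undoing a
  chosen representative of each coset moves the covering ball into a ball of larger radius
  \<open>s < 1\<close>.\<close>

lemma stabilizer_lattice: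
  assumes g: "gap a b"
  defines "H \<equiv> {\<gamma>\<in>\<Gamma>. \<psi> \<gamma> ` {a<..<b} = {a<..<b}}"
  shows "\<exists>s. cocompact_lattice H s"
proof -
  have sub: "{a<..<b} \<subseteq> N" using gapD(6)[OF g] by blast
  have img_prod: "\<psi> (product_elt \<gamma> \<delta>) ` {a<..<b} = \<psi> \<gamma> ` \<psi> \<delta> ` {a<..<b}" if "\<gamma> \<in> \<Gamma>" "\<delta> \<in> \<Gamma>" for \<gamma> \<delta>
    unfolding image_image by (rule image_cong) (use \<psi>_product[OF that] sub in auto)
  have img_inv: "\<psi> (inverse_elt \<gamma>) ` \<psi> \<gamma> ` {a<..<b} = {a<..<b}" if "\<gamma> \<in> \<Gamma>" for \<gamma>
  proof -
    have "\<psi> (inverse_elt \<gamma>) (\<psi> \<gamma> x) = x" if "x \<in> {a<..<b}" for x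
      using \<psi>_inverse(1)[OF \<open>\<gamma> \<in> \<Gamma>\<close>] sub that by blast
    then show ?thesis unfolding image_image by simp
  qed
  have HG: "H \<subseteq> \<Gamma>" by (auto simp: H_def)
  have subH: "subgroup H hyp_isometries"
  proof (rule group.subgroupI[OF group_hyp_isometries])
    show "H \<subseteq> carrier hyp_isometries" using HG isometry by blast
    have "\<psi> \<one>\<^bsub>hyp_isometries\<^esub> ` {a<..<b} = {a<..<b}"
    proof -
      have "\<psi> \<one>\<^bsub>hyp_isometries\<^esub> ` {a<..<b} = (\<lambda>x. x) ` {a<..<b}"
        by (rule image_cong[OF refl]) (rule \<psi>_one[OF subsetD[OF sub]])
      then show ?thesis by simp
    qed
    then show "H \<noteq> {}" using one_closed by (auto simp: H_def)
    show "inverse_elt \<gamma> \<in> H" if "\<gamma> \<in> H" for \<gamma>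
      using that img_inv[of \<gamma>] inverse_closed[of \<gamma>] by (auto simp: H_def)
    show "product_elt \<gamma> \<delta> \<in> H" if "\<gamma> \<in> H" "\<delta> \<in> H" for \<gamma> \<delta>
      using that img_prod[of \<gamma> \<delta>] product_closed[of \<gamma> \<delta>] by (simp add: H_def)
  qed
  define F where "F = {(a', b'). gap a' b' \<and> (\<exists>\<gamma>\<in>\<Gamma>. \<psi> \<gamma> ` {a<..<b} = {a'<..<b'})}"
  have finF: "finite F" unfolding F_def by (rule finite_gap_orbit[OF g])
  have "\<forall>p\<in>F. \<exists>\<gamma>. \<gamma> \<in> \<Gamma> \<and> \<psi> \<gamma> ` {a<..<b} = {fst p<..<snd p}" by (auto simp: F_def)
  from bchoice[OF this] obtain R where
    R: "\<And>p. p \<in> F \<Longrightarrow> R p \<in> \<Gamma> \<and> \<psi> (R p) ` {a<..<b} = {fst p<..<snd p}" by blast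
  have "\<forall>p\<in>F. \<exists>s. s < 1 \<and> inverse_elt (R p) ` cball 0 r \<subseteq> cball 0 s"
    using image_cball_subset inverse_closed R by blast
  from bchoice[OF this] obtain S where
    S: "\<And>p. p \<in> F \<Longrightarrow> S p < 1 \<and> inverse_elt (R p) ` cball 0 r \<subseteq> cball 0 (S p)" by blast
  \<comment> \<open>Inserting \<open>r\<close> makes the set nonempty and guarantees
    \<open>0 < s\<close>.\<close>
  define s where "s = Max (insert r (S ` F))"
  have fin: "finite (insert r (S ` F))" using finF by simp
  have "s \<in> insert r (S ` F)" unfolding s_def by (rule Max_in[OF fin]) simp
  moreover have "y < 1" if "y \<in> insert r (S ` F)" for y
    using that
  proof (rule insertE)
    assume "y \<in> S ` F"
    then obtain p where p: "y = S p" "p \<in> F" by (rule imageE)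
    show "y < 1" unfolding p(1) by (rule conjunct1[OF S[OF p(2)]])
  qed (simp add: r_less_1)
  ultimately have s1: "s < 1" by blast
  have rs: "r \<le> s" unfolding s_def by (rule Max_ge[OF fin]) simp
  have cov: "\<exists>h\<in>H. h z \<in> cball 0 s" if z: "z \<in> disc" for z
  proof -
    obtain \<gamma> where \<gamma>: "\<gamma> \<in> \<Gamma>" "\<gamma> z \<in> cball 0 r" using covering[OF z] by blast
    obtain a' b' where g': "gap a' b'" "\<psi> \<gamma> ` {a<..<b} = {a'<..<b'}" by (rule gap_image[OF \<gamma>(1) g])
    have pF: "(a', b') \<in> F" using g' \<gamma>(1) by (auto simp: F_def)
    define \<delta> where "\<delta> = R (a', b')"
    have \<delta>: "\<delta> \<in> \<Gamma>" "\<psi> \<delta> ` {a<..<b} = {a'<..<b'}" using R[OF pF] by (auto simp: \<delta>_def)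
    have i\<delta>: "inverse_elt \<delta> \<in> \<Gamma>" by (rule inverse_closed[OF \<delta>(1)])
    have "\<psi> (product_elt (inverse_elt \<delta>) \<gamma>) ` {a<..<b} = {a<..<b}"
      unfolding img_prod[OF i\<delta> \<gamma>(1)] g'(2) using img_inv[OF \<delta>(1)] \<delta>(2) by simp
    then have "product_elt (inverse_elt \<delta>) \<gamma> \<in> H" using product_closed[OF i\<delta> \<gamma>(1)] by (simp add: H_def)
    moreover have "product_elt (inverse_elt \<delta>) \<gamma> z \<in> cball 0 s"
    proof -
      have "S (a', b') \<le> s" unfolding s_def by (rule Max_ge[OF fin]) (use pF in blast)
      moreover have "inverse_elt \<delta> (\<gamma> z) \<in> cball 0 (S (a', b'))"
        using S[OF pF] \<gamma>(2) unfolding \<delta>_def by blast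
      ultimately show ?thesis unfolding product_apply[OF i\<delta> \<gamma>(1) z] by auto
    qed
    ultimately show ?thesis by blast
  qed
  have fin': "finite {\<gamma>\<in>H. \<gamma> z \<in> cball 0 t}" if "z \<in> disc" "t < 1" for z t
    by (rule finite_subset[OF _ locally_finite[OF that]]) (use HG in auto)
  have "0 < s" using rs r_pos by simp
  then have "cocompact_lattice H s"
    by (intro cocompact_lattice.intro isometry_group.intro cocompact_lattice_axioms.intro subH s1 cov fin')
  then show ?thesis ..
qed

lemma no_nonconstant: "N = {}"
proof (rule ccontr)
  assume "N \<noteq> {}"
  then obtain x0 where "x0 \<in> N" by blast
  then obtain a b where g: "gap a b" using gap_exists by blast
  define H where "H = {\<gamma>\<in>\<Gamma>. \<psi> \<gamma> ` {a<..<b} = {a<..<b}}"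
  obtain s where "cocompact_lattice H s" using stabilizer_lattice[OF g] by (auto simp: H_def)
  then interpret H: cocompact_lattice H s .
  \<comment> \<open>\<open>k\<close> may be negative: division by it then reverses the order, and
    the gap still gets boundary values 0 on the left and 1 on the right.\<close>
  define k where "k = v b 0 - v a 0"
  have k: "k \<noteq> 0" using gap_boundary_values_neq[OF g] by (simp add: k_def)
  define u where "u x z = (1 / k) * v x z + (- v a 0 / k)" for x z
  have u_eq: "u x z = (v x z - v a 0) / k" for x z by (simp add: u_def diff_divide_distrib)
  note gD = gapD[OF g]
  have ab01: "{a..b} \<subseteq> {0..1}" using gD by auto
  have ua: "u a z = 0" if "z \<in> disc" for z using constant_outside[OF gD(2,4) that] by (simp add: u_eq)
  have ub: "u b z = 1" if "z \<in> disc" for z using constant_outside[OF gD(3,5) that] k by (simp add: u_eq k_def)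
  have "gap_system H s u \<psi> a b"
  proof (intro gap_system.intro gap_system_axioms.intro H.cocompact_lattice_axioms)
    show "a < b" by (rule gD)
    have "continuous_on ({a..b} \<times> disc) (\<lambda>p. (1 / k) * (case p of (x, z) \<Rightarrow> v x z) + (- v a 0 / k))"
      by (intro continuous_intros continuous_on_subset[OF v_cont]) (use ab01 in blast)
    then show "continuous_on ({a..b} \<times> disc) (\<lambda>(x, z). u x z)" by (simp add: u_def case_prod_beta')
    show "harmonic_on disc (u x)" if "x \<in> {a..b}" for x
      unfolding u_def by (rule harmonic_on_affine[OF v_harmonic]) (use that ab01 in blast)
    show "0 \<le> u x z \<and> u x z \<le> 1" if x: "x \<in> {a..b}" and z: "z \<in> disc" for x z
    proof -
      consider "x = a" | "x = b" | "x \<in> {a<..<b}" using x by force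
      then show ?thesis
      proof cases
        case 3
        have "0 \<le> v x z - v a 0 \<and> v x z - v a 0 \<le> k \<or> k \<le> v x z - v a 0 \<and> v x z - v a 0 \<le> 0"
          using gap_bounds[OF g 3 z] by (cases "v a 0 \<le> v b 0") (auto simp: k_def)
        then show ?thesis unfolding u_eq using k by (auto simp: divide_le_eq_1 zero_le_divide_iff)
      qed (simp_all add: ua[OF z] ub[OF z])
    qed
    show "u a z = 0" "u b z = 1" if "z \<in> disc" for z using ua ub that by auto
    fix \<gamma> assume \<gamma>H: "\<gamma> \<in> H"
    then have \<gamma>: "\<gamma> \<in> \<Gamma>" "\<psi> \<gamma> ` {a<..<b} = {a<..<b}" by (auto simp: H_def)
    have sub: "{a<..<b} \<subseteq> N" using gD(6) by blast
    show "bij_betw (\<psi> \<gamma>) {a<..<b} {a<..<b}"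
      unfolding bij_betw_def using inj_on_subset[OF \<psi>_inj_on[OF \<gamma>(1)] sub] \<gamma>(2) by blast
    \<comment> \<open>The other alternative would exchange the boundary values, making them
      equal.\<close>
    show "strict_mono_on {a<..<b} (\<psi> \<gamma>)"
      using gap_image_boundary[OF \<gamma>(1) g g \<gamma>(2)] gap_boundary_values_neq[OF g] by auto
    show "u (\<psi> \<gamma> x) (\<gamma> z) = u x z" if "x \<in> {a<..<b}" "z \<in> disc" for x z
      using v_equivariant[OF \<gamma>(1) gD(6)[OF that(1)] that(2)] by (simp add: u_eq)
  qed
  from gap_system.constant_in_gap[OF this]
  obtain x c where x: "x \<in> {a<..<b}" "\<forall>z\<in>disc. u x z = c" by (elim bexE exE)
  have "v x z = c * k + v a 0" if "z \<in> disc" for z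
    using x(2)[rule_format, OF that] k by (simp add: u_eq field_simps)
  then have "x \<notin> N" unfolding N_eq by blast
  then show False using gD(6)[OF x(1)] by blast
qed

end

subsection \<open>Equivariant families over the circle and the interval\<close>

text \<open>The topology lives on all extensional functions, continuous or not, so a strict
  pointwise bound on \<open>K\<close> leaves no uniform margin. The number \<open>d < e\<close>
  supplies it.\<close>

lemma openin_uniformly_close:
  fixes f :: "complex \<Rightarrow> 'b::metric_space"
  assumes K: "compact K" "K \<subseteq> disc"
  shows "openin compact_convergence {g \<in> extensional disc. \<exists>d<e. \<forall>z\<in>K. dist (g z) (f z) \<le> d}"
  unfolding openin_compact_convergence
proof (intro conjI ballI)
  fix g assume "g \<in> {g \<in> extensional disc. \<exists>d<e. \<forall>z\<in>K. dist (g z) (f z) \<le> d}"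
  then obtain d where d: "d < e" "\<And>z. z \<in> K \<Longrightarrow> dist (g z) (f z) \<le> d" by blast
  have "compact_nbhd K ((e - d) / 2) g \<subseteq> {g \<in> extensional disc. \<exists>d<e. \<forall>z\<in>K. dist (g z) (f z) \<le> d}"
  proof
    fix h assume h: "h \<in> compact_nbhd K ((e - d) / 2) g"
    have "dist (h z) (f z) \<le> (e + d) / 2" if z: "z \<in> K" for z
    proof -
      have "dist (h z) (f z) \<le> dist (h z) (g z) + dist (g z) (f z)" by (rule dist_triangle)
      also have "\<dots> \<le> (e - d) / 2 + d"
        using h z d(2)[OF z] by (intro add_mono) (auto simp: compact_nbhd_def less_imp_le)
      finally show ?thesis by (simp add: field_simps)
    qed
    moreover have "(e + d) / 2 < e" using d(1) by simp
    ultimately show "h \<in> {g \<in> extensional disc. \<exists>d<e. \<forall>z\<in>K. dist (g z) (f z) \<le> d}"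
      using h unfolding compact_nbhd_def by blast
  qed
  moreover have "(e - d) / 2 > 0" using d(1) by simp
  ultimately show "\<exists>K' d. compact K' \<and> K' \<subseteq> disc \<and> d > 0 \<and>
      compact_nbhd K' d g \<subseteq> {g \<in> extensional disc. \<exists>d<e. \<forall>z\<in>K. dist (g z) (f z) \<le> d}"
    using K by blast
qed auto

text \<open>Near \<open>x\<close> the functions are uniformly close on a closed disc around
  \<open>z\<close>, and \<open>F x\<close> itself is continuous at \<open>z\<close>; half of
  \<open>e\<close> is spent on each.\<close>

lemma continuous_map_X0_imp_jointly_continuous:
  fixes X :: "'a::metric_space set"
  assumes F: "continuous_map (top_of_set X) X0_space F"
  shows "continuous_on (X \<times> disc) (\<lambda>(x, z). F x z)"
proof -
  have FX: "F x \<in> extensional disc \<and> harmonic_on disc (F x)" if "x \<in> X" for x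
    using continuous_map_image_subset_topspace[OF F] that
    by (auto simp: X0_space_def topspace_compact_convergence)
  have "\<exists>d>0. \<forall>p'\<in>X \<times> disc. dist p' p < d \<longrightarrow> dist (case p' of (x, z) \<Rightarrow> F x z) (case p of (x, z) \<Rightarrow> F x z) < e"
    if p: "p \<in> X \<times> disc" and e: "e > 0" for p e
  proof -
    obtain x z where xz: "p = (x, z)" "x \<in> X" "z \<in> disc" using p by (cases p) auto
    obtain d1 where d1: "d1 > 0" "cball z d1 \<subseteq> disc" using open_contains_cball[of disc] open_ball xz(3) by blast
    have "continuous_on disc (F x)" using harmonic_on_continuous FX[OF xz(2)] by blast
    then obtain d2 where d2: "d2 > 0" "\<And>w. w \<in> disc \<Longrightarrow> dist w z < d2 \<Longrightarrow> dist (F x w) (F x z) < e / 2"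
      using xz(3) half_gt_zero[OF e] unfolding continuous_on_iff by blast
    define U where "U = {g \<in> extensional disc. \<exists>d<e/2. \<forall>w\<in>cball z d1. dist (g w) (F x w) \<le> d}"
    have U: "openin compact_convergence U"
      unfolding U_def by (rule openin_uniformly_close[OF compact_cball d1(2)])
    have xU: "F x \<in> U"
      using FX[OF xz(2)] half_gt_zero[OF e] unfolding U_def by (intro CollectI conjI exI[of _ 0]) auto
    have "openin X0_space (U \<inter> topspace X0_space)"
      using U unfolding X0_space_def openin_subtopology by (auto simp: topspace_compact_convergence)
    from openin_continuous_map_preimage[OF F this]
    have "openin (top_of_set X) {y \<in> X. F y \<in> U \<inter> topspace X0_space}" by simp
    moreover have "x \<in> {y \<in> X. F y \<in> U \<inter> topspace X0_space}"
      using xU xz(2) continuous_map_image_subset_topspace[OF F] by auto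
    ultimately obtain d3 where d3: "d3 > 0" "\<And>y. y \<in> X \<Longrightarrow> dist y x < d3 \<Longrightarrow> F y \<in> U"
      unfolding openin_euclidean_subtopology_iff by blast
    show ?thesis
    proof (intro exI conjI ballI impI)
      show "0 < min d1 (min d2 d3)" using d1 d2 d3 by simp
      fix p' assume p': "p' \<in> X \<times> disc" "dist p' p < min d1 (min d2 d3)"
      obtain y w where yw: "p' = (y, w)" "y \<in> X" "w \<in> disc" using p'(1) by (cases p') auto
      have "dist y x \<le> dist p' p" "dist w z \<le> dist p' p"
        using dist_fst_le[of p' p] dist_snd_le[of p' p] by (simp_all add: yw xz)
      then have dd: "dist y x < d3" "dist w z < d2" "dist w z < d1" using p'(2) by auto
      have "F y \<in> U" by (rule d3(2)[OF yw(2) dd(1)])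
      then obtain d where d: "d < e / 2" "\<forall>w\<in>cball z d1. dist (F y w) (F x w) \<le> d"
        unfolding U_def by blast
      have "dist (F y w) (F x w) \<le> d" using d(2) dd(3) by (simp add: dist_commute)
      then have "dist (F y w) (F x w) < e / 2" using d(1) by simp
      moreover have "dist (F x w) (F x z) < e / 2" by (rule d2(2)[OF yw(3) dd(2)])
      ultimately have "dist (F y w) (F x z) < e"
        using dist_triangle[of "F y w" "F x z" "F x w"] by linarith
      then show "dist (case p' of (x, z) \<Rightarrow> F x z) (case p of (x, z) \<Rightarrow> F x z) < e" by (simp add: yw xz)
    qed
  qed
  then show ?thesis unfolding continuous_on_iff by blast
qed

section \<open>Equivariant families and their parametrisation by an interval\<close>

locale equivariant_family = cocompact_lattice \<Gamma> r for \<Gamma> r +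
  fixes X :: "'a::metric_space set" and \<phi> :: "(complex \<Rightarrow> complex) \<Rightarrow> 'a \<Rightarrow> 'a" and F :: "'a \<Rightarrow> complex \<Rightarrow> real"
  assumes action: "action_by_homeos \<Gamma> X \<phi>"
    and F_cont: "continuous_map (top_of_set X) X0_space F"
    and F_equivariant: "equivariant \<Gamma> X \<phi> F"
begin

definition constant_at :: "'a \<Rightarrow> bool" where
  "constant_at x \<longleftrightarrow> (\<exists>c. \<forall>z\<in>disc. F x z = c)"

lemma F_in_X0:
  assumes "x \<in> X"
  shows "F x \<in> extensional disc" "harmonic_on disc (F x)"
  using continuous_map_image_subset_topspace[OF F_cont] assms
  by (auto simp: X0_space_def topspace_compact_convergence)

lemma F_jointly_continuous: "continuous_on (X \<times> disc) (\<lambda>(x, z). F x z)"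
  by (rule continuous_map_X0_imp_jointly_continuous[OF F_cont])

lemma group_action: "group_action (subgroup_of_isometries \<Gamma>) X \<phi>"
  using action by (simp add: action_by_homeos_def)

lemma \<phi>_closed: "\<gamma> \<in> \<Gamma> \<Longrightarrow> x \<in> X \<Longrightarrow> \<phi> \<gamma> x \<in> X"
  using group_action.element_image[OF group_action] by simp

lemma \<phi>_product: "\<gamma> \<in> \<Gamma> \<Longrightarrow> \<delta> \<in> \<Gamma> \<Longrightarrow> x \<in> X \<Longrightarrow> \<phi> (product_elt \<gamma> \<delta>) x = \<phi> \<gamma> (\<phi> \<delta> x)"
  using group_action.composition_rule[OF group_action] by simp

lemma \<phi>_one: "x \<in> X \<Longrightarrow> \<phi> \<one>\<^bsub>hyp_isometries\<^esub> x = x"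
  using group_action.id_eq_one[OF group_action] by (simp add: fun_eq_iff) (metis restrict_apply')

lemma \<phi>_inverse:
  assumes "\<gamma> \<in> \<Gamma>" "x \<in> X"
  shows "\<phi> (inverse_elt \<gamma>) (\<phi> \<gamma> x) = x"
  using \<phi>_product[OF inverse_closed[OF assms(1)] assms] by (simp add: inverse_product[OF assms(1)] \<phi>_one[OF assms(2)])

lemma \<phi>_homeo: "\<gamma> \<in> \<Gamma> \<Longrightarrow> homeomorphic_map (top_of_set X) (top_of_set X) (\<phi> \<gamma>)"
  using action by (simp add: action_by_homeos_def)

lemma \<phi>_continuous: "\<gamma> \<in> \<Gamma> \<Longrightarrow> continuous_on X (\<phi> \<gamma>)"
  using homeomorphic_imp_continuous_map[OF \<phi>_homeo] by simp

lemma \<phi>_bij: "\<gamma> \<in> \<Gamma> \<Longrightarrow> bij_betw (\<phi> \<gamma>) X X"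
  using homeomorphic_imp_injective_map[OF \<phi>_homeo] homeomorphic_imp_surjective_map[OF \<phi>_homeo]
  by (simp add: bij_betw_def)

lemma F_invariant:
  assumes \<gamma>: "\<gamma> \<in> \<Gamma>" and x: "x \<in> X" and z: "z \<in> disc"
  shows "F (\<phi> \<gamma> x) (\<gamma> z) = F x z"
proof -
  have inj: "inj_on \<gamma> disc" using elt_Bij[OF \<gamma>] by (simp add: Bij_def bij_betw_def)
  have "F (\<phi> \<gamma> x) (\<gamma> z) = compose disc (F x) (inv_into disc \<gamma>) (\<gamma> z)"
    using F_equivariant \<gamma> x by (simp add: equivariant_def act_X0_def)
  also have "\<dots> = F x (inv_into disc \<gamma> (\<gamma> z))"
    by (rule compose_eq[OF in_disc[OF \<gamma> z]])
  finally show ?thesis using inv_into_f_f[OF inj z] by simp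
qed

lemma constant_at_\<phi>:
  assumes \<gamma>: "\<gamma> \<in> \<Gamma>" and x: "x \<in> X"
  shows "constant_at (\<phi> \<gamma> x) \<longleftrightarrow> constant_at x"
proof -
  have imp: "constant_at (\<phi> \<delta> y)" if \<delta>: "\<delta> \<in> \<Gamma>" and y: "y \<in> X" and c: "constant_at y" for \<delta> y
  proof -
    obtain c where c: "\<And>z. z \<in> disc \<Longrightarrow> F y z = c" using c unfolding constant_at_def by blast
    have "F (\<phi> \<delta> y) z = c" if z: "z \<in> disc" for z
    proof -
      have z': "inverse_elt \<delta> z \<in> disc" by (rule in_disc[OF inverse_closed[OF \<delta>] z])
      have "F (\<phi> \<delta> y) (\<delta> (inverse_elt \<delta> z)) = F y (inverse_elt \<delta> z)" by (rule F_invariant[OF \<delta> y z'])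
      then show ?thesis unfolding inverse_apply(2)[OF \<delta> z] using c[OF z'] by simp
    qed
    then show ?thesis unfolding constant_at_def by blast
  qed
  show ?thesis
    using imp[OF \<gamma> x] imp[OF inverse_closed[OF \<gamma>] \<phi>_closed[OF \<gamma> x]] \<phi>_inverse[OF \<gamma> x] by auto
qed

text \<open>Since the ball meets every orbit, a maximum over \<open>Y\<close> times the ball is a
  maximum over \<open>Y\<close> times the disc, and it is attained at an interior point of the
  disc.\<close>

lemma constant_in_invariant_compact:
  assumes Y: "compact Y" "Y \<noteq> {}" "Y \<subseteq> X" and inv: "\<And>\<gamma> y. \<gamma> \<in> \<Gamma> \<Longrightarrow> y \<in> Y \<Longrightarrow> \<phi> \<gamma> y \<in> Y"
  shows "\<exists>y\<in>Y. constant_at y"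
proof -
  have kd: "cball 0 r \<subseteq> disc" using r_less_1 by auto
  have ne: "Y \<times> cball (0::complex) r \<noteq> {}" using Y(2) r_pos by auto
  have "compact (Y \<times> cball (0::complex) r)" by (intro compact_Times compact_cball Y(1))
  moreover have "continuous_on (Y \<times> cball 0 r) (\<lambda>(x, z). F x z)"
    by (rule continuous_on_subset[OF F_jointly_continuous]) (use Y(3) kd in blast)
  ultimately obtain p where p: "p \<in> Y \<times> cball 0 r"
    "\<forall>q\<in>Y \<times> cball 0 r. (case q of (x, z) \<Rightarrow> F x z) \<le> (case p of (x, z) \<Rightarrow> F x z)"
    using continuous_attains_sup[OF _ ne] by blast
  obtain y z where yz: "p = (y, z)" by (cases p)
  have y: "y \<in> Y" and z: "z \<in> cball 0 r" using p(1) yz by auto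
  have yX: "y \<in> X" using y Y(3) by blast
  have zd: "z \<in> disc" using z kd by blast
  have "F y w \<le> F y z" if w: "w \<in> disc" for w
  proof -
    obtain \<gamma> where \<gamma>: "\<gamma> \<in> \<Gamma>" "\<gamma> w \<in> cball 0 r" using covering[OF w] by blast
    have "F (\<phi> \<gamma> y) (\<gamma> w) \<le> F y z"
      using p(2)[rule_format, of "(\<phi> \<gamma> y, \<gamma> w)"] inv[OF \<gamma>(1) y] \<gamma>(2) yz by auto
    then show ?thesis using F_invariant[OF \<gamma>(1) yX w] by simp
  qed
  from harmonic_maximum_principle[OF F_in_X0(2)[OF yX] this zd refl]
  have "F y w = F y z" if "w \<in> disc" for w using that by blast
  then show ?thesis using y unfolding constant_at_def by blast
qed

text \<open>The parametrisation \<open>p\<close> may identify the two end points of the interval.\<close>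

lemma constant_everywhere:
  fixes p :: "real \<Rightarrow> 'a" and q :: "'a \<Rightarrow> real"
  assumes p: "continuous_on {0..1} p" "p ` {0..1} = X"
    and ends: "constant_at (p 0)" "constant_at (p 1)"
    and qp: "\<And>t. 0 < t \<Longrightarrow> t < 1 \<Longrightarrow> q (p t) = t"
    and q: "continuous_on {x \<in> X. \<not> constant_at x} q"
    and x: "x \<in> X"
  shows "constant_at x"
proof -
  define N where "N = {t \<in> {0..1}. \<not> constant_at (p t)}"
  \<comment> \<open>The action read in the parameter. \<open>q\<close> inverts \<open>p\<close> at
    nonconstant points, which form an invariant set, so \<open>\<psi>\<close> is meaningful on
    \<open>N\<close>.\<close>
  define \<psi> where "\<psi> \<gamma> t = q (\<phi> \<gamma> (p t))" for \<gamma> t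
  have pX: "p t \<in> X" if "t \<in> {0..1}" for t using p(2) that by blast
  have inv: "q x \<in> N \<and> p (q x) = x" if x: "x \<in> X" "\<not> constant_at x" for x
  proof -
    obtain t where t: "t \<in> {0..1}" "x = p t" using p(2) x(1) by blast
    have "t \<noteq> 0" "t \<noteq> 1" using ends x(2) t(2) by auto
    then have "q x = t" using qp[of t] t by simp
    then show ?thesis using t x(2) by (simp add: N_def)
  qed
  have Nin: "p t \<in> X" "\<not> constant_at (p t)" "q (p t) = t" if "t \<in> N" for t
  proof -
    have t: "t \<in> {0..1}" "\<not> constant_at (p t)" using that by (auto simp: N_def)
    then show "p t \<in> X" "\<not> constant_at (p t)" using pX by auto
    have "t \<noteq> 0" "t \<noteq> 1" using ends t(2) by auto
    then show "q (p t) = t" using qp[of t] t(1) by simp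
  qed
  have act: "\<phi> \<gamma> (p t) \<in> X" "\<not> constant_at (\<phi> \<gamma> (p t))" if "\<gamma> \<in> \<Gamma>" "t \<in> N" for \<gamma> t
    using \<phi>_closed[OF that(1) Nin(1)[OF that(2)]] constant_at_\<phi>[OF that(1) Nin(1)[OF that(2)]] Nin(2)[OF that(2)]
    by blast+
  have p\<psi>: "p (\<psi> \<gamma> t) = \<phi> \<gamma> (p t)" if "\<gamma> \<in> \<Gamma>" "t \<in> N" for \<gamma> t
    unfolding \<psi>_def using inv[OF act[OF that]] by blast
  have "interval_system \<Gamma> r (\<lambda>t. F (p t)) \<psi> N"
  proof (intro interval_system.intro interval_system_axioms.intro cocompact_lattice_axioms)
    have "continuous_on ({0..1} \<times> disc) (\<lambda>s. (p (fst s), snd s))"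
      by (intro continuous_on_Pair continuous_on_compose2[OF p(1)] continuous_on_fst continuous_on_snd
          continuous_on_id) auto
    moreover have "(\<lambda>s. (p (fst s), snd s)) ` ({0..1} \<times> disc) \<subseteq> X \<times> disc" using pX by auto
    ultimately have "continuous_on ({0..1} \<times> disc) (\<lambda>s. case (p (fst s), snd s) of (x, z) \<Rightarrow> F x z)"
      by (rule continuous_on_compose2[OF F_jointly_continuous])
    then show "continuous_on ({0..1} \<times> disc) (\<lambda>(t, z). F (p t) z)" by (simp add: case_prod_beta')
    show "harmonic_on disc (F (p t))" if "t \<in> {0..1}" for t by (rule F_in_X0(2)[OF pX[OF that]])
    show "N = {t \<in> {0..1}. \<not> (\<exists>c. \<forall>z\<in>disc. F (p t) z = c)}" by (simp only: N_def constant_at_def)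
    show "0 \<notin> N" "1 \<notin> N" using ends by (auto simp: N_def)
    fix \<gamma> assume \<gamma>: "\<gamma> \<in> \<Gamma>"
    show "\<psi> \<gamma> t \<in> N" if "t \<in> N" for t unfolding \<psi>_def using inv[OF act[OF \<gamma> that]] by blast
    have "continuous_on N (\<lambda>t. \<phi> \<gamma> (p t))"
      by (rule continuous_on_compose2[OF \<phi>_continuous[OF \<gamma>] continuous_on_subset[OF p(1)]])
         (use Nin(1) in \<open>auto simp: N_def\<close>)
    then show "continuous_on N (\<psi> \<gamma>)"
      unfolding \<psi>_def[abs_def] by (rule continuous_on_compose2[OF q]) (use act[OF \<gamma>] in blast)
    show "F (p (\<psi> \<gamma> t)) (\<gamma> z) = F (p t) z" if "t \<in> N" "z \<in> disc" for t z
      unfolding p\<psi>[OF \<gamma> that(1)] by (rule F_invariant[OF \<gamma> Nin(1)[OF that(1)] that(2)])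
    show "\<psi> (product_elt \<gamma> \<delta>) t = \<psi> \<gamma> (\<psi> \<delta> t)" if "\<delta> \<in> \<Gamma>" "t \<in> N" for \<delta> t
      unfolding \<psi>_def[of "product_elt \<gamma> \<delta>"] \<psi>_def[of \<gamma>] p\<psi>[OF that]
      by (simp only: \<phi>_product[OF \<gamma> that(1) Nin(1)[OF that(2)]])
  next
    show "\<psi> \<one>\<^bsub>hyp_isometries\<^esub> t = t" if "t \<in> N" for t
      unfolding \<psi>_def by (simp only: \<phi>_one[OF Nin(1)[OF that]] Nin(3)[OF that])
  qed
  then have "N = {}" by (rule interval_system.no_nonconstant)
  obtain t where t: "t \<in> {0..1}" "x = p t" using p(2) x by blast
  show ?thesis
  proof (rule ccontr)
    assume "\<not> constant_at x"
    then have "t \<in> N" using t by (simp add: N_def)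
    then show False using \<open>N = {}\<close> by blast
  qed
qed

lemma image_constant_functions:
  assumes "\<And>x. x \<in> X \<Longrightarrow> constant_at x"
  shows "F ` X \<subseteq> constant_functions"
proof (rule image_subsetI)
  fix x assume x: "x \<in> X"
  obtain c where c: "\<And>z. z \<in> disc \<Longrightarrow> F x z = c" using assms[OF x] unfolding constant_at_def by blast
  have "F x = (\<lambda>z\<in>disc. c)"
    by (rule extensionalityI[OF F_in_X0(1)[OF x] restrict_extensional]) (simp add: c del: mem_ball mem_ball_0)
  then show "F x \<in> constant_functions" unfolding constant_functions_def by blast
qed

end

lemma homeomorphism_unit_interval_endpoints:
  fixes f :: "real \<Rightarrow> real"
  assumes f: "continuous_on {0..1} f" "bij_betw f {0..1} {0..1}" and e: "e \<in> {0, 1}"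
  shows "f e \<in> {0, 1}"
proof -
  have inj: "inj_on f {0..1}" and img: "f ` {0..1} = {0..1}" using f(2) by (auto simp: bij_betw_def)
  have e01: "e \<in> {0..1}" using e by auto
  then have fe: "f e \<in> {0..1}" using img by blast
  obtain s where s: "s \<in> {0..1}" "f s = 0" using img by (metis atLeastAtMost_iff imageE order_refl zero_le_one)
  obtain t where t: "t \<in> {0..1}" "f t = 1" using img by (metis atLeastAtMost_iff imageE order_refl zero_le_one)
  have "strict_mono_on {0..1} f \<or> strict_antimono_on {0..1} f"
    using injective_eq_monotone_map[OF is_interval_cc f(1)] inj by blast
  then show ?thesis
  proof
    assume m: "strict_mono_on {0..1} f"
    have d: "f x < f y" if "x \<in> {0..1}" "y \<in> {0..1}" "x < y" for x y
      using strict_mono_onD[OF m that] .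
    show ?thesis
    proof (cases "e = 0")
      case True
      have "\<not> e < s" using d[OF e01 s(1)] s(2) fe by auto
      then show ?thesis using True s by auto
    next
      case False
      then have "e = 1" using e by simp
      moreover have "\<not> t < e" using d[OF t(1) e01] t(2) fe by auto
      ultimately show ?thesis using t by auto
    qed
  next
    assume m: "strict_antimono_on {0..1} f"
    have d: "f y < f x" if "x \<in> {0..1}" "y \<in> {0..1}" "x < y" for x y
      using monotone_onD[OF m that] by simp
    show ?thesis
    proof (cases "e = 0")
      case True
      have "\<not> e < t" using d[OF e01 t(1)] t(2) fe by auto
      then show ?thesis using True t by auto
    next
      case False
      then have "e = 1" using e by simp
      moreover have "\<not> s < e" using d[OF s(1) e01] s(2) fe by auto
      ultimately show ?thesis using s by auto
    qed
  qed
qed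

lemma interval_constant:
  assumes "equivariant_family \<Gamma> r {0..1::real} \<phi> F"
  shows "F ` {0..1} \<subseteq> constant_functions"
proof -
  interpret equivariant_family \<Gamma> r "{0..1::real}" \<phi> F by (rule assms)
  have e: "constant_at e" if e: "e \<in> {0, 1}" for e
  proof -
    have e01: "e \<in> {0..1}" using e by auto
    \<comment> \<open>Homeomorphisms of the interval permute its ends, so this orbit is finite and
      hence a compact invariant set. Constancy at one of its points spreads along the orbit back to
      \<open>e\<close>.\<close>
    let ?Y = "(\<lambda>\<gamma>. \<phi> \<gamma> e) ` \<Gamma>"
    have sub: "?Y \<subseteq> {0, 1}"
      using homeomorphism_unit_interval_endpoints[OF \<phi>_continuous \<phi>_bij e] by blast
    have "\<exists>y\<in>?Y. constant_at y"
    proof (rule constant_in_invariant_compact)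
      show "compact ?Y" by (rule finite_imp_compact[OF finite_subset[OF sub]]) simp
      show "?Y \<noteq> {}" using one_closed by blast
      show "?Y \<subseteq> {0..1}" using sub by auto
      show "\<phi> \<gamma> y \<in> ?Y" if \<gamma>: "\<gamma> \<in> \<Gamma>" and y: "y \<in> ?Y" for \<gamma> y
      proof -
        obtain \<delta> where \<delta>: "y = \<phi> \<delta> e" "\<delta> \<in> \<Gamma>" using y by (rule imageE)
        show ?thesis unfolding \<delta>(1) \<phi>_product[OF \<gamma> \<delta>(2) e01, symmetric]
          by (rule imageI[OF product_closed[OF \<gamma> \<delta>(2)]])
      qed
    qed
    then obtain \<gamma> where "\<gamma> \<in> \<Gamma>" "constant_at (\<phi> \<gamma> e)" by blast
    then show ?thesis using constant_at_\<phi> e01 by blast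
  qed
  show ?thesis
  proof (rule image_constant_functions)
    fix x :: real assume x: "x \<in> {0..1}"
    show "constant_at x"
      by (rule constant_everywhere[of "\<lambda>t. t" "\<lambda>t. t"]) (use e x in \<open>auto intro: continuous_on_id\<close>)
  qed
qed

lemma circle_constant:
  assumes "equivariant_family \<Gamma> r (sphere (0::complex) 1) \<phi> F"
  shows "F ` sphere 0 1 \<subseteq> constant_functions"
proof -
  interpret equivariant_family \<Gamma> r "sphere (0::complex) 1" \<phi> F by (rule assms)
  \<comment> \<open>The whole circle is a compact invariant set; the circle is cut open at the
    constant point found there.\<close>
  obtain c where c: "c \<in> sphere 0 1" "constant_at c"
    using constant_in_invariant_compact[of "sphere 0 1"] \<phi>_closed by (auto simp del: mem_sphere mem_sphere_0)
  have c1: "cmod c = 1" "c \<noteq> 0" using c(1) by auto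
  define p where "p t = c * exp (\<i> * complex_of_real (2 * pi * t))" for t :: real
  define q where "q x = Arg2pi (x / c) / (2 * pi)" for x
  show ?thesis
  proof (rule image_constant_functions)
    fix x :: complex assume x: "x \<in> sphere 0 1"
    show "constant_at x"
    proof (rule constant_everywhere[of p q])
      show "continuous_on {0..1} p" unfolding p_def by (intro continuous_intros)
      have "\<exists>t\<in>{0..1}. y = p t" if y: "y \<in> sphere 0 1" for y
      proof (intro bexI)
        have "cmod (y / c) = 1" using y c1 by (simp add: norm_divide)
        then have "y / c = exp (\<i> * of_real (Arg2pi (y / c)))" using Arg2pi[of "y / c"] by (simp only: is_Arg_def of_real_1 mult_1_left)
        then show "y = p (q y)" using c1(2) by (simp add: p_def q_def field_simps)
        show "q y \<in> {0..1}" using Arg2pi[of "y / c"] by (simp add: q_def)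
      qed
      moreover have "p t \<in> sphere 0 1" for t using c1 by (simp add: p_def norm_mult)
      ultimately show "p ` {0..1} = sphere 0 1" by blast
      show "constant_at (p 0)" using c(2) by (simp add: p_def)
      have "p 1 = c" using exp_two_pi_i by (simp add: p_def mult_ac)
      then show "constant_at (p 1)" using c(2) by simp
      show "q (p t) = t" if "0 < t" "t < 1" for t
      proof -
        have "Arg2pi (exp (\<i> * complex_of_real (2 * pi * t))) = 2 * pi * t"
          by (rule Arg2pi_unique[of 1]) (use that in auto)
        then show ?thesis using c1(2) by (simp add: p_def q_def)
      qed
      \<comment> \<open>\<open>Arg2pi\<close> can jump only on the nonnegative reals, which
        \<open>x / c\<close> meets only at the excluded constant point \<open>x = c\<close>.\<close>
      show "continuous_on {x \<in> sphere 0 1. \<not> constant_at x} q"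
        unfolding q_def
      proof (intro continuous_on_divide continuous_on_const)
        show "continuous_on {x \<in> sphere 0 1. \<not> constant_at x} (\<lambda>x. Arg2pi (x / c))"
        proof (rule continuous_on_compose2[where g = Arg2pi and t = "- \<real>\<^sub>\<ge>\<^sub>0"])
          show "continuous_on (- \<real>\<^sub>\<ge>\<^sub>0) Arg2pi"
            using continuous_at_Arg2pi by (auto intro: continuous_at_imp_continuous_on)
          show "continuous_on {x \<in> sphere 0 1. \<not> constant_at x} (\<lambda>x. x / c)"
            using c1(2) by (intro continuous_intros) simp
          show "(\<lambda>x. x / c) ` {x \<in> sphere 0 1. \<not> constant_at x} \<subseteq> - \<real>\<^sub>\<ge>\<^sub>0"
          proof (rule image_subsetI, rule ComplI)
            fix y assume y: "y \<in> {x \<in> sphere 0 1. \<not> constant_at x}" and "y / c \<in> \<real>\<^sub>\<ge>\<^sub>0"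
            then obtain s where s: "y / c = of_real s" "0 \<le> s" by (auto elim: nonneg_Reals_cases)
            have "cmod (y / c) = 1" using y c1 by (simp add: norm_divide)
            then have "s = 1" using s by simp
            then have "y = c" using s(1) c1(2) by simp
            then show False using y c(2) by simp
          qed
        qed
      qed auto
    qed (rule x)
  qed
qed

theorem corollary1p4:
  fixes \<Gamma> :: "(complex \<Rightarrow> complex) set"
  assumes "discrete_subgroup \<Gamma>"
    and "compact_surface (disc_quotient \<Gamma>)"
  shows "(\<forall>\<phi> F. action_by_homeos \<Gamma> (sphere (0::complex) 1) \<phi> \<and>
            continuous_map (top_of_set (sphere 0 1)) X0_space F \<and>
            equivariant \<Gamma> (sphere 0 1) \<phi> F \<longrightarrow>
            F ` sphere 0 1 \<subseteq> constant_functions) \<and>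
         (\<forall>\<phi> F. action_by_homeos \<Gamma> {0..1::real} \<phi> \<and>
            continuous_map (top_of_set {0..1}) X0_space F \<and>
            equivariant \<Gamma> {0..1} \<phi> F \<longrightarrow>
            F ` {0..1} \<subseteq> constant_functions)"
proof -
  have sub: "subgroup \<Gamma> hyp_isometries" using assms(1) by (simp add: discrete_subgroup_def)
  have "compact_space (disc_quotient \<Gamma>)" using assms(2) by (simp add: compact_surface_def)
  then obtain r where "0 < r" "r < 1" "\<And>z. z \<in> disc \<Longrightarrow> \<exists>\<gamma>\<in>\<Gamma>. \<gamma> z \<in> cball 0 r"
    using cocompact_imp_ball[OF sub] by blast
  then have "cocompact_lattice \<Gamma> r"
    by (intro cocompact_lattice.intro isometry_group.intro cocompact_lattice_axioms.intro sub
        discrete_imp_finite[OF assms(1)])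
  note lat = equivariant_family.intro[OF this equivariant_family_axioms.intro]
  show ?thesis
    using circle_constant[OF lat] interval_constant[OF lat] by blast
qed

end
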